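(* Let $R$ be a Noetherian ring, $M$ a finitely generated $R$-module, and $I$ an ideal of $R$ with $IM\neq M$. Fix an integer $n>0$. The following are equivalent. (1) $\operatorname{Ext}^i_R(N,M)=0$ for all $i<n$ and every finitely generated $R$-module $N$ with $\operatorname{Supp}(N)\subseteq V(I)$. (2) $\operatorname{Ext}^i_R(R/I,M)=0$ for all $i<n$. (3) There exists a finitely generated $R$-module $N$ with $\operatorname{Supp}(N)=V(I)$ such that $\operatorname{Ext}^i_R(N,M)=0$ for every $i<n$. (4) There exists an $M$-regular sequence $x_1,\dots,x_n$ of length $n$ in $I$.
   Context: Rings are commutative. $V(I)$ is the set of primes containing $I$. A sequence $x_1,\dots,x_n$ in $R$ is $M$-regular if for each $j$ multiplication by $x_j$ is injective on $M/(x_1,\dots,x_{j-1})M$, and $(x_1,\dots,x_n)M\neq M$. *)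

theory Defs
  imports "HOL-Algebra.Algebra"
begin

text \<open>
  The record type of modules extends that of rings. The fields \<open>mult\<close> and \<open>one\<close> play no role for
  modules and are left \<^const>\<open>undefined\<close> in the constructions below.
\<close>

definition regular_module :: "('a, 'r) ring_scheme \<Rightarrow> ('a, 'a) module" where
  "regular_module R =
     \<lparr>carrier = carrier R, monoid.mult = monoid.mult R, one = one R,
      ring.zero = ring.zero R, ring.add = ring.add R, smult = monoid.mult R\<rparr>"

definition zero_module :: "('a, 'm) module \<Rightarrow> bool" where
  "zero_module M \<longleftrightarrow> carrier M = {\<zero>\<^bsub>M\<^esub>}"

definition submodule_span :: "('a, 'r) ring_scheme \<Rightarrow> ('a, 'm) module \<Rightarrow> 'm set \<Rightarrow> 'm set" where
  "submodule_span R M A = \<Inter>{K. submodule K R M \<and> A \<subseteq> K}"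

definition fin_gen_module :: "('a, 'r) ring_scheme \<Rightarrow> ('a, 'm) module \<Rightarrow> bool" where
  "fin_gen_module R M \<longleftrightarrow> module R M \<and>
     (\<exists>A \<subseteq> carrier M. finite A \<and> submodule_span R M A = carrier M)"

definition ideal_smult :: "('a, 'r) ring_scheme \<Rightarrow> 'a set \<Rightarrow> ('a, 'm) module \<Rightarrow> 'm set" where
  "ideal_smult R I M = submodule_span R M {a \<odot>\<^bsub>M\<^esub> m | a m. a \<in> I \<and> m \<in> carrier M}"

definition quot_module :: "('a, 'm) module \<Rightarrow> 'm set \<Rightarrow> ('a, 'm set) module" where
  "quot_module M K =
     \<lparr>carrier = a_rcosets\<^bsub>M\<^esub> K, monoid.mult = undefined, one = undefined,
      ring.zero = K, ring.add = set_add M, smult = (\<lambda>a C. \<Union>x\<in>C. K +>\<^bsub>M\<^esub> (a \<odot>\<^bsub>M\<^esub> x))\<rparr>"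


section \<open>Support\<close>

definition prime_loc_pairs ::
  "('a, 'r) ring_scheme \<Rightarrow> ('a, 'n) module \<Rightarrow> 'a set \<Rightarrow> ('n \<times> 'a) set" where
  "prime_loc_pairs R N P = carrier N \<times> (carrier R - P)"

definition prime_loc_rel ::
  "('a, 'r) ring_scheme \<Rightarrow> ('a, 'n) module \<Rightarrow> 'a set \<Rightarrow> (('n \<times> 'a) \<times> ('n \<times> 'a)) set" where
  "prime_loc_rel R N P =
     {((x, s), (y, t)). (x, s) \<in> prime_loc_pairs R N P \<and> (y, t) \<in> prime_loc_pairs R N P \<and>
        (\<exists>u \<in> carrier R - P. u \<odot>\<^bsub>N\<^esub> (t \<odot>\<^bsub>N\<^esub> x) = u \<odot>\<^bsub>N\<^esub> (s \<odot>\<^bsub>N\<^esub> y))}"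

text \<open>
  The localization of \<open>N\<close> at \<open>P\<close>, whose elements are the classes of the fractions \<open>x / s\<close>. It is
  regarded as an \<open>R\<close>-module only: its vanishing does not depend on the action of the local ring.
\<close>

definition prime_loc_module ::
  "('a, 'r) ring_scheme \<Rightarrow> ('a, 'n) module \<Rightarrow> 'a set \<Rightarrow> ('a, ('n \<times> 'a) set) module" where
  "prime_loc_module R N P =
     \<lparr>carrier = prime_loc_pairs R N P // prime_loc_rel R N P, monoid.mult = undefined, one = undefined,
      ring.zero = prime_loc_rel R N P `` {(\<zero>\<^bsub>N\<^esub>, \<one>\<^bsub>R\<^esub>)},
      ring.add = (\<lambda>C D. \<Union>(x, s)\<in>C. \<Union>(y, t)\<in>D.
               prime_loc_rel R N P `` {(t \<odot>\<^bsub>N\<^esub> x \<oplus>\<^bsub>N\<^esub> s \<odot>\<^bsub>N\<^esub> y, s \<otimes>\<^bsub>R\<^esub> t)}),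
      smult = (\<lambda>a C. \<Union>(x, s)\<in>C. prime_loc_rel R N P `` {(a \<odot>\<^bsub>N\<^esub> x, s)})\<rparr>"

definition Supp :: "('a, 'r) ring_scheme \<Rightarrow> ('a, 'n) module \<Rightarrow> 'a set set" where
  "Supp R N = {P. primeideal P R \<and> \<not> zero_module (prime_loc_module R N P)}"

definition prime_vanishing :: "('a, 'r) ring_scheme \<Rightarrow> 'a set \<Rightarrow> 'a set set" where
  "prime_vanishing R I = {P. primeideal P R \<and> I \<subseteq> P}"


section \<open>Ext\<close>

text \<open>Homomorphisms are extensional, so that each one is a single element of the Hom module.\<close>

definition mod_homs ::
  "('a, 'r) ring_scheme \<Rightarrow> ('a, 'n) module \<Rightarrow> ('a, 'm) module \<Rightarrow> ('n \<Rightarrow> 'm) set" where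
  "mod_homs R N M = {f \<in> carrier N \<rightarrow>\<^sub>E carrier M.
     (\<forall>x \<in> carrier N. \<forall>y \<in> carrier N. f (x \<oplus>\<^bsub>N\<^esub> y) = f x \<oplus>\<^bsub>M\<^esub> f y) \<and>
     (\<forall>a \<in> carrier R. \<forall>x \<in> carrier N. f (a \<odot>\<^bsub>N\<^esub> x) = a \<odot>\<^bsub>M\<^esub> f x)}"

definition hom_module ::
  "('a, 'r) ring_scheme \<Rightarrow> ('a, 'n) module \<Rightarrow> ('a, 'm) module \<Rightarrow> ('a, 'n \<Rightarrow> 'm) module" where
  "hom_module R N M =
     \<lparr>carrier = mod_homs R N M, monoid.mult = undefined, one = undefined,
      ring.zero = (\<lambda>x\<in>carrier N. \<zero>\<^bsub>M\<^esub>),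
      ring.add = (\<lambda>f g. \<lambda>x\<in>carrier N. f x \<oplus>\<^bsub>M\<^esub> g x),
      smult = (\<lambda>a f. \<lambda>x\<in>carrier N. a \<odot>\<^bsub>M\<^esub> f x)\<rparr>"

definition module_basis :: "('a, 'r) ring_scheme \<Rightarrow> ('a, 'm) module \<Rightarrow> 'm set \<Rightarrow> bool" where
  "module_basis R F B \<longleftrightarrow> B \<subseteq> carrier F \<and> submodule_span R F B = carrier F \<and>
     (\<forall>A c. finite A \<and> A \<subseteq> B \<and> c \<in> A \<rightarrow> carrier R \<and>
        (\<Oplus>\<^bsub>F\<^esub>b\<in>A. c b \<odot>\<^bsub>F\<^esub> b) = \<zero>\<^bsub>F\<^esub> \<longrightarrow> (\<forall>b\<in>A. c b = \<zero>\<^bsub>R\<^esub>))"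

definition free_module :: "('a, 'r) ring_scheme \<Rightarrow> ('a, 'm) module \<Rightarrow> bool" where
  "free_module R F \<longleftrightarrow> module R F \<and> (\<exists>B. module_basis R F B)"

text \<open>
  An exact sequence \<open>\<dots> \<rightarrow> F 2 \<rightarrow> F 1 \<rightarrow> F 0 \<rightarrow> N \<rightarrow> 0\<close> with all \<open>F i\<close> free, where \<open>d i\<close> is the map
  from \<open>F (i + 1)\<close> to \<open>F i\<close> and \<open>e\<close> is the augmentation.
\<close>

definition free_resolution ::
  "('a, 'r) ring_scheme \<Rightarrow> (nat \<Rightarrow> ('a, 'p) module) \<Rightarrow> (nat \<Rightarrow> 'p \<Rightarrow> 'p) \<Rightarrow> ('p \<Rightarrow> 'n)
     \<Rightarrow> ('a, 'n) module \<Rightarrow> bool" where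
  "free_resolution R F d e N \<longleftrightarrow>
     (\<forall>i. free_module R (F i)) \<and>
     (\<forall>i. d i \<in> mod_homs R (F (Suc i)) (F i)) \<and>
     e \<in> mod_homs R (F 0) N \<and>
     e ` carrier (F 0) = carrier N \<and>
     d 0 ` carrier (F 1) = {x \<in> carrier (F 0). e x = \<zero>\<^bsub>N\<^esub>} \<and>
     (\<forall>i. d (Suc i) ` carrier (F (Suc (Suc i))) = {x \<in> carrier (F (Suc i)). d i x = \<zero>\<^bsub>F i\<^esub>})"

text \<open>The cochain complex \<open>Hom(F i, M)\<close>, starting in degree 0, and its cohomology.\<close>

definition cocycles ::
  "('a, 'r) ring_scheme \<Rightarrow> (nat \<Rightarrow> ('a, 'p) module) \<Rightarrow> (nat \<Rightarrow> 'p \<Rightarrow> 'p) \<Rightarrow> ('a, 'm) module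
     \<Rightarrow> nat \<Rightarrow> ('p \<Rightarrow> 'm) set" where
  "cocycles R F d M i = {f \<in> mod_homs R (F i) M.
     compose (carrier (F (Suc i))) f (d i) = \<zero>\<^bsub>hom_module R (F (Suc i)) M\<^esub>}"

fun coboundaries ::
  "('a, 'r) ring_scheme \<Rightarrow> (nat \<Rightarrow> ('a, 'p) module) \<Rightarrow> (nat \<Rightarrow> 'p \<Rightarrow> 'p) \<Rightarrow> ('a, 'm) module
     \<Rightarrow> nat \<Rightarrow> ('p \<Rightarrow> 'm) set" where
  "coboundaries R F d M 0 = {\<zero>\<^bsub>hom_module R (F 0) M\<^esub>}"
| "coboundaries R F d M (Suc i) =
     (\<lambda>g. compose (carrier (F (Suc i))) g (d i)) ` mod_homs R (F i) M"

definition hom_cohomology ::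
  "('a, 'r) ring_scheme \<Rightarrow> (nat \<Rightarrow> ('a, 'p) module) \<Rightarrow> (nat \<Rightarrow> 'p \<Rightarrow> 'p) \<Rightarrow> ('a, 'm) module
     \<Rightarrow> nat \<Rightarrow> ('a, ('p \<Rightarrow> 'm) set) module" where
  "hom_cohomology R F d M i =
     quot_module ((hom_module R (F i) M)\<lparr>carrier := cocycles R F d M i\<rparr>) (coboundaries R F d M i)"

text \<open>
  Ext is computed from a chosen free resolution of its first argument. The element type
  \<open>('a + 'n) list\<close> is infinite and contains copies of \<open>'a\<close> and \<open>'n\<close>; so there are at most as many
  finite \<open>R\<close>-linear combinations of its elements as it has elements, and every \<open>R\<close>-module \<open>N\<close> has a
  free resolution by modules over this type.
\<close>

definition chosen_resolution ::
  "('a, 'r) ring_scheme \<Rightarrow> ('a, 'n) module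
     \<Rightarrow> (nat \<Rightarrow> ('a, ('a + 'n) list) module) \<times> (nat \<Rightarrow> ('a + 'n) list \<Rightarrow> ('a + 'n) list)" where
  "chosen_resolution R N = (SOME (F, d). \<exists>e. free_resolution R F d e N)"

definition Ext ::
  "('a, 'r) ring_scheme \<Rightarrow> nat \<Rightarrow> ('a, 'n) module \<Rightarrow> ('a, 'm) module
     \<Rightarrow> ('a, (('a + 'n) list \<Rightarrow> 'm) set) module" where
  "Ext R i N M = (case chosen_resolution R N of (F, d) \<Rightarrow> hom_cohomology R F d M i)"


section \<open>Regular sequences\<close>

definition regular_sequence :: "('a, 'r) ring_scheme \<Rightarrow> ('a, 'm) module \<Rightarrow> 'a list \<Rightarrow> bool" where
  "regular_sequence R M xs \<longleftrightarrow> set xs \<subseteq> carrier R \<and>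
     (\<forall>j < length xs.
        let Q = quot_module M (ideal_smult R (Idl\<^bsub>R\<^esub> (set (take j xs))) M)
        in inj_on (\<lambda>m. (xs ! j) \<odot>\<^bsub>Q\<^esub> m) (carrier Q)) \<and>
     ideal_smult R (Idl\<^bsub>R\<^esub> (set xs)) M \<noteq> carrier M"


section \<open>Quantification over finitely generated modules\<close>

text \<open>
  HOL has no quantifier over all modules of all types. A finitely generated \<open>R\<close>-module is isomorphic
  to a quotient of some \<open>R^k\<close>. With the elements of \<open>R^k\<close> represented by lists of length \<open>k\<close>, the
  carrier of the quotient consists of sets of lists, so modules over the following type represent
  all finitely generated modules up to isomorphism.
\<close>

type_synonym 'a fg_module = "('a, 'a list set) module"

end

(* Ext is computed from a free resolution F of N. A linear map from a free module to M/K lifts to M,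
   so the cohomology of Hom(F, M/K) can be described by maps into M modulo the submodule K; the
   induction on the regular sequence then runs over submodules K of the fixed module M.

   If x is a nonzerodivisor on M/K, the long exact sequence of multiplication by x relates the
   vanishing for K and for K + xM. From Ext to sequences: were every element of I a zero divisor on
   M/K, Kaplansky's argument and prime avoidance would give an associated prime P = (K : m) containing
   I, so P lies in Supp N, and there would be a nonzero map N -> R/P -> M/K. From sequences to Ext:
   as Supp N is contained in V(I), a power of x in I kills N, hence (by a homotopy) kills the
   cohomology, on which multiplication by x is injective by induction. *)

theory Submission
  imports Defs
begin

section \<open>Submodules and spans\<close>

text \<open>The obstacle is one of types. The elements of \<open>M/xM\<close> are sets of elements
  of \<open>M\<close>, so an induction that really passed to quotients would change the type of the
  coefficients at every step. This is why notions such as nonzerodivisor and annihilator are phrased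
  inside \<open>M\<close> relative to a submodule. Passing from \<open>K\<close> to
  \<open>K + xM\<close> is worth one cohomological degree, which accounts for the bounds
  \<open>i + j < length xs\<close> and \<open>i + j < n\<close> near the end. Localizations are
  unfolded in the same spirit: a statement about \<open>N\<close> at a prime \<open>P\<close> is
  expressed by multipliers outside \<open>P\<close>. The classical route to a nonzero map
  \<open>N -> R/P\<close> applies Nakayama's lemma at \<open>P\<close>; here its place is taken by a
  generating set that is smallest up to such a multiplier. \<open>Ext\<close> rests on a
  \<open>SOME\<close>, about which nothing is known until a resolution exists inside the prescribed
  element type. For finitely generated \<open>N\<close> over a Noetherian ring every term can be
  taken of finite rank, with lists of fixed length as vectors.\<close>

lemma (in cring) ideal_memI:
  assumes "J \<subseteq> carrier R" "\<zero> \<in> J" "\<And>r s. r \<in> J \<Longrightarrow> s \<in> J \<Longrightarrow> r \<oplus> s \<in> J"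
    "\<And>r s. r \<in> carrier R \<Longrightarrow> s \<in> J \<Longrightarrow> r \<otimes> s \<in> J"
  shows "ideal J R"
proof (rule idealI)
  show "ring R" ..
  show "subgroup J (add_monoid R)"
  proof (rule add.subgroupI)
    show "J \<subseteq> carrier R" "J \<noteq> {}" using assms by auto
    fix a assume a: "a \<in> J"
    have "\<ominus> \<one> \<otimes> a \<in> J" using a assms(4) by blast
    then show "\<ominus> a \<in> J" using a assms(1) by (simp add: l_minus subsetD)
  qed (use assms in auto)
  show "\<And>a x. a \<in> J \<Longrightarrow> x \<in> carrier R \<Longrightarrow> x \<otimes> a \<in> J" using assms by blast
  then show "\<And>a x. a \<in> J \<Longrightarrow> x \<in> carrier R \<Longrightarrow> a \<otimes> x \<in> J" using assms(1) m_comm by (metis subsetD)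
qed

lemma (in ring) ideal_memD:
  assumes "ideal J R"
  shows "\<And>x. x \<in> J \<Longrightarrow> x \<in> carrier R" "\<zero> \<in> J" "\<And>r s. r \<in> J \<Longrightarrow> s \<in> J \<Longrightarrow> r \<oplus> s \<in> J"
    "\<And>r s. r \<in> carrier R \<Longrightarrow> s \<in> J \<Longrightarrow> r \<otimes> s \<in> J" "\<And>r s. r \<in> carrier R \<Longrightarrow> s \<in> J \<Longrightarrow> s \<otimes> r \<in> J"
    "\<And>r. r \<in> J \<Longrightarrow> \<ominus> r \<in> J"
proof -
  interpret J: ideal J R by fact
  show "\<And>x. x \<in> J \<Longrightarrow> x \<in> carrier R" "\<zero> \<in> J" "\<And>r s. r \<in> J \<Longrightarrow> s \<in> J \<Longrightarrow> r \<oplus> s \<in> J"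
    "\<And>r s. r \<in> carrier R \<Longrightarrow> s \<in> J \<Longrightarrow> r \<otimes> s \<in> J" "\<And>r s. r \<in> carrier R \<Longrightarrow> s \<in> J \<Longrightarrow> s \<otimes> r \<in> J"
    "\<And>r. r \<in> J \<Longrightarrow> \<ominus> r \<in> J"
    using J.I_l_closed J.I_r_closed by auto
qed

text \<open>The locale \<open>module\<close> admits extensions of the module record, while
  \<open>submodule_span\<close>, \<open>quot_module\<close> and the other notions are defined for
  the plain record; the type is fixed accordingly.\<close>

locale plain_module = module R M
  for R :: "('a, 'r) ring_scheme" (structure) and M :: "('a, 'm) module" (structure)
begin

lemma submodule_memI:
  assumes "H \<subseteq> carrier M" "\<zero>\<^bsub>M\<^esub> \<in> H"
    and "\<And>a b. \<lbrakk>a \<in> H; b \<in> H\<rbrakk> \<Longrightarrow> a \<oplus>\<^bsub>M\<^esub> b \<in> H"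
    and "\<And>a x. \<lbrakk>a \<in> carrier R; x \<in> H\<rbrakk> \<Longrightarrow> a \<odot>\<^bsub>M\<^esub> x \<in> H"
  shows "submodule H R M"
proof (rule submoduleI)
  fix a assume "a \<in> H"
  then have "(\<ominus> \<one>) \<odot>\<^bsub>M\<^esub> a \<in> H" "a \<in> carrier M" using assms(1,4) by auto
  then show "\<ominus>\<^bsub>M\<^esub> a \<in> H" by (simp add: smult_l_minus)
qed (use assms in auto)

lemma submodule_memD:
  assumes "submodule H R M"
  shows "\<And>x. x \<in> H \<Longrightarrow> x \<in> carrier M" "\<zero>\<^bsub>M\<^esub> \<in> H"
    "\<And>a b. \<lbrakk>a \<in> H; b \<in> H\<rbrakk> \<Longrightarrow> a \<oplus>\<^bsub>M\<^esub> b \<in> H"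
    "\<And>a x. \<lbrakk>a \<in> carrier R; x \<in> H\<rbrakk> \<Longrightarrow> a \<odot>\<^bsub>M\<^esub> x \<in> H"
    "\<And>a. a \<in> H \<Longrightarrow> \<ominus>\<^bsub>M\<^esub> a \<in> H"
proof -
  show z: "\<zero>\<^bsub>M\<^esub> \<in> H"
    using submoduleE(2,1,4)[OF assms] smult_l_null
    by (metis R.zero_closed equals0I subsetD)
qed (use submoduleE[OF assms] in auto)

lemma submodule_add_cancel:
  assumes "submodule H R M" "a \<in> carrier M" "b \<in> H" "a \<oplus>\<^bsub>M\<^esub> b \<in> H"
  shows "a \<in> H"
proof -
  note D = submodule_memD[OF assms(1)]
  have "(a \<oplus>\<^bsub>M\<^esub> b) \<oplus>\<^bsub>M\<^esub> \<ominus>\<^bsub>M\<^esub> b \<in> H" using D assms by blast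
  moreover have "(a \<oplus>\<^bsub>M\<^esub> b) \<oplus>\<^bsub>M\<^esub> \<ominus>\<^bsub>M\<^esub> b = a" using assms D(1)[of b] by (simp add: M.a_assoc M.r_neg)
  ultimately show ?thesis by simp
qed

lemma smult_add_neg:
  assumes "a \<in> carrier R" "m \<in> carrier M"
  shows "a \<odot>\<^bsub>M\<^esub> m \<oplus>\<^bsub>M\<^esub> (\<ominus> a) \<odot>\<^bsub>M\<^esub> m = \<zero>\<^bsub>M\<^esub>"
    using assms by (simp add: smult_l_minus M.r_neg)

lemma submodule_zero: "submodule {\<zero>\<^bsub>M\<^esub>} R M"
  by (rule submodule_memI) auto

lemma submodule_Inter:
  assumes "\<And>K. K \<in> S \<Longrightarrow> submodule K R M" "S \<noteq> {}"
  shows "submodule (\<Inter>S) R M"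
proof (rule submodule_memI)
  show "\<Inter>S \<subseteq> carrier M" using assms submodule_memD(1) by blast
  show "\<zero>\<^bsub>M\<^esub> \<in> \<Inter>S" using assms(1) submodule_memD(2) by blast
next
  fix a b assume "a \<in> \<Inter>S" "b \<in> \<Inter>S"
  then show "a \<oplus>\<^bsub>M\<^esub> b \<in> \<Inter>S" by (auto intro: submodule_memD(3)[OF assms(1)])
next
  fix r a assume "r \<in> carrier R" "a \<in> \<Inter>S"
  then show "r \<odot>\<^bsub>M\<^esub> a \<in> \<Inter>S" by (auto intro: submodule_memD(4)[OF assms(1)])
qed

lemma submodule_Int:
  assumes "submodule H R M" "submodule K R M"
  shows "submodule (H \<inter> K) R M"
  using submodule_Inter[of "{H, K}"] assms by auto

lemma span_submodule: "A \<subseteq> carrier M \<Longrightarrow> submodule (submodule_span R M A) R M"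
  unfolding submodule_span_def
  using carrier_is_submodule by (intro submodule_Inter) auto

lemma span_incl: "A \<subseteq> submodule_span R M A"
  unfolding submodule_span_def by auto

lemma span_minimal: "submodule K R M \<Longrightarrow> A \<subseteq> K \<Longrightarrow> submodule_span R M A \<subseteq> K"
  unfolding submodule_span_def by auto

lemma span_closed: "A \<subseteq> carrier M \<Longrightarrow> submodule_span R M A \<subseteq> carrier M"
  using carrier_is_submodule span_minimal by auto

lemma span_mono: "A \<subseteq> B \<Longrightarrow> submodule_span R M A \<subseteq> submodule_span R M B"
  unfolding submodule_span_def by auto

lemma span_empty: "submodule_span R M {} = {\<zero>\<^bsub>M\<^esub>}"
  using span_minimal[OF submodule_zero, of "{}"] submodule_memD(2)[OF span_submodule[of "{}"]] by auto

lemma submodule_plus_smults: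
  assumes "submodule K R M" "J \<subseteq> carrier R" "\<zero> \<in> J"
    "\<And>r s. r \<in> J \<Longrightarrow> s \<in> J \<Longrightarrow> r \<oplus> s \<in> J" "\<And>r s. r \<in> carrier R \<Longrightarrow> s \<in> J \<Longrightarrow> r \<otimes> s \<in> J"
    "m \<in> carrier M"
  shows "submodule {r \<odot>\<^bsub>M\<^esub> m \<oplus>\<^bsub>M\<^esub> k | r k. r \<in> J \<and> k \<in> K} R M" (is "submodule ?H R M")
proof (rule submodule_memI)
  note D = submodule_memD[OF assms(1)]
  have J: "\<And>r. r \<in> J \<Longrightarrow> r \<in> carrier R" using assms(2) by auto
  show "?H \<subseteq> carrier M" using D(1) J assms(6) by auto
  have "\<zero>\<^bsub>M\<^esub> = \<zero> \<odot>\<^bsub>M\<^esub> m \<oplus>\<^bsub>M\<^esub> \<zero>\<^bsub>M\<^esub>" using assms(6) by simp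
  then show "\<zero>\<^bsub>M\<^esub> \<in> ?H" using D(2) assms(3) by blast
  fix a b assume "a \<in> ?H" "b \<in> ?H"
  then obtain r k s l where *: "a = r \<odot>\<^bsub>M\<^esub> m \<oplus>\<^bsub>M\<^esub> k" "b = s \<odot>\<^bsub>M\<^esub> m \<oplus>\<^bsub>M\<^esub> l" "r \<in> J" "s \<in> J" "k \<in> K" "l \<in> K" by auto
  then have "a \<oplus>\<^bsub>M\<^esub> b = (r \<oplus> s) \<odot>\<^bsub>M\<^esub> m \<oplus>\<^bsub>M\<^esub> (k \<oplus>\<^bsub>M\<^esub> l)"
    using D(1) J assms(6) by (simp add: smult_l_distr M.a_ac)
  then show "a \<oplus>\<^bsub>M\<^esub> b \<in> ?H" using * D(3) assms(4) by blast
next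
  note D = submodule_memD[OF assms(1)]
  have J: "\<And>r. r \<in> J \<Longrightarrow> r \<in> carrier R" using assms(2) by auto
  fix c a assume c: "c \<in> carrier R" and "a \<in> ?H"
  then obtain r k where *: "a = r \<odot>\<^bsub>M\<^esub> m \<oplus>\<^bsub>M\<^esub> k" "r \<in> J" "k \<in> K" by auto
  then have "c \<odot>\<^bsub>M\<^esub> a = (c \<otimes> r) \<odot>\<^bsub>M\<^esub> m \<oplus>\<^bsub>M\<^esub> c \<odot>\<^bsub>M\<^esub> k"
    using D(1) J assms(6) c by (simp add: smult_r_distr smult_assoc1)
  then show "c \<odot>\<^bsub>M\<^esub> a \<in> ?H" using * c D(4) assms(5) by blast
qed

lemma submodule_plus_cyclic:
  assumes "submodule K R M" "m \<in> carrier M"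
  shows "submodule {r \<odot>\<^bsub>M\<^esub> m \<oplus>\<^bsub>M\<^esub> k | r k. r \<in> carrier R \<and> k \<in> K} R M"
  using assms by (intro submodule_plus_smults) auto

text \<open>Splits off one generator. This drives the induction on generators for submodules of
  Noetherian modules and supplies the coordinate along \<open>y0\<close> in
  \<open>relative_coordinate\<close>.\<close>

lemma span_insert:
  assumes "a \<in> carrier M" "A \<subseteq> carrier M"
  shows "submodule_span R M (insert a A) = {r \<odot>\<^bsub>M\<^esub> a \<oplus>\<^bsub>M\<^esub> k | r k. r \<in> carrier R \<and> k \<in> submodule_span R M A}"
    (is "_ = ?H")
proof
  note D = submodule_memD[OF span_submodule[OF assms(2)]]
  have "a = \<one> \<odot>\<^bsub>M\<^esub> a \<oplus>\<^bsub>M\<^esub> \<zero>\<^bsub>M\<^esub>" using assms by simp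
  then have "a \<in> ?H" using D(2) by blast
  moreover have "A \<subseteq> ?H"
  proof
    fix b assume b: "b \<in> A"
    then have "b = \<zero> \<odot>\<^bsub>M\<^esub> a \<oplus>\<^bsub>M\<^esub> b" using assms by (simp add: subsetD)
    then show "b \<in> ?H" using b span_incl by blast
  qed
  ultimately show "submodule_span R M (insert a A) \<subseteq> ?H"
    using span_submodule assms by (intro span_minimal submodule_plus_cyclic) auto
  have *: "insert a A \<subseteq> carrier M" using assms by auto
  note E = submodule_memD[OF span_submodule[OF *]]
  show "?H \<subseteq> submodule_span R M (insert a A)"
    using E(3,4) span_incl[of "insert a A"] span_mono[of A "insert a A"] by blast
qed

text \<open>The spans of the finite subsets of \<open>A\<close> form a directed family, so their
  union is a submodule, and it contains \<open>A\<close>.\<close>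

lemma span_finite_subset:
  assumes "A \<subseteq> carrier M" "z \<in> submodule_span R M A"
  shows "\<exists>B\<subseteq>A. finite B \<and> z \<in> submodule_span R M B"
proof -
  let ?H = "\<Union>B\<in>{B. B \<subseteq> A \<and> finite B}. submodule_span R M B"
  have "submodule ?H R M"
  proof (rule submodule_memI)
    show "?H \<subseteq> carrier M" using span_closed assms by blast
    show "\<zero>\<^bsub>M\<^esub> \<in> ?H" using span_empty by (intro UN_I[of "{}"]) auto
  next
    fix a b assume "a \<in> ?H" "b \<in> ?H"
    then obtain B C where *: "B \<subseteq> A" "finite B" "a \<in> submodule_span R M B" "C \<subseteq> A" "finite C" "b \<in> submodule_span R M C"
      by auto
    then have "a \<in> submodule_span R M (B \<union> C)" "b \<in> submodule_span R M (B \<union> C)"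
      using span_mono[of B "B \<union> C"] span_mono[of C "B \<union> C"] by auto
    moreover have "submodule (submodule_span R M (B \<union> C)) R M" using * assms by (intro span_submodule) auto
    ultimately have "a \<oplus>\<^bsub>M\<^esub> b \<in> submodule_span R M (B \<union> C)" using submodule_memD(3) by blast
    then show "a \<oplus>\<^bsub>M\<^esub> b \<in> ?H" using * by (intro UN_I[of "B \<union> C"]) auto
  next
    fix r a assume r: "r \<in> carrier R" and "a \<in> ?H"
    then obtain B where *: "B \<subseteq> A" "finite B" "a \<in> submodule_span R M B" by auto
    then have "submodule (submodule_span R M B) R M" using assms by (intro span_submodule) auto
    then have "r \<odot>\<^bsub>M\<^esub> a \<in> submodule_span R M B" using r * submodule_memD(4) by simp
    then show "r \<odot>\<^bsub>M\<^esub> a \<in> ?H" using * by blast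
  qed
  moreover have "A \<subseteq> ?H"
  proof
    fix a assume "a \<in> A"
    then show "a \<in> ?H" using span_incl[of "{a}"] by (intro UN_I[of "{a}"]) auto
  qed
  ultimately have "submodule_span R M A \<subseteq> ?H" by (rule span_minimal)
  then show ?thesis using assms(2) by auto
qed

text \<open>Each element of \<open>B\<close> needs only finitely many elements of \<open>A\<close>.
  The gain is that the new generators are members of \<open>A\<close>; later \<open>A\<close>
  consists of the elements with a maximal annihilator, and arbitrary generators would lose that
  property.\<close>

lemma span_subset_of_finite:
  assumes "A \<subseteq> carrier M" "finite B" "submodule_span R M B = submodule_span R M A"
  shows "\<exists>C\<subseteq>A. finite C \<and> submodule_span R M C = submodule_span R M A"
proof -
  have "\<forall>b\<in>B. \<exists>C\<subseteq>A. finite C \<and> b \<in> submodule_span R M C"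
    using span_finite_subset[OF assms(1)] assms(3) span_incl[of B] by blast
  then obtain C where C: "\<And>b. b \<in> B \<Longrightarrow> C b \<subseteq> A \<and> finite (C b) \<and> b \<in> submodule_span R M (C b)"
    by metis
  let ?C = "\<Union>b\<in>B. C b"
  have sub: "?C \<subseteq> A" using C by auto
  have "B \<subseteq> submodule_span R M ?C"
    using C span_mono[of _ ?C] by blast
  then have "submodule_span R M B \<subseteq> submodule_span R M ?C"
    using sub assms(1) by (intro span_minimal span_submodule) auto
  then have "submodule_span R M ?C = submodule_span R M A" using assms(3) span_mono[OF sub] by auto
  moreover have "finite ?C" using C assms(2) by auto
  ultimately show ?thesis using sub by blast
qed

text \<open>This is the ideal of leading coefficients: those \<open>r\<close> that occur in front of
  \<open>a\<close> in some element of \<open>K\<close>, with tails taken from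
  \<open>S\<close>.\<close>

lemma ideal_relative_colon:
  assumes "submodule S R M" "submodule K R M" "a \<in> carrier M"
  shows "ideal {r \<in> carrier R. \<exists>k\<in>S. r \<odot>\<^bsub>M\<^esub> a \<oplus>\<^bsub>M\<^esub> k \<in> K} R" (is "ideal ?J R")
proof (rule ideal_memI)
  note S = submodule_memD[OF assms(1)] and D = submodule_memD[OF assms(2)] and a = assms(3)
  have "\<zero> \<odot>\<^bsub>M\<^esub> a \<oplus>\<^bsub>M\<^esub> \<zero>\<^bsub>M\<^esub> \<in> K" using a D by simp
  then show "\<zero> \<in> ?J" using S(2) by blast
  fix r s assume "r \<in> ?J" "s \<in> ?J"
  then obtain k l where *: "r \<in> carrier R" "s \<in> carrier R" "k \<in> S" "l \<in> S"
    "r \<odot>\<^bsub>M\<^esub> a \<oplus>\<^bsub>M\<^esub> k \<in> K" "s \<odot>\<^bsub>M\<^esub> a \<oplus>\<^bsub>M\<^esub> l \<in> K" by auto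
  then have "(r \<odot>\<^bsub>M\<^esub> a \<oplus>\<^bsub>M\<^esub> k) \<oplus>\<^bsub>M\<^esub> (s \<odot>\<^bsub>M\<^esub> a \<oplus>\<^bsub>M\<^esub> l) = (r \<oplus> s) \<odot>\<^bsub>M\<^esub> a \<oplus>\<^bsub>M\<^esub> (k \<oplus>\<^bsub>M\<^esub> l)"
    using a S(1) by (simp add: smult_l_distr M.a_ac)
  then have "(r \<oplus> s) \<odot>\<^bsub>M\<^esub> a \<oplus>\<^bsub>M\<^esub> (k \<oplus>\<^bsub>M\<^esub> l) \<in> K" using D(3)[OF *(5,6)] by simp
  then show "r \<oplus> s \<in> ?J" using * S(3) by auto
next
  note S = submodule_memD[OF assms(1)] and D = submodule_memD[OF assms(2)] and a = assms(3)
  fix r s assume "r \<in> carrier R" "s \<in> ?J"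
  then obtain l where *: "r \<in> carrier R" "s \<in> carrier R" "l \<in> S"
    "s \<odot>\<^bsub>M\<^esub> a \<oplus>\<^bsub>M\<^esub> l \<in> K" by auto
  then have "r \<odot>\<^bsub>M\<^esub> (s \<odot>\<^bsub>M\<^esub> a \<oplus>\<^bsub>M\<^esub> l) = (r \<otimes> s) \<odot>\<^bsub>M\<^esub> a \<oplus>\<^bsub>M\<^esub> r \<odot>\<^bsub>M\<^esub> l"
    using a S(1) by (simp add: smult_r_distr smult_assoc1)
  then have "(r \<otimes> s) \<odot>\<^bsub>M\<^esub> a \<oplus>\<^bsub>M\<^esub> r \<odot>\<^bsub>M\<^esub> l \<in> K" using D(4)[OF *(1,4)] by simp
  then show "r \<otimes> s \<in> ?J" using * S(4) by auto
qed auto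

end

section \<open>Submodules of finitely generated modules over a Noetherian ring\<close>

locale noetherian_module = plain_module R M + noetherian_ring R
  for R :: "('a, 'r) ring_scheme" (structure) and M :: "('a, 'm) module" (structure)
begin

text \<open>Leading coefficients, as in Hilbert's basis theorem: the coefficients at
  \<open>a\<close> of the elements of \<open>K\<close> form a finitely generated ideal. Lifts of its
  generators to \<open>K\<close>, together with generators of the part of \<open>K\<close> inside
  the span of the remaining elements, generate \<open>K\<close>.\<close>

lemma submodule_of_finite_span_fin_gen:
  assumes "finite A" "A \<subseteq> carrier M" "submodule K R M" "K \<subseteq> submodule_span R M A"
  shows "\<exists>B\<subseteq>K. finite B \<and> submodule_span R M B = K"
  using assms
proof (induction A arbitrary: K rule: finite_induct)
  case empty
  then have "submodule_span R M {} = K" using span_empty submodule_memD(2)[OF empty(2)] by auto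
  then show ?case by blast
next
  case (insert a A)
  have a: "a \<in> carrier M" and A: "A \<subseteq> carrier M" using insert by auto
  note D = submodule_memD[OF \<open>submodule K R M\<close>]
  note S = submodule_memD[OF span_submodule[OF A]]
  let ?J = "{r \<in> carrier R. \<exists>k\<in>submodule_span R M A. r \<odot>\<^bsub>M\<^esub> a \<oplus>\<^bsub>M\<^esub> k \<in> K}"
  have "ideal ?J R" using span_submodule[OF A] insert(5) a by (rule ideal_relative_colon)
  then obtain C where C: "C \<subseteq> carrier R" "finite C" "?J = Idl C" using finetely_gen by meson
  have CJ: "C \<subseteq> ?J" using C R.genideal_self by auto
  then have "\<forall>c\<in>C. \<exists>k\<in>submodule_span R M A. c \<odot>\<^bsub>M\<^esub> a \<oplus>\<^bsub>M\<^esub> k \<in> K" by blast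
  \<comment> \<open>A tail \<open>g c\<close> completes each generating coefficient \<open>c\<close>
    to an element of \<open>K\<close>.\<close>
  then obtain g where g: "\<And>c. c \<in> C \<Longrightarrow> g c \<in> submodule_span R M A \<and> c \<odot>\<^bsub>M\<^esub> a \<oplus>\<^bsub>M\<^esub> g c \<in> K" by metis
  have "submodule (K \<inter> submodule_span R M A) R M" using insert span_submodule[OF A] by (intro submodule_Int) auto
  then obtain B where B: "B \<subseteq> K \<inter> submodule_span R M A" "finite B" "submodule_span R M B = K \<inter> submodule_span R M A"
    using insert.IH[of "K \<inter> submodule_span R M A"] A by blast
  let ?G = "B \<union> (\<lambda>c. c \<odot>\<^bsub>M\<^esub> a \<oplus>\<^bsub>M\<^esub> g c) ` C"
  have GK: "?G \<subseteq> K" using B g by auto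
  then have GM: "?G \<subseteq> carrier M" using D(1) by blast
  note E = submodule_memD[OF span_submodule[OF GM]]
  \<comment> \<open>Every leading coefficient of \<open>K\<close> already occurs in the span of the
    chosen elements: the coefficients that do form an ideal, and it contains the generators
    \<open>C\<close>.\<close>
  have "?J \<subseteq> {r \<in> carrier R. \<exists>k\<in>submodule_span R M A. r \<odot>\<^bsub>M\<^esub> a \<oplus>\<^bsub>M\<^esub> k \<in> submodule_span R M ?G}" (is "_ \<subseteq> ?L")
  proof -
    have "ideal ?L R" using span_submodule[OF A] span_submodule[OF GM] a by (rule ideal_relative_colon)
    moreover have "C \<subseteq> ?L"
    proof
      fix c assume c: "c \<in> C"
      then have "c \<odot>\<^bsub>M\<^esub> a \<oplus>\<^bsub>M\<^esub> g c \<in> ?G" by blast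
      then have "c \<odot>\<^bsub>M\<^esub> a \<oplus>\<^bsub>M\<^esub> g c \<in> submodule_span R M ?G" by (rule subsetD[OF span_incl])
      then show "c \<in> ?L" using c g C(1) by blast
    qed
    ultimately have "Idl C \<subseteq> ?L" by (rule R.genideal_minimal)
    then show ?thesis using C(3) by simp
  qed
  note JL = this
  have "K \<subseteq> submodule_span R M ?G"
  proof
    fix z assume z: "z \<in> K"
    then have "z \<in> submodule_span R M (insert a A)" using insert by auto
    then obtain r w where w: "r \<in> carrier R" "w \<in> submodule_span R M A" "z = r \<odot>\<^bsub>M\<^esub> a \<oplus>\<^bsub>M\<^esub> w"
      using span_insert[OF a A] by auto
    then have "r \<in> ?L" using JL z by blast
    then obtain k where k: "k \<in> submodule_span R M A" "r \<odot>\<^bsub>M\<^esub> a \<oplus>\<^bsub>M\<^esub> k \<in> submodule_span R M ?G" by auto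
    have GsubK: "submodule_span R M ?G \<subseteq> K" using span_minimal GK insert by blast
    have k': "k \<in> carrier M" "w \<in> carrier M" "r \<odot>\<^bsub>M\<^esub> a \<in> carrier M" using S(1) k w a by auto
    \<comment> \<open>Subtracting an element with the same leading coefficient cancels the multiple
      of \<open>a\<close>, so the remainder lies both in \<open>K\<close> and in the span of
      \<open>A\<close>.\<close>
    have eq: "z \<oplus>\<^bsub>M\<^esub> \<ominus>\<^bsub>M\<^esub> (r \<odot>\<^bsub>M\<^esub> a \<oplus>\<^bsub>M\<^esub> k) = w \<oplus>\<^bsub>M\<^esub> \<ominus>\<^bsub>M\<^esub> k"
    proof -
      have "z \<oplus>\<^bsub>M\<^esub> \<ominus>\<^bsub>M\<^esub> (r \<odot>\<^bsub>M\<^esub> a \<oplus>\<^bsub>M\<^esub> k) = (r \<odot>\<^bsub>M\<^esub> a \<oplus>\<^bsub>M\<^esub> \<ominus>\<^bsub>M\<^esub> (r \<odot>\<^bsub>M\<^esub> a)) \<oplus>\<^bsub>M\<^esub> (w \<oplus>\<^bsub>M\<^esub> \<ominus>\<^bsub>M\<^esub> k)"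
        using k' w(3) by (simp add: M.minus_add M.a_ac)
      then show ?thesis using k' by (simp add: M.r_neg)
    qed
    have "z \<oplus>\<^bsub>M\<^esub> \<ominus>\<^bsub>M\<^esub> (r \<odot>\<^bsub>M\<^esub> a \<oplus>\<^bsub>M\<^esub> k) \<in> K" using z subsetD[OF GsubK k(2)] D(3)[OF z D(5)] by blast
    moreover have "w \<oplus>\<^bsub>M\<^esub> \<ominus>\<^bsub>M\<^esub> k \<in> submodule_span R M A" using S(3)[OF w(2) S(5)[OF k(1)]] .
    ultimately have "z \<oplus>\<^bsub>M\<^esub> \<ominus>\<^bsub>M\<^esub> (r \<odot>\<^bsub>M\<^esub> a \<oplus>\<^bsub>M\<^esub> k) \<in> submodule_span R M B" using B(3) eq by auto
    then have "z \<oplus>\<^bsub>M\<^esub> \<ominus>\<^bsub>M\<^esub> (r \<odot>\<^bsub>M\<^esub> a \<oplus>\<^bsub>M\<^esub> k) \<in> submodule_span R M ?G" using span_mono[OF Un_upper1, of B] by (rule subsetD[rotated])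
    then show "z \<in> submodule_span R M ?G"
      using submodule_add_cancel[OF span_submodule[OF GM] D(1)[OF z] E(5)[OF k(2)]] by simp
  qed
  then have "submodule_span R M ?G = K" using span_minimal GK insert(5) by blast
  moreover have "finite ?G" using B C by auto
  ultimately show ?case using GK by blast
qed

lemma submodule_fin_gen:
  assumes "fin_gen_module R M" "submodule K R M"
  shows "\<exists>B\<subseteq>K. finite B \<and> submodule_span R M B = K"
proof -
  obtain A where "A \<subseteq> carrier M" "finite A" "submodule_span R M A = carrier M"
    using assms(1) unfolding fin_gen_module_def by auto
  then show ?thesis using submodule_of_finite_span_fin_gen[of A K] assms(2) submodule_memD(1)[OF assms(2)] by auto
qed

end

section \<open>Linear maps and free modules\<close>

text \<open>\<open>mod_homs\<close> without extensionality, so that sums, multiples and composites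
  are plain lambda terms. Extensionality is restored by \<open>restrict\<close> where
  \<open>Ext\<close> is unfolded.\<close>

definition linear_map ::
  "('a, 'r) ring_scheme \<Rightarrow> ('a, 'n) module \<Rightarrow> ('a, 'm) module \<Rightarrow> ('n \<Rightarrow> 'm) \<Rightarrow> bool" where
  "linear_map R N M f \<longleftrightarrow> f \<in> carrier N \<rightarrow> carrier M \<and>
     (\<forall>x \<in> carrier N. \<forall>y \<in> carrier N. f (x \<oplus>\<^bsub>N\<^esub> y) = f x \<oplus>\<^bsub>M\<^esub> f y) \<and>
     (\<forall>a \<in> carrier R. \<forall>x \<in> carrier N. f (a \<odot>\<^bsub>N\<^esub> x) = a \<odot>\<^bsub>M\<^esub> f x)"

lemma linear_mapD:
  assumes "linear_map R N M f"
  shows "\<And>x. x \<in> carrier N \<Longrightarrow> f x \<in> carrier M"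
    "\<And>x y. \<lbrakk>x \<in> carrier N; y \<in> carrier N\<rbrakk> \<Longrightarrow> f (x \<oplus>\<^bsub>N\<^esub> y) = f x \<oplus>\<^bsub>M\<^esub> f y"
    "\<And>a x. \<lbrakk>a \<in> carrier R; x \<in> carrier N\<rbrakk> \<Longrightarrow> f (a \<odot>\<^bsub>N\<^esub> x) = a \<odot>\<^bsub>M\<^esub> f x"
  using assms unfolding linear_map_def by auto

lemma mod_homs_iff: "f \<in> mod_homs R N M \<longleftrightarrow> linear_map R N M f \<and> f \<in> extensional (carrier N)"
  unfolding mod_homs_def linear_map_def PiE_def by auto

lemma restrict_mod_homs:
  assumes "module R N" "linear_map R N M f"
  shows "restrict f (carrier N) \<in> mod_homs R N M"
proof -
  interpret N: plain_module R N using assms(1) by (simp add: plain_module_def)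
  show ?thesis using assms(2) unfolding mod_homs_iff linear_map_def by (auto simp: Pi_iff)
qed

lemma linear_map_zero:
  assumes "module R N" "module R M" "linear_map R N M f"
  shows "f \<zero>\<^bsub>N\<^esub> = \<zero>\<^bsub>M\<^esub>"
proof -
  interpret N: plain_module R N using assms(1) by (simp add: plain_module_def)
  interpret M: plain_module R M using assms(2) by (simp add: plain_module_def)
  have "f (\<zero>\<^bsub>R\<^esub> \<odot>\<^bsub>N\<^esub> \<zero>\<^bsub>N\<^esub>) = \<zero>\<^bsub>R\<^esub> \<odot>\<^bsub>M\<^esub> f \<zero>\<^bsub>N\<^esub>" using linear_mapD(3)[OF assms(3)] by blast
  then show ?thesis using linear_mapD(1)[OF assms(3)] by simp
qed

lemma linear_map_const_zero:
  assumes "module R M"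
  shows "linear_map R N M (\<lambda>_. \<zero>\<^bsub>M\<^esub>)"
proof -
  interpret M: plain_module R M using assms by (simp add: plain_module_def)
  show ?thesis unfolding linear_map_def by auto
qed

lemma linear_map_add:
  assumes "module R M" "linear_map R N M f" "linear_map R N M g"
  shows "linear_map R N M (\<lambda>x. f x \<oplus>\<^bsub>M\<^esub> g x)"
proof -
  interpret M: plain_module R M using assms by (simp add: plain_module_def)
  note [simp] = linear_mapD[OF assms(2)] linear_mapD[OF assms(3)]
  show ?thesis unfolding linear_map_def by (auto simp: M.M.a_ac M.smult_r_distr)
qed

lemma linear_map_smult:
  assumes "module R M" "linear_map R N M f" "c \<in> carrier R"
  shows "linear_map R N M (\<lambda>x. c \<odot>\<^bsub>M\<^esub> f x)"
proof -
  interpret M: plain_module R M using assms by (simp add: plain_module_def)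
  note [simp] = linear_mapD[OF assms(2)] assms(3)
  show ?thesis unfolding linear_map_def
    by (auto simp: M.smult_r_distr M.smult_assoc1[symmetric] M.R.m_comm)
qed

lemma linear_map_comp:
  assumes "linear_map R N M f" "linear_map R M P g"
  shows "linear_map R N P (\<lambda>x. g (f x))"
  using linear_mapD[OF assms(1)] linear_mapD[OF assms(2)] unfolding linear_map_def by auto

section \<open>Linear combinations and linear maps out of free modules\<close>

definition comb :: "('a, 'm) module \<Rightarrow> ('b \<Rightarrow> 'm) \<Rightarrow> 'b set \<Rightarrow> ('b \<Rightarrow> 'a) \<Rightarrow> 'm" where
  "comb M g A c = (\<Oplus>\<^bsub>M\<^esub>b\<in>A. c b \<odot>\<^bsub>M\<^esub> g b)"

text \<open>The coefficients are total and vanish off \<open>A\<close>, so two combinations can be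
  moved to a common finite index set before they are added.\<close>

definition coeff_fun :: "('a, 'r) ring_scheme \<Rightarrow> 'b set \<Rightarrow> ('b \<Rightarrow> 'a) \<Rightarrow> bool" where
  "coeff_fun R A c \<longleftrightarrow> finite A \<and> (\<forall>b. c b \<in> carrier R) \<and> (\<forall>b. b \<notin> A \<longrightarrow> c b = \<zero>\<^bsub>R\<^esub>)"

context plain_module
begin

lemma comb_closed:
  assumes "coeff_fun R A c" "g \<in> A \<rightarrow> carrier M"
  shows "comb M g A c \<in> carrier M"
  using assms unfolding comb_def coeff_fun_def by (intro M.finsum_closed) auto

lemma comb_mono:
  assumes "coeff_fun R A c" "A \<subseteq> A'" "finite A'" "g \<in> A' \<rightarrow> carrier M"
  shows "comb M g A c = comb M g A' c"
  unfolding comb_def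
  using assms by (intro M.add.finprod_mono_neutral_cong_left) (auto simp: coeff_fun_def Pi_iff)

lemma coeff_fun_mono: "coeff_fun R A c \<Longrightarrow> A \<subseteq> A' \<Longrightarrow> finite A' \<Longrightarrow> coeff_fun R A' c"
  unfolding coeff_fun_def by auto

lemma coeff_fun_add: "coeff_fun R A c \<Longrightarrow> coeff_fun R A c' \<Longrightarrow> coeff_fun R A (\<lambda>b. c b \<oplus> c' b)"
  unfolding coeff_fun_def by auto

lemma coeff_fun_smult: "coeff_fun R A c \<Longrightarrow> r \<in> carrier R \<Longrightarrow> coeff_fun R A (\<lambda>b. r \<otimes> c b)"
  unfolding coeff_fun_def by auto

lemma comb_add:
  assumes "coeff_fun R A c" "coeff_fun R A c'" "g \<in> A \<rightarrow> carrier M"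
  shows "comb M g A (\<lambda>b. c b \<oplus> c' b) = comb M g A c \<oplus>\<^bsub>M\<^esub> comb M g A c'"
proof -
  have "comb M g A (\<lambda>b. c b \<oplus> c' b) = (\<Oplus>\<^bsub>M\<^esub>b\<in>A. c b \<odot>\<^bsub>M\<^esub> g b \<oplus>\<^bsub>M\<^esub> c' b \<odot>\<^bsub>M\<^esub> g b)"
    unfolding comb_def using assms
    by (intro M.add.finprod_cong') (auto simp: coeff_fun_def smult_l_distr Pi_iff)
  also have "\<dots> = comb M g A c \<oplus>\<^bsub>M\<^esub> comb M g A c'"
    unfolding comb_def using assms
    by (intro M.finsum_addf) (auto simp: coeff_fun_def)
  finally show ?thesis .
qed

lemma comb_smult:
  assumes "coeff_fun R A c" "r \<in> carrier R" "g \<in> A \<rightarrow> carrier M"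
  shows "comb M g A (\<lambda>b. r \<otimes> c b) = r \<odot>\<^bsub>M\<^esub> comb M g A c"
proof -
  have "comb M g A (\<lambda>b. r \<otimes> c b) = (\<Oplus>\<^bsub>M\<^esub>b\<in>A. r \<odot>\<^bsub>M\<^esub> (c b \<odot>\<^bsub>M\<^esub> g b))"
    unfolding comb_def using assms
    by (intro M.add.finprod_cong') (auto simp: coeff_fun_def smult_assoc1 Pi_iff)
  also have "\<dots> = r \<odot>\<^bsub>M\<^esub> comb M g A c"
    unfolding comb_def using assms
    by (intro finsum_smult_ldistr[symmetric]) (auto simp: coeff_fun_def)
  finally show ?thesis .
qed

lemma comb_in_submodule:
  assumes "submodule K R M" "coeff_fun R A c" "g \<in> A \<rightarrow> K"
  shows "comb M g A c \<in> K"
proof -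
  note D = submodule_memD[OF assms(1)]
  have "finite A" "\<And>b. c b \<in> carrier R" using assms(2) unfolding coeff_fun_def by auto
  then have "(\<Oplus>\<^bsub>M\<^esub>b\<in>A. c b \<odot>\<^bsub>M\<^esub> g b) \<in> K" using assms(3)
  proof (induction A rule: finite_induct)
    case empty then show ?case using D by simp
  next
    case (insert x A)
    then have "(\<Oplus>\<^bsub>M\<^esub>b\<in>insert x A. c b \<odot>\<^bsub>M\<^esub> g b) = c x \<odot>\<^bsub>M\<^esub> g x \<oplus>\<^bsub>M\<^esub> (\<Oplus>\<^bsub>M\<^esub>b\<in>A. c b \<odot>\<^bsub>M\<^esub> g b)"
      using D(1) by (intro M.finsum_insert) (auto simp: Pi_iff)
    moreover have "c x \<odot>\<^bsub>M\<^esub> g x \<in> K" "(\<Oplus>\<^bsub>M\<^esub>b\<in>A. c b \<odot>\<^bsub>M\<^esub> g b) \<in> K" using insert D(4) by auto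
    ultimately show ?case using D(3) by simp
  qed
  then show ?thesis unfolding comb_def .
qed

lemma comb_single:
  assumes "coeff_fun R {b} c" "g b \<in> carrier M"
  shows "comb M g {b} c = c b \<odot>\<^bsub>M\<^esub> g b"
proof -
  have "(\<Oplus>\<^bsub>M\<^esub>x\<in>insert b {}. c x \<odot>\<^bsub>M\<^esub> g x) = c b \<odot>\<^bsub>M\<^esub> g b \<oplus>\<^bsub>M\<^esub> (\<Oplus>\<^bsub>M\<^esub>x\<in>{}. c x \<odot>\<^bsub>M\<^esub> g x)"
    using assms by (intro M.finsum_insert) (auto simp: coeff_fun_def)
  then show ?thesis unfolding comb_def using assms by (simp add: coeff_fun_def)
qed

lemma span_comb:
  assumes "B \<subseteq> carrier M" "z \<in> submodule_span R M B"
  shows "\<exists>A c. A \<subseteq> B \<and> coeff_fun R A c \<and> z = comb M (\<lambda>b. b) A c"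
proof -
  let ?H = "{z. \<exists>A c. A \<subseteq> B \<and> coeff_fun R A c \<and> z = comb M (\<lambda>b. b) A c}"
  have "submodule ?H R M"
  proof (rule submodule_memI)
    show "?H \<subseteq> carrier M" using assms(1) by (auto intro!: comb_closed)
    show "\<zero>\<^bsub>M\<^esub> \<in> ?H"
      by (auto intro!: exI[of _ "{}"] exI[of _ "\<lambda>_. \<zero>"] simp: coeff_fun_def comb_def)
  next
    fix x y assume "x \<in> ?H" "y \<in> ?H"
    then obtain A c A' c' where *: "A \<subseteq> B" "coeff_fun R A c" "x = comb M (\<lambda>b. b) A c"
      "A' \<subseteq> B" "coeff_fun R A' c'" "y = comb M (\<lambda>b. b) A' c'" by auto
    have fin: "finite (A \<union> A')" using * by (simp add: coeff_fun_def)
    have sub: "(\<lambda>b. b) \<in> A \<union> A' \<rightarrow> carrier M" using * assms by auto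
    have "x \<oplus>\<^bsub>M\<^esub> y = comb M (\<lambda>b. b) (A \<union> A') (\<lambda>b. c b \<oplus> c' b)"
      using * comb_mono[OF *(2) _ fin sub] comb_mono[OF *(5) _ fin sub]
        comb_add[OF coeff_fun_mono[OF *(2) _ fin] coeff_fun_mono[OF *(5) _ fin] sub] by simp
    moreover have "coeff_fun R (A \<union> A') (\<lambda>b. c b \<oplus> c' b)"
      using coeff_fun_add coeff_fun_mono[OF *(2) _ fin] coeff_fun_mono[OF *(5) _ fin] by simp
    moreover have "A \<union> A' \<subseteq> B" using * by auto
    ultimately show "x \<oplus>\<^bsub>M\<^esub> y \<in> ?H" by blast
  next
    fix r x assume r: "r \<in> carrier R" and "x \<in> ?H"
    then obtain A c where *: "A \<subseteq> B" "coeff_fun R A c" "x = comb M (\<lambda>b. b) A c" by auto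
    then have "(\<lambda>b. b) \<in> A \<rightarrow> carrier M" using assms(1) by auto
    then have "r \<odot>\<^bsub>M\<^esub> x = comb M (\<lambda>b. b) A (\<lambda>b. r \<otimes> c b)"
      using comb_smult[OF *(2) r, of "\<lambda>b. b"] * by simp
    then show "r \<odot>\<^bsub>M\<^esub> x \<in> ?H" using * coeff_fun_smult r by blast
  qed
  moreover have "B \<subseteq> ?H"
  proof
    fix b assume b: "b \<in> B"
    let ?c = "\<lambda>x. if x = b then \<one> else \<zero>"
    have c: "coeff_fun R {b} ?c" by (auto simp: coeff_fun_def)
    then have "b = comb M (\<lambda>b. b) {b} ?c" using comb_single[OF c, of "\<lambda>b. b"] b assms(1) by auto
    then show "b \<in> ?H" using c b by blast
  qed
  ultimately have "submodule_span R M B \<subseteq> ?H" by (rule span_minimal)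
  then show ?thesis using assms(2) by auto
qed

end

text \<open>The map is obtained from its graph \<open>G\<close>: \<open>z\<close> and
  \<open>p\<close> are related if the same coefficients produce \<open>z\<close> from basis elements
  and \<open>p\<close> from their prescribed images. \<open>G\<close> is linear by construction,
  total because \<open>B\<close> spans, and single-valued because it relates zero to zero
  only.\<close>

lemma free_module_extend:
  fixes R :: "('a, 'r) ring_scheme" (structure) and F :: "('a, 'p) module" and P :: "('a, 'q) module"
  assumes "module R F" "module R P" "module_basis R F B" "\<phi> \<in> B \<rightarrow> carrier P"
  shows "\<exists>h. linear_map R F P h \<and> (\<forall>b\<in>B. h b = \<phi> b)"
proof -
  interpret F: plain_module R F using assms(1) by (simp add: plain_module_def)
  interpret P: plain_module R P using assms(2) by (simp add: plain_module_def)
  have BF: "B \<subseteq> carrier F" and span: "submodule_span R F B = carrier F"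
    and indep: "\<And>A c. finite A \<Longrightarrow> A \<subseteq> B \<Longrightarrow> c \<in> A \<rightarrow> carrier R \<Longrightarrow>
        (\<Oplus>\<^bsub>F\<^esub>b\<in>A. c b \<odot>\<^bsub>F\<^esub> b) = \<zero>\<^bsub>F\<^esub> \<Longrightarrow> (\<forall>b\<in>A. c b = \<zero>)"
    using assms(3) unfolding module_basis_def by blast+
  define G where "G z p \<longleftrightarrow> (\<exists>A c. A \<subseteq> B \<and> coeff_fun R A c \<and> z = comb F (\<lambda>b. b) A c \<and> p = comb P \<phi> A c)" for z p
  have Gadd: "G (z \<oplus>\<^bsub>F\<^esub> w) (p \<oplus>\<^bsub>P\<^esub> q)" if G: "G z p" "G w q" for z p w q
  proof -
    obtain A c A' c' where *: "A \<subseteq> B" "coeff_fun R A c" "z = comb F (\<lambda>b. b) A c" "p = comb P \<phi> A c"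
      "A' \<subseteq> B" "coeff_fun R A' c'" "w = comb F (\<lambda>b. b) A' c'" "q = comb P \<phi> A' c'" using G unfolding G_def by auto
    have fin: "finite (A \<union> A')" using * by (simp add: coeff_fun_def)
    have sub: "(\<lambda>b. b) \<in> A \<union> A' \<rightarrow> carrier F" "\<phi> \<in> A \<union> A' \<rightarrow> carrier P" using * BF assms(4) by auto
    have "z \<oplus>\<^bsub>F\<^esub> w = comb F (\<lambda>b. b) (A \<union> A') (\<lambda>b. c b \<oplus> c' b)"
      using * F.comb_mono[OF *(2) _ fin sub(1)] F.comb_mono[OF *(6) _ fin sub(1)]
        F.comb_add[OF F.coeff_fun_mono[OF *(2) _ fin] F.coeff_fun_mono[OF *(6) _ fin] sub(1)] by simp
    moreover have "p \<oplus>\<^bsub>P\<^esub> q = comb P \<phi> (A \<union> A') (\<lambda>b. c b \<oplus> c' b)"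
      using * P.comb_mono[OF *(2) _ fin sub(2)] P.comb_mono[OF *(6) _ fin sub(2)]
        P.comb_add[OF F.coeff_fun_mono[OF *(2) _ fin] F.coeff_fun_mono[OF *(6) _ fin] sub(2)] by simp
    moreover have "coeff_fun R (A \<union> A') (\<lambda>b. c b \<oplus> c' b)"
      using F.coeff_fun_add F.coeff_fun_mono[OF *(2) _ fin] F.coeff_fun_mono[OF *(6) _ fin] by simp
    moreover have "A \<union> A' \<subseteq> B" using * by auto
    ultimately show ?thesis unfolding G_def by blast
  qed
  have Gsmult: "G (r \<odot>\<^bsub>F\<^esub> z) (r \<odot>\<^bsub>P\<^esub> p)" if G: "G z p" and r: "r \<in> carrier R" for r z p
  proof -
    obtain A c where *: "A \<subseteq> B" "coeff_fun R A c" "z = comb F (\<lambda>b. b) A c" "p = comb P \<phi> A c"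
      using G unfolding G_def by auto
    have sub: "(\<lambda>b. b) \<in> A \<rightarrow> carrier F" "\<phi> \<in> A \<rightarrow> carrier P" using * BF assms(4) by auto
    show ?thesis unfolding G_def
      using F.comb_smult[OF *(2) r sub(1)] P.comb_smult[OF *(2) r sub(2)] F.coeff_fun_smult[OF *(2) r] * by metis
  qed
  have Gclosed: "p \<in> carrier P" "z \<in> carrier F" if G: "G z p" for z p
  proof -
    obtain A c where *: "A \<subseteq> B" "coeff_fun R A c" "z = comb F (\<lambda>b. b) A c" "p = comb P \<phi> A c"
      using G unfolding G_def by auto
    have sub: "(\<lambda>b. b) \<in> A \<rightarrow> carrier F" "\<phi> \<in> A \<rightarrow> carrier P" using * BF assms(4) by auto
    show "p \<in> carrier P" "z \<in> carrier F" using F.comb_closed[OF *(2) sub(1)] P.comb_closed[OF *(2) sub(2)] * by auto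
  qed
  have Gzero: "p = \<zero>\<^bsub>P\<^esub>" if G: "G \<zero>\<^bsub>F\<^esub> p" for p
  proof -
    obtain A c where *: "A \<subseteq> B" "coeff_fun R A c" "\<zero>\<^bsub>F\<^esub> = comb F (\<lambda>b. b) A c" "p = comb P \<phi> A c"
      using G unfolding G_def by auto
    \<comment> \<open>This is the place where independence of the basis enters.\<close>
    have "\<forall>b\<in>A. c b = \<zero>"
    proof (rule indep[OF _ *(1)])
      show "finite A" "c \<in> A \<rightarrow> carrier R" using *(2) unfolding coeff_fun_def by auto
      show "(\<Oplus>\<^bsub>F\<^esub>b\<in>A. c b \<odot>\<^bsub>F\<^esub> b) = \<zero>\<^bsub>F\<^esub>" using *(3) unfolding comb_def by (rule sym)
    qed
    then have "comb P \<phi> A c = (\<Oplus>\<^bsub>P\<^esub>b\<in>A. \<zero>\<^bsub>P\<^esub>)"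
      unfolding comb_def using *(1) assms(4) by (intro P.M.add.finprod_cong') (auto simp: Pi_iff subset_iff)
    then show ?thesis using *(4) by simp
  qed
  have Guniq: "p = q" if "G z p" "G z q" for z p q
  proof -
    have "G (z \<oplus>\<^bsub>F\<^esub> (\<ominus> \<one>) \<odot>\<^bsub>F\<^esub> z) (p \<oplus>\<^bsub>P\<^esub> (\<ominus> \<one>) \<odot>\<^bsub>P\<^esub> q)" using that by (intro Gadd Gsmult) auto
    then have "p \<oplus>\<^bsub>P\<^esub> (\<ominus> \<one>) \<odot>\<^bsub>P\<^esub> q = \<zero>\<^bsub>P\<^esub>"
      using Gclosed[OF that(1)] by (intro Gzero) (simp add: F.smult_l_minus F.M.r_neg)
    then have "p \<oplus>\<^bsub>P\<^esub> \<ominus>\<^bsub>P\<^esub> q = \<zero>\<^bsub>P\<^esub>" using Gclosed[OF that(2)] by (simp add: P.smult_l_minus)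
    then show ?thesis using Gclosed[OF that(1)] Gclosed[OF that(2)]
      by (metis P.M.add.inv_closed P.M.minus_equality P.M.minus_minus)
  qed
  have Gex: "\<exists>p. G z p" if "z \<in> carrier F" for z
    using F.span_comb[OF BF, of z] that span unfolding G_def by auto
  define h where "h z = (THE p. G z p)" for z
  have Gh: "G z (h z)" if "z \<in> carrier F" for z
    unfolding h_def using Gex[OF that] Guniq by (metis theI)
  have "h b = \<phi> b" if b: "b \<in> B" for b
  proof -
    let ?c = "\<lambda>x. if x = b then \<one> else \<zero>"
    have c: "coeff_fun R {b} ?c" by (auto simp: coeff_fun_def)
    then have "b = comb F (\<lambda>b. b) {b} ?c" using F.comb_single[OF c, of "\<lambda>b. b"] b BF by auto
    moreover have "\<phi> b = comb P \<phi> {b} ?c" using P.comb_single[OF c, of \<phi>] b assms(4) by (auto simp: Pi_iff)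
    ultimately have "G b (\<phi> b)" unfolding G_def using c b by blast
    then show ?thesis using Guniq Gh b BF by blast
  qed
  moreover have "linear_map R F P h"
    unfolding linear_map_def
  proof (intro conjI ballI)
    show "h \<in> carrier F \<rightarrow> carrier P" using Gh Gclosed by blast
    show "h (x \<oplus>\<^bsub>F\<^esub> y) = h x \<oplus>\<^bsub>P\<^esub> h y" if "x \<in> carrier F" "y \<in> carrier F" for x y
      using Guniq[OF Gh Gadd[OF Gh Gh]] that by simp
    show "h (a \<odot>\<^bsub>F\<^esub> x) = a \<odot>\<^bsub>P\<^esub> h x" if "a \<in> carrier R" "x \<in> carrier F" for a x
      using Guniq[OF Gh Gsmult[OF Gh]] that by simp
  qed
  ultimately show ?thesis by blast
qed

text \<open>
  All liftings through free modules below, including those modulo a submodule of the target, are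
  selections of a linear map from a total relation that is itself linear.
\<close>

lemma free_module_select:
  fixes R :: "('a, 'r) ring_scheme" (structure) and F :: "('a, 'p) module" and P :: "('a, 'q) module"
  assumes "free_module R F" "module R P"
    and tot: "\<And>z. z \<in> carrier F \<Longrightarrow> \<exists>p\<in>carrier P. T z p"
    and zero: "T \<zero>\<^bsub>F\<^esub> \<zero>\<^bsub>P\<^esub>"
    and add: "\<And>z p w q. \<lbrakk>z \<in> carrier F; w \<in> carrier F; p \<in> carrier P; q \<in> carrier P; T z p; T w q\<rbrakk>
      \<Longrightarrow> T (z \<oplus>\<^bsub>F\<^esub> w) (p \<oplus>\<^bsub>P\<^esub> q)"
    and smult: "\<And>r z p. \<lbrakk>r \<in> carrier R; z \<in> carrier F; p \<in> carrier P; T z p\<rbrakk>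
      \<Longrightarrow> T (r \<odot>\<^bsub>F\<^esub> z) (r \<odot>\<^bsub>P\<^esub> p)"
  shows "\<exists>h. linear_map R F P h \<and> (\<forall>z\<in>carrier F. T z (h z))"
proof -
  obtain B where F: "module R F" and B: "module_basis R F B" using assms(1) unfolding free_module_def by auto
  interpret F: plain_module R F using F by (simp add: plain_module_def)
  have BF: "B \<subseteq> carrier F" and span: "submodule_span R F B = carrier F"
    using B unfolding module_basis_def by blast+
  have "\<forall>b\<in>B. \<exists>p\<in>carrier P. T b p" using tot BF by blast
  then obtain \<phi> where \<phi>: "\<And>b. b \<in> B \<Longrightarrow> \<phi> b \<in> carrier P \<and> T b (\<phi> b)" by metis
  then obtain h where h: "linear_map R F P h" "\<And>b. b \<in> B \<Longrightarrow> h b = \<phi> b"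
    using free_module_extend[OF F assms(2) B, of \<phi>] by auto
  note D = linear_mapD[OF h(1)]
  \<comment> \<open>The points at which \<open>h\<close> obeys \<open>T\<close> form a submodule;
    since it contains the basis, it is everything.\<close>
  have "submodule {z \<in> carrier F. T z (h z)} R F"
    by (rule F.submodule_memI)
      (use D linear_map_zero[OF F assms(2) h(1)] zero add smult in \<open>auto\<close>)
  moreover have "B \<subseteq> {z \<in> carrier F. T z (h z)}" using \<phi> h BF by auto
  ultimately have "carrier F \<subseteq> {z \<in> carrier F. T z (h z)}" using F.span_minimal span by blast
  then show ?thesis using h(1) by blast
qed

section \<open>Cohomology with coefficients in a quotient\<close>

text \<open>Injectivity of \<open>x\<close> on \<open>M/K\<close>, expressed inside
  \<open>M\<close>; \<open>inj_on_quot_smult_iff\<close> relates it to the quotient module in the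
  definition of regular sequences.\<close>

definition nonzerodivisor_mod :: "('a, 'm) module \<Rightarrow> 'm set \<Rightarrow> 'a \<Rightarrow> bool" where
  "nonzerodivisor_mod M K x \<longleftrightarrow> (\<forall>m\<in>carrier M. x \<odot>\<^bsub>M\<^esub> m \<in> K \<longrightarrow> m \<in> K)"

text \<open>The submodule \<open>K + xM\<close>, that is, the preimage in \<open>M\<close> of
  \<open>x (M/K)\<close>.\<close>

definition plus_multiples :: "('a, 'm) module \<Rightarrow> 'm set \<Rightarrow> 'a \<Rightarrow> 'm set" where
  "plus_multiples M K x = {x \<odot>\<^bsub>M\<^esub> m \<oplus>\<^bsub>M\<^esub> k | m k. m \<in> carrier M \<and> k \<in> K}"

lemma (in plain_module) smult_swap:
  assumes "a \<in> carrier R" "b \<in> carrier R" "x \<in> carrier M"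
  shows "a \<odot>\<^bsub>M\<^esub> (b \<odot>\<^bsub>M\<^esub> x) = b \<odot>\<^bsub>M\<^esub> (a \<odot>\<^bsub>M\<^esub> x)"
  using assms by (simp add: smult_assoc1[symmetric] R.m_comm)

lemma (in plain_module) submodule_plus_multiples:
  assumes "submodule K R M" "x \<in> carrier R"
  shows "submodule (plus_multiples M K x) R M"
proof (rule submodule_memI)
  note D = submodule_memD[OF assms(1)]
  show "plus_multiples M K x \<subseteq> carrier M" using D(1) assms unfolding plus_multiples_def by auto
  have "\<zero>\<^bsub>M\<^esub> = x \<odot>\<^bsub>M\<^esub> \<zero>\<^bsub>M\<^esub> \<oplus>\<^bsub>M\<^esub> \<zero>\<^bsub>M\<^esub>" using assms(2) by simp
  then show "\<zero>\<^bsub>M\<^esub> \<in> plus_multiples M K x" unfolding plus_multiples_def using D(2) by blast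
  fix a b assume "a \<in> plus_multiples M K x" "b \<in> plus_multiples M K x"
  then obtain m k n l where *: "a = x \<odot>\<^bsub>M\<^esub> m \<oplus>\<^bsub>M\<^esub> k" "b = x \<odot>\<^bsub>M\<^esub> n \<oplus>\<^bsub>M\<^esub> l" "m \<in> carrier M" "n \<in> carrier M" "k \<in> K" "l \<in> K"
    unfolding plus_multiples_def by auto
  then have "a \<oplus>\<^bsub>M\<^esub> b = x \<odot>\<^bsub>M\<^esub> (m \<oplus>\<^bsub>M\<^esub> n) \<oplus>\<^bsub>M\<^esub> (k \<oplus>\<^bsub>M\<^esub> l)"
    using D(1) assms(2) by (simp add: smult_r_distr M.a_ac)
  then show "a \<oplus>\<^bsub>M\<^esub> b \<in> plus_multiples M K x"
    unfolding plus_multiples_def using *(3,4) D(3)[OF *(5,6)] M.a_closed by blast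
next
  note D = submodule_memD[OF assms(1)]
  fix c a assume c: "c \<in> carrier R" and "a \<in> plus_multiples M K x"
  then obtain m k where *: "a = x \<odot>\<^bsub>M\<^esub> m \<oplus>\<^bsub>M\<^esub> k" "m \<in> carrier M" "k \<in> K"
    unfolding plus_multiples_def by auto
  then have "c \<odot>\<^bsub>M\<^esub> a = x \<odot>\<^bsub>M\<^esub> (c \<odot>\<^bsub>M\<^esub> m) \<oplus>\<^bsub>M\<^esub> c \<odot>\<^bsub>M\<^esub> k"
    using D(1) assms(2) c by (simp add: smult_r_distr smult_assoc1[symmetric] R.m_comm)
  then show "c \<odot>\<^bsub>M\<^esub> a \<in> plus_multiples M K x"
    unfolding plus_multiples_def using smult_closed[OF c *(2)] D(4)[OF c *(3)] by blast
qed

lemma (in plain_module) plus_multiples_incl: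
  assumes "submodule K R M" "x \<in> carrier R"
  shows "K \<subseteq> plus_multiples M K x"
proof
  fix k assume k: "k \<in> K"
  then have "k = x \<odot>\<^bsub>M\<^esub> \<zero>\<^bsub>M\<^esub> \<oplus>\<^bsub>M\<^esub> k" using submodule_memD(1)[OF assms(1)] assms(2) by simp
  then show "k \<in> plus_multiples M K x" unfolding plus_multiples_def using k by blast
qed

lemma (in plain_module) nonzerodivisor_mod_cancel:
  assumes "submodule K R M" "x \<in> carrier R" "nonzerodivisor_mod M K x"
    "a \<in> carrier M" "b \<in> carrier M" "k \<in> K" "x \<odot>\<^bsub>M\<^esub> a = x \<odot>\<^bsub>M\<^esub> b \<oplus>\<^bsub>M\<^esub> k"
  shows "\<exists>k'\<in>K. a = b \<oplus>\<^bsub>M\<^esub> k'"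
proof -
  have kM: "k \<in> carrier M" using submodule_memD(1)[OF assms(1)] assms by blast
  have "x \<odot>\<^bsub>M\<^esub> (\<ominus>\<^bsub>M\<^esub> b \<oplus>\<^bsub>M\<^esub> a) = \<ominus>\<^bsub>M\<^esub> (x \<odot>\<^bsub>M\<^esub> b) \<oplus>\<^bsub>M\<^esub> (x \<odot>\<^bsub>M\<^esub> b \<oplus>\<^bsub>M\<^esub> k)"
    using assms(2,4,5) by (simp add: smult_r_distr smult_r_minus assms(7))
  also have "\<dots> = k" using assms(2,5) kM by (simp add: M.r_neg1)
  finally have "\<ominus>\<^bsub>M\<^esub> b \<oplus>\<^bsub>M\<^esub> a \<in> K" using assms(3-6) unfolding nonzerodivisor_mod_def by simp
  moreover have "a = b \<oplus>\<^bsub>M\<^esub> (\<ominus>\<^bsub>M\<^esub> b \<oplus>\<^bsub>M\<^esub> a)" using assms(4,5) by (simp add: M.r_neg2)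
  ultimately show ?thesis by blast
qed

text \<open>One module \<open>N\<close>, one resolution of it and one coefficient module stay fixed,
  while the submodule \<open>K\<close> and the degree vary. The element type of the resolution is a
  parameter, instantiated in \<open>Ext_resolution_coeffs\<close> with that of
  \<open>chosen_resolution\<close>.\<close>

locale resolution_coeffs = plain_module R M
  for R :: "('a, 'r) ring_scheme" (structure) and M :: "('a, 'm) module" (structure) +
  fixes N :: "('a, 'n) module" and F :: "nat \<Rightarrow> ('a, 'p) module" and d :: "nat \<Rightarrow> 'p \<Rightarrow> 'p" and e :: "'p \<Rightarrow> 'n"
  assumes res: "free_resolution R F d e N" and N_module: "module R N"
begin

lemma F_free: "free_module R (F i)"
  using res unfolding free_resolution_def by blast

lemma F_module: "module R (F i)"
  using F_free unfolding free_module_def by blast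

lemma d_linear: "linear_map R (F (Suc i)) (F i) (d i)"
proof -
  have "d i \<in> mod_homs R (F (Suc i)) (F i)" using res unfolding free_resolution_def by blast
  then show ?thesis by (simp add: mod_homs_iff)
qed

lemma e_linear: "linear_map R (F 0) N e"
proof -
  have "e \<in> mod_homs R (F 0) N" using res unfolding free_resolution_def by blast
  then show ?thesis by (simp add: mod_homs_iff)
qed

lemma e_surj: "e ` carrier (F 0) = carrier N"
  using res unfolding free_resolution_def by blast

lemma exact_0: "d 0 ` carrier (F (Suc 0)) = {x \<in> carrier (F 0). e x = \<zero>\<^bsub>N\<^esub>}"
  using res unfolding free_resolution_def by simp

lemma exact_Suc: "d (Suc i) ` carrier (F (Suc (Suc i))) = {x \<in> carrier (F (Suc i)). d i x = \<zero>\<^bsub>F i\<^esub>}"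
  using res unfolding free_resolution_def by blast

lemma exact_SucE:
  assumes "w \<in> carrier (F (Suc i))" "d i w = \<zero>\<^bsub>F i\<^esub>"
  obtains p where "p \<in> carrier (F (Suc (Suc i)))" "d (Suc i) p = w"
proof -
  have "w \<in> d (Suc i) ` carrier (F (Suc (Suc i)))" unfolding exact_Suc using assms by simp
  then show thesis using that by auto
qed

lemma d_closed: "z \<in> carrier (F (Suc i)) \<Longrightarrow> d i z \<in> carrier (F i)"
  using linear_mapD(1)[OF d_linear] .

lemma d_d: "z \<in> carrier (F (Suc (Suc i))) \<Longrightarrow> d i (d (Suc i) z) = \<zero>\<^bsub>F i\<^esub>"
proof -
  assume "z \<in> carrier (F (Suc (Suc i)))"
  then have "d (Suc i) z \<in> d (Suc i) ` carrier (F (Suc (Suc i)))" by simp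
  then show ?thesis unfolding exact_Suc by simp
qed

text \<open>The coboundaries of \<open>Hom(F, M)\<close>, without extensionality. No differential
  enters degree 0, so there only the zero map qualifies.\<close>

definition bnd :: "nat \<Rightarrow> ('p \<Rightarrow> 'm) \<Rightarrow> bool" where
  "bnd i b \<longleftrightarrow> linear_map R (F i) M b \<and>
     (case i of 0 \<Rightarrow> (\<forall>z\<in>carrier (F 0). b z = \<zero>\<^bsub>M\<^esub>)
      | Suc j \<Rightarrow> (\<exists>g. linear_map R (F j) M g \<and> (\<forall>z\<in>carrier (F i). b z = g (d j z))))"

definition cocycle_mod :: "'m set \<Rightarrow> nat \<Rightarrow> ('p \<Rightarrow> 'm) \<Rightarrow> bool" where
  "cocycle_mod K i f \<longleftrightarrow> linear_map R (F i) M f \<and> (\<forall>z\<in>carrier (F (Suc i)). f (d i z) \<in> K)"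

text \<open>The bounding cochain takes values in \<open>M\<close> although the equation holds modulo
  \<open>K\<close>: a cochain with values in \<open>M/K\<close> can be lifted along the free
  module.\<close>

definition coboundary_mod :: "'m set \<Rightarrow> nat \<Rightarrow> ('p \<Rightarrow> 'm) \<Rightarrow> bool" where
  "coboundary_mod K i f \<longleftrightarrow> (\<exists>b. bnd i b \<and> (\<forall>z\<in>carrier (F i). \<exists>k\<in>K. f z = b z \<oplus>\<^bsub>M\<^esub> k))"

text \<open>Since \<open>F i\<close> is free, linear maps \<open>F i \<rightarrow> M / K\<close> lift to \<open>M\<close>; so this says that the \<open>i\<close>-th
  cohomology of \<open>Hom(F, M / K)\<close> is zero, without changing the type of the coefficients.\<close>

definition vanishing :: "'m set \<Rightarrow> nat \<Rightarrow> bool" where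
  "vanishing K i \<longleftrightarrow> (\<forall>f. cocycle_mod K i f \<longrightarrow> coboundary_mod K i f)"

lemma coboundary_mod_cong:
  assumes "coboundary_mod K i f" "\<And>z. z \<in> carrier (F i) \<Longrightarrow> f z = g z"
  shows "coboundary_mod K i g"
  using assms unfolding coboundary_mod_def by fastforce

lemma bnd_linear: "bnd i b \<Longrightarrow> linear_map R (F i) M b"
  unfolding bnd_def by blast

lemma bnd_SucI: "linear_map R (F j) M g \<Longrightarrow> bnd (Suc j) (\<lambda>z. g (d j z))"
  unfolding bnd_def using linear_map_comp[OF d_linear] by auto

lemma bnd_SucE:
  assumes "bnd (Suc j) b"
  obtains g where "linear_map R (F j) M g" "\<And>z. z \<in> carrier (F (Suc j)) \<Longrightarrow> b z = g (d j z)"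
  using assms unfolding bnd_def by auto

lemma bnd_d:
  assumes "bnd i b" "z \<in> carrier (F (Suc i))"
  shows "b (d i z) = \<zero>\<^bsub>M\<^esub>"
proof (cases i)
  case 0
  then show ?thesis using assms d_closed unfolding bnd_def by auto
next
  case (Suc j)
  then obtain g where g: "linear_map R (F j) M g" "\<And>z. z \<in> carrier (F (Suc j)) \<Longrightarrow> b z = g (d j z)"
    using assms(1) bnd_SucE by metis
  then show ?thesis
    using Suc assms(2) d_closed[of z i] d_d[of z j] linear_map_zero[OF F_module module_axioms g(1)] by simp
qed

text \<open>The step \<open>H\<^sup>i\<^sup>-\<^sup>1(M/(K + xM)) \<rightarrow> H\<^sup>i(M/K) \<rightarrow> H\<^sup>i(M/K)\<close> of the long exact sequence.\<close>

lemma coboundary_mod_cancel: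
  assumes K: "submodule K R M" and x: "x \<in> carrier R" and nzd: "nonzerodivisor_mod M K x"
    and van: "\<And>j. i = Suc j \<Longrightarrow> vanishing (plus_multiples M K x) j"
    and f: "linear_map R (F i) M f"
    and xf: "coboundary_mod K i (\<lambda>z. x \<odot>\<^bsub>M\<^esub> f z)"
  shows "coboundary_mod K i f"
proof -
  note K' = submodule_memD[OF K] and f' = linear_mapD[OF f]
  obtain b where b: "bnd i b" and xfb: "\<And>z. z \<in> carrier (F i) \<Longrightarrow> \<exists>k\<in>K. x \<odot>\<^bsub>M\<^esub> f z = b z \<oplus>\<^bsub>M\<^esub> k"
    using xf unfolding coboundary_mod_def by blast
  show ?thesis
  proof (cases i)
    case 0
    have "\<exists>k\<in>K. f z = b z \<oplus>\<^bsub>M\<^esub> k" if z: "z \<in> carrier (F i)" for z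
    proof -
      obtain k where k: "k \<in> K" "x \<odot>\<^bsub>M\<^esub> f z = b z \<oplus>\<^bsub>M\<^esub> k" using xfb z by blast
      have "b z = \<zero>\<^bsub>M\<^esub>" using b 0 z unfolding bnd_def by auto
      then show ?thesis using nonzerodivisor_mod_cancel[OF K x nzd f'(1)[OF z] M.zero_closed k(1)] k x K'(1)[OF k(1)] by simp
    qed
    then show ?thesis unfolding coboundary_mod_def using b by blast
  next
    case (Suc j)
    obtain g where g: "linear_map R (F j) M g" and bg: "\<And>z. z \<in> carrier (F (Suc j)) \<Longrightarrow> b z = g (d j z)"
      using b Suc bnd_SucE by metis
    \<comment> \<open>The cochain \<open>g\<close> that bounds \<open>x f\<close> satisfies
      \<open>g d = x f\<close> modulo \<open>K\<close>, so it becomes a cocycle once the multiples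
      of \<open>x\<close> are divided out.\<close>
    have "cocycle_mod (plus_multiples M K x) j g"
      unfolding cocycle_mod_def
    proof (intro conjI g ballI)
      fix z assume z: "z \<in> carrier (F (Suc j))"
      obtain k where k: "k \<in> K" "x \<odot>\<^bsub>M\<^esub> f z = b z \<oplus>\<^bsub>M\<^esub> k" using xfb z Suc by blast
      have gz: "g (d j z) \<in> carrier M" using linear_mapD(1)[OF g d_closed[OF z]] .
      have "x \<odot>\<^bsub>M\<^esub> f z \<oplus>\<^bsub>M\<^esub> \<ominus>\<^bsub>M\<^esub> k = g (d j z)"
        using k bg[OF z] gz K'(1)[OF k(1)] by (simp add: M.a_assoc M.r_neg)
      then show "g (d j z) \<in> plus_multiples M K x"
        unfolding plus_multiples_def using f'(1) z Suc K'(5)[OF k(1)] by force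
    qed
    then obtain b' where b': "bnd j b'"
      and gb': "\<And>z. z \<in> carrier (F j) \<Longrightarrow> \<exists>k\<in>plus_multiples M K x. g z = b' z \<oplus>\<^bsub>M\<^esub> k"
      using van[OF Suc] unfolding vanishing_def coboundary_mod_def by blast
    note b'D = linear_mapD[OF bnd_linear[OF b']] and gD = linear_mapD[OF g]
    \<comment> \<open>The error \<open>g - b'\<close> takes values in \<open>K + xM\<close>;
      freeness lets its quotient by \<open>x\<close> be chosen linearly.\<close>
    have "\<exists>h. linear_map R (F j) M h \<and> (\<forall>z\<in>carrier (F j). \<exists>k\<in>K. g z = b' z \<oplus>\<^bsub>M\<^esub> (x \<odot>\<^bsub>M\<^esub> h z \<oplus>\<^bsub>M\<^esub> k))"
    proof (rule free_module_select[OF F_free module_axioms])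
      fix z assume "z \<in> carrier (F j)"
      then show "\<exists>m\<in>carrier M. \<exists>k\<in>K. g z = b' z \<oplus>\<^bsub>M\<^esub> (x \<odot>\<^bsub>M\<^esub> m \<oplus>\<^bsub>M\<^esub> k)"
        using gb'[of z] unfolding plus_multiples_def by auto
    next
      show "\<exists>k\<in>K. g \<zero>\<^bsub>F j\<^esub> = b' \<zero>\<^bsub>F j\<^esub> \<oplus>\<^bsub>M\<^esub> (x \<odot>\<^bsub>M\<^esub> \<zero>\<^bsub>M\<^esub> \<oplus>\<^bsub>M\<^esub> k)"
        using K'(2) x linear_map_zero[OF F_module module_axioms g] linear_map_zero[OF F_module module_axioms bnd_linear[OF b']]
        by (intro bexI[of _ "\<zero>\<^bsub>M\<^esub>"]) auto
    next
      fix z p w q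
      assume zw: "z \<in> carrier (F j)" "w \<in> carrier (F j)" and pq: "p \<in> carrier M" "q \<in> carrier M"
        and "\<exists>k\<in>K. g z = b' z \<oplus>\<^bsub>M\<^esub> (x \<odot>\<^bsub>M\<^esub> p \<oplus>\<^bsub>M\<^esub> k)" "\<exists>k\<in>K. g w = b' w \<oplus>\<^bsub>M\<^esub> (x \<odot>\<^bsub>M\<^esub> q \<oplus>\<^bsub>M\<^esub> k)"
      then obtain k l where kl: "k \<in> K" "l \<in> K" "g z = b' z \<oplus>\<^bsub>M\<^esub> (x \<odot>\<^bsub>M\<^esub> p \<oplus>\<^bsub>M\<^esub> k)" "g w = b' w \<oplus>\<^bsub>M\<^esub> (x \<odot>\<^bsub>M\<^esub> q \<oplus>\<^bsub>M\<^esub> l)"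
        by blast
      have "g (z \<oplus>\<^bsub>F j\<^esub> w) = b' (z \<oplus>\<^bsub>F j\<^esub> w) \<oplus>\<^bsub>M\<^esub> (x \<odot>\<^bsub>M\<^esub> (p \<oplus>\<^bsub>M\<^esub> q) \<oplus>\<^bsub>M\<^esub> (k \<oplus>\<^bsub>M\<^esub> l))"
        using zw pq kl x K'(1) by (simp add: gD(2) b'D(1,2) smult_r_distr M.a_ac)
      then show "\<exists>k\<in>K. g (z \<oplus>\<^bsub>F j\<^esub> w) = b' (z \<oplus>\<^bsub>F j\<^esub> w) \<oplus>\<^bsub>M\<^esub> (x \<odot>\<^bsub>M\<^esub> (p \<oplus>\<^bsub>M\<^esub> q) \<oplus>\<^bsub>M\<^esub> k)"
        using K'(3)[OF kl(1,2)] by blast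
    next
      fix r z p
      assume r: "r \<in> carrier R" and z: "z \<in> carrier (F j)" and p: "p \<in> carrier M"
        and "\<exists>k\<in>K. g z = b' z \<oplus>\<^bsub>M\<^esub> (x \<odot>\<^bsub>M\<^esub> p \<oplus>\<^bsub>M\<^esub> k)"
      then obtain k where k: "k \<in> K" "g z = b' z \<oplus>\<^bsub>M\<^esub> (x \<odot>\<^bsub>M\<^esub> p \<oplus>\<^bsub>M\<^esub> k)" by blast
      have "g (r \<odot>\<^bsub>F j\<^esub> z) = b' (r \<odot>\<^bsub>F j\<^esub> z) \<oplus>\<^bsub>M\<^esub> (x \<odot>\<^bsub>M\<^esub> (r \<odot>\<^bsub>M\<^esub> p) \<oplus>\<^bsub>M\<^esub> r \<odot>\<^bsub>M\<^esub> k)"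
        using z p k x r K'(1) by (simp add: gD(3) b'D(1,3) smult_r_distr smult_assoc1[symmetric] R.m_comm)
      then show "\<exists>k\<in>K. g (r \<odot>\<^bsub>F j\<^esub> z) = b' (r \<odot>\<^bsub>F j\<^esub> z) \<oplus>\<^bsub>M\<^esub> (x \<odot>\<^bsub>M\<^esub> (r \<odot>\<^bsub>M\<^esub> p) \<oplus>\<^bsub>M\<^esub> k)"
        using K'(4)[OF r k(1)] by blast
    qed
    then obtain h where h: "linear_map R (F j) M h"
      and gh: "\<And>z. z \<in> carrier (F j) \<Longrightarrow> \<exists>k\<in>K. g z = b' z \<oplus>\<^bsub>M\<^esub> (x \<odot>\<^bsub>M\<^esub> h z \<oplus>\<^bsub>M\<^esub> k)" by blast
    \<comment> \<open>The coboundary \<open>b'\<close> vanishes on \<open>d j z\<close>, so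
      \<open>x f\<close> agrees with \<open>x h d\<close> modulo \<open>K\<close>, and
      \<open>x\<close> can be cancelled.\<close>
    have "\<exists>k\<in>K. f z = h (d j z) \<oplus>\<^bsub>M\<^esub> k" if z: "z \<in> carrier (F (Suc j))" for z
    proof -
      obtain k where k: "k \<in> K" "x \<odot>\<^bsub>M\<^esub> f z = b z \<oplus>\<^bsub>M\<^esub> k" using xfb z Suc by blast
      obtain l where l: "l \<in> K" "g (d j z) = b' (d j z) \<oplus>\<^bsub>M\<^esub> (x \<odot>\<^bsub>M\<^esub> h (d j z) \<oplus>\<^bsub>M\<^esub> l)"
        using gh d_closed[OF z] by blast
      have hM: "h (d j z) \<in> carrier M" using linear_mapD(1)[OF h d_closed[OF z]] .
      have "x \<odot>\<^bsub>M\<^esub> f z = x \<odot>\<^bsub>M\<^esub> h (d j z) \<oplus>\<^bsub>M\<^esub> (l \<oplus>\<^bsub>M\<^esub> k)"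
        using k l bg[OF z] bnd_d[OF b' z] hM x K'(1) by (simp add: M.a_assoc)
      then show ?thesis
        using nonzerodivisor_mod_cancel[OF K x nzd f'(1) hM K'(3)[OF l(1) k(1)]] z Suc by simp
    qed
    then show ?thesis unfolding coboundary_mod_def using bnd_SucI[OF h] Suc by blast
  qed
qed

text \<open>Of the homotopy \<open>d s + t d = a\<close>, where \<open>a\<close> annihilates \<open>N\<close>, the next lemma keeps the part that the
  induction needs: \<open>d t d = a d\<close>.\<close>

lemma annihilator_homotopy:
  assumes a: "a \<in> carrier R" and aN: "\<And>y. y \<in> carrier N \<Longrightarrow> a \<odot>\<^bsub>N\<^esub> y = \<zero>\<^bsub>N\<^esub>"
  shows "\<exists>t. linear_map R (F i) (F (Suc i)) t \<and>
    (\<forall>z\<in>carrier (F (Suc i)). d i (t (d i z)) = a \<odot>\<^bsub>F i\<^esub> d i z)"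
proof (induction i)
  case 0
  interpret F0: plain_module R "F 0" using F_module by (simp add: plain_module_def)
  interpret F1: plain_module R "F (Suc 0)" using F_module by (simp add: plain_module_def)
  note dD = linear_mapD[OF d_linear[of 0]]
  \<comment> \<open>The multiple \<open>a z\<close> dies in \<open>N\<close>, hence is a boundary,
    and its preimage under \<open>d 0\<close> can be chosen linearly in \<open>z\<close>.\<close>
  have "\<exists>t. linear_map R (F 0) (F (Suc 0)) t \<and> (\<forall>z\<in>carrier (F 0). d 0 (t z) = a \<odot>\<^bsub>F 0\<^esub> z)"
  proof (rule free_module_select[OF F_free F_module])
    fix z assume z: "z \<in> carrier (F 0)"
    then have "e (a \<odot>\<^bsub>F 0\<^esub> z) = \<zero>\<^bsub>N\<^esub>" using linear_mapD[OF e_linear] a aN by simp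
    then have "a \<odot>\<^bsub>F 0\<^esub> z \<in> d 0 ` carrier (F (Suc 0))" using exact_0 z a by simp
    then show "\<exists>p\<in>carrier (F (Suc 0)). d 0 p = a \<odot>\<^bsub>F 0\<^esub> z" by auto
  qed (use dD linear_map_zero[OF F_module F_module d_linear] a in
      \<open>auto simp: F0.smult_r_distr F0.smult_assoc1[symmetric] R.m_comm\<close>)
  then show ?case using d_closed by blast
next
  case (Suc i)
  interpret F0: plain_module R "F i" using F_module by (simp add: plain_module_def)
  interpret F1: plain_module R "F (Suc i)" using F_module by (simp add: plain_module_def)
  obtain t where t: "linear_map R (F i) (F (Suc i)) t"
    and dt: "\<And>z. z \<in> carrier (F (Suc i)) \<Longrightarrow> d i (t (d i z)) = a \<odot>\<^bsub>F i\<^esub> d i z" using Suc by blast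
  note dD = linear_mapD[OF d_linear[of i]] and dD' = linear_mapD[OF d_linear[of "Suc i"]] and tD = linear_mapD[OF t]
  \<comment> \<open>The induction hypothesis says that \<open>a z - t (d z)\<close> is a cycle.
    Exactness makes it a boundary, and \<open>s\<close> selects a preimage.\<close>
  have "\<exists>s. linear_map R (F (Suc i)) (F (Suc (Suc i))) s \<and>
     (\<forall>z\<in>carrier (F (Suc i)). a \<odot>\<^bsub>F (Suc i)\<^esub> z = d (Suc i) (s z) \<oplus>\<^bsub>F (Suc i)\<^esub> t (d i z))"
  proof (rule free_module_select[OF F_free F_module])
    fix z assume z: "z \<in> carrier (F (Suc i))"
    let ?w = "a \<odot>\<^bsub>F (Suc i)\<^esub> z \<oplus>\<^bsub>F (Suc i)\<^esub> (\<ominus> \<one>) \<odot>\<^bsub>F (Suc i)\<^esub> t (d i z)"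
    have w: "?w \<in> carrier (F (Suc i))" using z a tD dD by simp
    have "d i ?w = a \<odot>\<^bsub>F i\<^esub> d i z \<oplus>\<^bsub>F i\<^esub> (\<ominus> \<one>) \<odot>\<^bsub>F i\<^esub> (a \<odot>\<^bsub>F i\<^esub> d i z)"
      using z a tD(1) dD dt by simp
    also have "\<dots> = \<zero>\<^bsub>F i\<^esub>" using z a dD(1) by (simp add: F0.smult_l_minus F0.M.r_neg)
    finally obtain p where p: "p \<in> carrier (F (Suc (Suc i)))" "d (Suc i) p = ?w" by (rule exact_SucE[OF w])
    have "?w \<oplus>\<^bsub>F (Suc i)\<^esub> t (d i z) = a \<odot>\<^bsub>F (Suc i)\<^esub> z"
      using z a tD(1) dD(1) by (simp add: F1.smult_l_minus F1.M.a_assoc F1.M.l_neg)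
    then show "\<exists>p\<in>carrier (F (Suc (Suc i))). a \<odot>\<^bsub>F (Suc i)\<^esub> z = d (Suc i) p \<oplus>\<^bsub>F (Suc i)\<^esub> t (d i z)"
      by (intro bexI[OF _ p(1)]) (simp add: p(2))
  next
    show "a \<odot>\<^bsub>F (Suc i)\<^esub> \<zero>\<^bsub>F (Suc i)\<^esub> = d (Suc i) \<zero>\<^bsub>F (Suc (Suc i))\<^esub> \<oplus>\<^bsub>F (Suc i)\<^esub> t (d i \<zero>\<^bsub>F (Suc i)\<^esub>)"
      using a linear_map_zero[OF F_module F_module d_linear] linear_map_zero[OF F_module F_module t] by simp
  next
    fix z p w q assume *: "z \<in> carrier (F (Suc i))" "w \<in> carrier (F (Suc i))" "p \<in> carrier (F (Suc (Suc i)))" "q \<in> carrier (F (Suc (Suc i)))"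
      "a \<odot>\<^bsub>F (Suc i)\<^esub> z = d (Suc i) p \<oplus>\<^bsub>F (Suc i)\<^esub> t (d i z)" "a \<odot>\<^bsub>F (Suc i)\<^esub> w = d (Suc i) q \<oplus>\<^bsub>F (Suc i)\<^esub> t (d i w)"
    then show "a \<odot>\<^bsub>F (Suc i)\<^esub> (z \<oplus>\<^bsub>F (Suc i)\<^esub> w) = d (Suc i) (p \<oplus>\<^bsub>F (Suc (Suc i))\<^esub> q) \<oplus>\<^bsub>F (Suc i)\<^esub> t (d i (z \<oplus>\<^bsub>F (Suc i)\<^esub> w))"
      using a by (simp add: F1.smult_r_distr dD' dD tD F1.M.a_ac)
  next
    fix r z p assume *: "r \<in> carrier R" "z \<in> carrier (F (Suc i))" "p \<in> carrier (F (Suc (Suc i)))"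
      "a \<odot>\<^bsub>F (Suc i)\<^esub> z = d (Suc i) p \<oplus>\<^bsub>F (Suc i)\<^esub> t (d i z)"
    then have "a \<odot>\<^bsub>F (Suc i)\<^esub> (r \<odot>\<^bsub>F (Suc i)\<^esub> z) = r \<odot>\<^bsub>F (Suc i)\<^esub> (a \<odot>\<^bsub>F (Suc i)\<^esub> z)"
      using a by (intro F1.smult_swap) auto
    then show "a \<odot>\<^bsub>F (Suc i)\<^esub> (r \<odot>\<^bsub>F (Suc i)\<^esub> z) = d (Suc i) (r \<odot>\<^bsub>F (Suc (Suc i))\<^esub> p) \<oplus>\<^bsub>F (Suc i)\<^esub> t (d i (r \<odot>\<^bsub>F (Suc i)\<^esub> z))"
      using * by (simp add: F1.smult_r_distr dD' dD tD)
  qed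
  then obtain s where s: "linear_map R (F (Suc i)) (F (Suc (Suc i))) s"
    and ds: "\<And>z. z \<in> carrier (F (Suc i)) \<Longrightarrow> a \<odot>\<^bsub>F (Suc i)\<^esub> z = d (Suc i) (s z) \<oplus>\<^bsub>F (Suc i)\<^esub> t (d i z)" by blast
  \<comment> \<open>At a boundary the summand with \<open>t\<close> vanishes because
    \<open>d d = 0\<close>, so \<open>s\<close> serves as \<open>t\<close> in the next
    degree.\<close>
  have "d (Suc i) (s (d (Suc i) z)) = a \<odot>\<^bsub>F (Suc i)\<^esub> d (Suc i) z" if z: "z \<in> carrier (F (Suc (Suc i)))" for z
    using ds[OF d_closed[OF z]] d_d[OF z] linear_map_zero[OF F_module F_module t]
      dD'(1)[OF linear_mapD(1)[OF s d_closed[OF z]]] by simp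
  then show ?case using s by blast
qed

text \<open>The homotopy is composed with the cocycle. In positive degree
  \<open>a z - t (d z)\<close> is a cycle, hence a boundary, and \<open>f\<close> sends boundaries
  into \<open>K\<close>; so \<open>a f\<close> agrees modulo \<open>K\<close> with the coboundary of
  \<open>f t\<close>. In degree 0 already \<open>a z\<close> is a boundary.\<close>

lemma annihilator_coboundary:
  assumes K: "submodule K R M" and a: "a \<in> carrier R"
    and aN: "\<And>y. y \<in> carrier N \<Longrightarrow> a \<odot>\<^bsub>N\<^esub> y = \<zero>\<^bsub>N\<^esub>" and f: "cocycle_mod K i f"
  shows "coboundary_mod K i (\<lambda>z. a \<odot>\<^bsub>M\<^esub> f z)"
proof -
  have fl: "linear_map R (F i) M f" and fK: "\<And>z. z \<in> carrier (F (Suc i)) \<Longrightarrow> f (d i z) \<in> K"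
    using f unfolding cocycle_mod_def by auto
  note fD = linear_mapD[OF fl] and K' = submodule_memD[OF K]
  show ?thesis
  proof (cases i)
    case 0
    have "bnd i (\<lambda>_. \<zero>\<^bsub>M\<^esub>)" unfolding bnd_def using 0 linear_map_const_zero[OF module_axioms] by simp
    moreover have "a \<odot>\<^bsub>M\<^esub> f z \<in> K" if z: "z \<in> carrier (F i)" for z
    proof -
      have zz: "a \<odot>\<^bsub>F 0\<^esub> z \<in> carrier (F 0)"
        using module.smult_closed[OF F_module a] z 0 by simp
      have "e (a \<odot>\<^bsub>F 0\<^esub> z) = \<zero>\<^bsub>N\<^esub>" using linear_mapD[OF e_linear] a aN z 0 by simp
      then have "a \<odot>\<^bsub>F 0\<^esub> z \<in> d 0 ` carrier (F (Suc 0))" using exact_0 zz by simp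
      then have "f (a \<odot>\<^bsub>F 0\<^esub> z) \<in> K" using fK 0 by auto
      then show ?thesis using fD(3)[OF a z] 0 by simp
    qed
    ultimately show ?thesis unfolding coboundary_mod_def using K'(1) by fastforce
  next
    case (Suc j)
    interpret F0: plain_module R "F j" using F_module by (simp add: plain_module_def)
    interpret F1: plain_module R "F (Suc j)" using F_module by (simp add: plain_module_def)
    obtain t where t: "linear_map R (F j) (F (Suc j)) t"
      and dt: "\<And>z. z \<in> carrier (F (Suc j)) \<Longrightarrow> d j (t (d j z)) = a \<odot>\<^bsub>F j\<^esub> d j z"
      using annihilator_homotopy[OF a aN, of j] by blast
    note dD = linear_mapD[OF d_linear[of j]] and tD = linear_mapD[OF t]
    have "bnd i (\<lambda>z. f (t (d j z)))"
      using bnd_SucI[OF linear_map_comp[OF t]] fl Suc by simp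
    moreover have "\<exists>k\<in>K. a \<odot>\<^bsub>M\<^esub> f z = f (t (d j z)) \<oplus>\<^bsub>M\<^esub> k" if "z \<in> carrier (F i)" for z
    proof -
      have z: "z \<in> carrier (F (Suc j))" using that Suc by simp
      let ?w = "a \<odot>\<^bsub>F (Suc j)\<^esub> z \<oplus>\<^bsub>F (Suc j)\<^esub> (\<ominus> \<one>) \<odot>\<^bsub>F (Suc j)\<^esub> t (d j z)"
      have w: "?w \<in> carrier (F (Suc j))" using z a tD dD by simp
      have "d j ?w = a \<odot>\<^bsub>F j\<^esub> d j z \<oplus>\<^bsub>F j\<^esub> (\<ominus> \<one>) \<odot>\<^bsub>F j\<^esub> (a \<odot>\<^bsub>F j\<^esub> d j z)"
        using z a tD(1) dD dt by simp
      also have "\<dots> = \<zero>\<^bsub>F j\<^esub>" using z a dD(1) by (simp add: F0.smult_l_minus F0.M.r_neg)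
      finally obtain p where p: "p \<in> carrier (F (Suc (Suc j)))" "d (Suc j) p = ?w" by (rule exact_SucE[OF w])
      then have "f ?w \<in> K" using fK Suc by metis
      moreover have "f (t (d j z)) \<oplus>\<^bsub>M\<^esub> f ?w = a \<odot>\<^bsub>M\<^esub> f z"
      proof -
        have "t (d j z) \<oplus>\<^bsub>F (Suc j)\<^esub> ?w = a \<odot>\<^bsub>F (Suc j)\<^esub> z"
          using z a tD(1) dD(1) by (simp add: F1.smult_l_minus F1.M.a_lcomm[of "t (d j z)"] F1.M.r_neg)
        moreover have "f (t (d j z) \<oplus>\<^bsub>F (Suc j)\<^esub> ?w) = f (t (d j z)) \<oplus>\<^bsub>M\<^esub> f ?w"
          using fD(2) tD(1)[OF d_closed[OF z]] w Suc by simp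
        ultimately show ?thesis using fD(3)[OF a] z Suc by simp
      qed
      ultimately show ?thesis by metis
    qed
    ultimately show ?thesis unfolding coboundary_mod_def by blast
  qed
qed

text \<open>As a power of \<open>x\<close> kills \<open>N\<close>, that power times any cocycle is a
  coboundary, and \<open>coboundary_mod_cancel\<close> strips the factors \<open>x\<close> one at a
  time. The form of \<open>van\<close> imposes no condition in degree 0.\<close>

lemma vanishing_of_nonzerodivisor:
  assumes K: "submodule K R M" and x: "x \<in> carrier R" and nzd: "nonzerodivisor_mod M K x"
    and van: "\<And>j. i = Suc j \<Longrightarrow> vanishing (plus_multiples M K x) j"
    and xN: "\<And>y. y \<in> carrier N \<Longrightarrow> (x [^] (k::nat)) \<odot>\<^bsub>N\<^esub> y = \<zero>\<^bsub>N\<^esub>"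
  shows "vanishing K i"
  unfolding vanishing_def
proof (intro allI impI)
  fix f assume f: "cocycle_mod K i f"
  then have fl: "linear_map R (F i) M f" unfolding cocycle_mod_def by blast
  have "coboundary_mod K i f" if "coboundary_mod K i (\<lambda>z. (x [^] k) \<odot>\<^bsub>M\<^esub> f z)" for k :: nat
    using that
  proof (induction k)
    case 0
    then show ?case by (rule coboundary_mod_cong) (simp add: linear_mapD(1)[OF fl])
  next
    case (Suc k)
    have eq: "(x [^] Suc k) \<odot>\<^bsub>M\<^esub> f z = x \<odot>\<^bsub>M\<^esub> ((x [^] k) \<odot>\<^bsub>M\<^esub> f z)" if "z \<in> carrier (F i)" for z
    proof -
      have "x [^] Suc k = x \<otimes> x [^] k" using x by (simp add: R.m_comm)
      then show ?thesis using x linear_mapD(1)[OF fl that] by (simp only: smult_assoc1 R.nat_pow_closed)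
    qed
    have "coboundary_mod K i (\<lambda>z. x \<odot>\<^bsub>M\<^esub> ((x [^] k) \<odot>\<^bsub>M\<^esub> f z))"
      by (rule coboundary_mod_cong[OF Suc(2)]) (rule eq)
    then have "coboundary_mod K i (\<lambda>z. (x [^] k) \<odot>\<^bsub>M\<^esub> f z)"
      by (intro coboundary_mod_cancel[OF K x nzd van linear_map_smult[OF module_axioms fl R.nat_pow_closed[OF x]]])
    then show ?case by (rule Suc(1))
  qed
  then show "coboundary_mod K i f"
    using annihilator_coboundary[OF K R.nat_pow_closed[OF x] xN f] by blast
qed

text \<open>The step \<open>H\<^sup>i(M/K) \<rightarrow> H\<^sup>i(M/(K + xM)) \<rightarrow> H\<^sup>i\<^sup>+\<^sup>1(M/K)\<close> of the long exact sequence.\<close>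

lemma vanishing_plus_multiples:
  assumes K: "submodule K R M" and x: "x \<in> carrier R" and nzd: "nonzerodivisor_mod M K x"
    and van: "vanishing K i" "vanishing K (Suc i)"
  shows "vanishing (plus_multiples M K x) i"
  unfolding vanishing_def
proof (intro allI impI)
  fix f assume "cocycle_mod (plus_multiples M K x) i f"
  then have fl: "linear_map R (F i) M f"
    and fK: "\<And>z. z \<in> carrier (F (Suc i)) \<Longrightarrow> f (d i z) \<in> plus_multiples M K x" unfolding cocycle_mod_def by auto
  note fD = linear_mapD[OF fl] and K' = submodule_memD[OF K] and dD = linear_mapD[OF d_linear[of i]]
  \<comment> \<open>The connecting map: \<open>g\<close> is the quotient of \<open>f d\<close> by
    \<open>x\<close>, chosen linearly modulo \<open>K\<close>.\<close>
  have "\<exists>g. linear_map R (F (Suc i)) M g \<and> (\<forall>z\<in>carrier (F (Suc i)). \<exists>k\<in>K. f (d i z) = x \<odot>\<^bsub>M\<^esub> g z \<oplus>\<^bsub>M\<^esub> k)"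
  proof (rule free_module_select[OF F_free module_axioms])
    fix z assume "z \<in> carrier (F (Suc i))"
    then show "\<exists>m\<in>carrier M. \<exists>k\<in>K. f (d i z) = x \<odot>\<^bsub>M\<^esub> m \<oplus>\<^bsub>M\<^esub> k"
      using fK[of z] unfolding plus_multiples_def by auto
  next
    show "\<exists>k\<in>K. f (d i \<zero>\<^bsub>F (Suc i)\<^esub>) = x \<odot>\<^bsub>M\<^esub> \<zero>\<^bsub>M\<^esub> \<oplus>\<^bsub>M\<^esub> k"
      using K'(2) x linear_map_zero[OF F_module module_axioms fl] linear_map_zero[OF F_module F_module d_linear]
      by (intro bexI[of _ "\<zero>\<^bsub>M\<^esub>"]) auto
  next
    fix z p w q
    assume zw: "z \<in> carrier (F (Suc i))" "w \<in> carrier (F (Suc i))" and pq: "p \<in> carrier M" "q \<in> carrier M"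
      and "\<exists>k\<in>K. f (d i z) = x \<odot>\<^bsub>M\<^esub> p \<oplus>\<^bsub>M\<^esub> k" "\<exists>k\<in>K. f (d i w) = x \<odot>\<^bsub>M\<^esub> q \<oplus>\<^bsub>M\<^esub> k"
    then obtain k l where kl: "k \<in> K" "l \<in> K" "f (d i z) = x \<odot>\<^bsub>M\<^esub> p \<oplus>\<^bsub>M\<^esub> k" "f (d i w) = x \<odot>\<^bsub>M\<^esub> q \<oplus>\<^bsub>M\<^esub> l"
      by blast
    have "f (d i (z \<oplus>\<^bsub>F (Suc i)\<^esub> w)) = x \<odot>\<^bsub>M\<^esub> (p \<oplus>\<^bsub>M\<^esub> q) \<oplus>\<^bsub>M\<^esub> (k \<oplus>\<^bsub>M\<^esub> l)"
      using zw pq kl x K'(1) by (simp add: fD(2) dD(1,2) smult_r_distr M.a_ac)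
    then show "\<exists>k\<in>K. f (d i (z \<oplus>\<^bsub>F (Suc i)\<^esub> w)) = x \<odot>\<^bsub>M\<^esub> (p \<oplus>\<^bsub>M\<^esub> q) \<oplus>\<^bsub>M\<^esub> k"
      using K'(3)[OF kl(1,2)] by blast
  next
    fix r z p
    assume r: "r \<in> carrier R" and z: "z \<in> carrier (F (Suc i))" and p: "p \<in> carrier M"
      and "\<exists>k\<in>K. f (d i z) = x \<odot>\<^bsub>M\<^esub> p \<oplus>\<^bsub>M\<^esub> k"
    then obtain k where k: "k \<in> K" "f (d i z) = x \<odot>\<^bsub>M\<^esub> p \<oplus>\<^bsub>M\<^esub> k" by blast
    have "f (d i (r \<odot>\<^bsub>F (Suc i)\<^esub> z)) = x \<odot>\<^bsub>M\<^esub> (r \<odot>\<^bsub>M\<^esub> p) \<oplus>\<^bsub>M\<^esub> r \<odot>\<^bsub>M\<^esub> k"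
      using z p k x r K'(1) by (simp add: fD(3) dD(1,3) smult_r_distr smult_assoc1[symmetric] R.m_comm)
    then show "\<exists>k\<in>K. f (d i (r \<odot>\<^bsub>F (Suc i)\<^esub> z)) = x \<odot>\<^bsub>M\<^esub> (r \<odot>\<^bsub>M\<^esub> p) \<oplus>\<^bsub>M\<^esub> k"
      using K'(4)[OF r k(1)] by blast
  qed
  then obtain g where g: "linear_map R (F (Suc i)) M g"
    and fg: "\<And>z. z \<in> carrier (F (Suc i)) \<Longrightarrow> \<exists>k\<in>K. f (d i z) = x \<odot>\<^bsub>M\<^esub> g z \<oplus>\<^bsub>M\<^esub> k" by blast
  note gD = linear_mapD[OF g]
  \<comment> \<open>From \<open>d d = 0\<close> follows that \<open>x g d\<close> has values in
    \<open>K\<close>, and \<open>x\<close> is a nonzerodivisor modulo \<open>K\<close>.\<close>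
  have "cocycle_mod K (Suc i) g"
    unfolding cocycle_mod_def
  proof (intro conjI g ballI)
    fix z assume z: "z \<in> carrier (F (Suc (Suc i)))"
    obtain k where k: "k \<in> K" "f (d i (d (Suc i) z)) = x \<odot>\<^bsub>M\<^esub> g (d (Suc i) z) \<oplus>\<^bsub>M\<^esub> k"
      using fg[OF d_closed[OF z]] by blast
    then have "x \<odot>\<^bsub>M\<^esub> g (d (Suc i) z) \<oplus>\<^bsub>M\<^esub> k = \<zero>\<^bsub>M\<^esub>"
      using d_d[OF z] linear_map_zero[OF F_module module_axioms fl] by simp
    then have "x \<odot>\<^bsub>M\<^esub> g (d (Suc i) z) \<in> K"
      using submodule_add_cancel[OF K _ k(1), of "x \<odot>\<^bsub>M\<^esub> g (d (Suc i) z)"] gD(1)[OF d_closed[OF z]] x K'(2) by simp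
    then show "g (d (Suc i) z) \<in> K" using nzd gD(1)[OF d_closed[OF z]] unfolding nonzerodivisor_mod_def by blast
  qed
  then obtain b where b: "bnd (Suc i) b" and gb: "\<And>z. z \<in> carrier (F (Suc i)) \<Longrightarrow> \<exists>k\<in>K. g z = b z \<oplus>\<^bsub>M\<^esub> k"
    using van(2) unfolding vanishing_def coboundary_mod_def by blast
  obtain h where h: "linear_map R (F i) M h" and bh: "\<And>z. z \<in> carrier (F (Suc i)) \<Longrightarrow> b z = h (d i z)"
    using b bnd_SucE by metis
  note hD = linear_mapD[OF h]
  \<comment> \<open>With \<open>g = h d\<close> modulo \<open>K\<close>, the correction by
    \<open>x h\<close> turns \<open>f\<close> into a cocycle modulo \<open>K\<close> itself, to
    which vanishing in degree \<open>i\<close> applies.\<close>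
  have "cocycle_mod K i (\<lambda>z. f z \<oplus>\<^bsub>M\<^esub> (\<ominus> x) \<odot>\<^bsub>M\<^esub> h z)"
    unfolding cocycle_mod_def
  proof (intro conjI ballI)
    show "linear_map R (F i) M (\<lambda>z. f z \<oplus>\<^bsub>M\<^esub> (\<ominus> x) \<odot>\<^bsub>M\<^esub> h z)"
      using x by (intro linear_map_add linear_map_smult module_axioms fl h) simp
    fix z assume z: "z \<in> carrier (F (Suc i))"
    obtain k where k: "k \<in> K" "f (d i z) = x \<odot>\<^bsub>M\<^esub> g z \<oplus>\<^bsub>M\<^esub> k" using fg[OF z] by blast
    obtain l where l: "l \<in> K" "g z = h (d i z) \<oplus>\<^bsub>M\<^esub> l" using gb[OF z] bh[OF z] by metis
    note hM = hD(1)[OF d_closed[OF z]]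
    have "f (d i z) \<oplus>\<^bsub>M\<^esub> (\<ominus> x) \<odot>\<^bsub>M\<^esub> h (d i z) =
        (x \<odot>\<^bsub>M\<^esub> h (d i z) \<oplus>\<^bsub>M\<^esub> (\<ominus> x) \<odot>\<^bsub>M\<^esub> h (d i z)) \<oplus>\<^bsub>M\<^esub> (x \<odot>\<^bsub>M\<^esub> l \<oplus>\<^bsub>M\<^esub> k)"
      using k l x hM K'(1) by (simp add: smult_r_distr M.a_ac)
    also have "\<dots> = x \<odot>\<^bsub>M\<^esub> l \<oplus>\<^bsub>M\<^esub> k" using k l x hM K'(1) by (simp add: smult_add_neg)
    finally show "f (d i z) \<oplus>\<^bsub>M\<^esub> (\<ominus> x) \<odot>\<^bsub>M\<^esub> h (d i z) \<in> K" using K'(3)[OF K'(4)[OF x l(1)] k(1)] by simp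
  qed
  then obtain b' where b': "bnd i b'"
    and fb: "\<And>z. z \<in> carrier (F i) \<Longrightarrow> \<exists>k\<in>K. f z \<oplus>\<^bsub>M\<^esub> (\<ominus> x) \<odot>\<^bsub>M\<^esub> h z = b' z \<oplus>\<^bsub>M\<^esub> k"
    using van(1) unfolding vanishing_def coboundary_mod_def by blast
  \<comment> \<open>Adding \<open>x h\<close> back changes the values only by multiples of
    \<open>x\<close>.\<close>
  have "\<exists>k\<in>plus_multiples M K x. f z = b' z \<oplus>\<^bsub>M\<^esub> k" if z: "z \<in> carrier (F i)" for z
  proof -
    obtain k where k: "k \<in> K" "f z \<oplus>\<^bsub>M\<^esub> (\<ominus> x) \<odot>\<^bsub>M\<^esub> h z = b' z \<oplus>\<^bsub>M\<^esub> k" using fb[OF z] by blast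
    note [simp] = fD(1)[OF z] hD(1)[OF z] K'(1)[OF k(1)] linear_mapD(1)[OF bnd_linear[OF b'] z] x
    have "f z = (f z \<oplus>\<^bsub>M\<^esub> (\<ominus> x) \<odot>\<^bsub>M\<^esub> h z) \<oplus>\<^bsub>M\<^esub> x \<odot>\<^bsub>M\<^esub> h z"
      by (simp add: smult_l_minus M.a_assoc M.l_neg)
    also have "\<dots> = b' z \<oplus>\<^bsub>M\<^esub> (x \<odot>\<^bsub>M\<^esub> h z \<oplus>\<^bsub>M\<^esub> k)" using k(2) by (simp add: M.a_ac)
    finally show ?thesis unfolding plus_multiples_def using k(1) hD(1)[OF z] by blast
  qed
  then show "coboundary_mod (plus_multiples M K x) i f" unfolding coboundary_mod_def using b' by blast
qed

end

section \<open>Prime ideals, annihilators and support\<close>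

lemma (in noetherian_ring) ideal_family_maximal:
  assumes "C \<noteq> {}" "\<And>J. J \<in> C \<Longrightarrow> ideal J R"
  shows "\<exists>J\<in>C. \<forall>L\<in>C. J \<subseteq> L \<longrightarrow> L = J"
proof (rule subset_Zorn_nonempty[OF assms(1)])
  fix D assume D: "D \<noteq> {}" "subset.chain C D"
  have sub: "C \<subseteq> {I. ideal I R}" using assms(2) by auto
  have "subset.chain {I. ideal I R} D" using D(2) sub unfolding subset_chain_def by auto
  then have "\<Union>D \<in> D" by (rule ideal_chain_is_trivial[OF D(1)])
  then show "\<Union>D \<in> C" using D(2) unfolding subset_chain_def by auto
qed

text \<open>One element outside \<open>P\<close> is taken from each ideal; primality keeps the
  product of them outside \<open>P\<close>.\<close>

lemma (in cring) prime_not_containing_Inter: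
  assumes "primeideal P R" "finite S" "\<And>J. J \<in> S \<Longrightarrow> ideal J R" "\<And>J. J \<in> S \<Longrightarrow> \<not> J \<subseteq> P"
  shows "\<exists>a\<in>carrier R. a \<notin> P \<and> (\<forall>J\<in>S. a \<in> J)"
  using assms(2-)
proof (induction S rule: finite_induct)
  case empty
  interpret P: primeideal P R by fact
  have "P \<noteq> carrier R" using P.I_notcarr by blast
  then show ?case using P.a_subset by auto
next
  case (insert L S)
  interpret P: primeideal P R by fact
  obtain a where a: "a \<in> carrier R" "a \<notin> P" "\<And>J. J \<in> S \<Longrightarrow> a \<in> J" using insert by auto
  obtain b where b: "b \<in> L" "b \<notin> P" using insert(5)[of L] by auto
  have L: "ideal L R" using insert(4) by simp
  have bR: "b \<in> carrier R" using ideal_memD(1)[OF L b(1)] .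
  have "a \<otimes> b \<notin> P" using P.I_prime[OF a(1) bR] a b by auto
  moreover have "a \<otimes> b \<in> L" using ideal_memD(4)[OF L a(1) b(1)] .
  moreover have "a \<otimes> b \<in> J" if "J \<in> S" for J
    using ideal_memD(5)[OF insert(4) bR a(3)] that by simp
  ultimately show ?case using a(1) bR by (intro bexI[of _ "a \<otimes> b"]) auto
qed

text \<open>If the element \<open>x\<close> found for \<open>S\<close> happens to lie in the new
  prime \<open>Q\<close>, it is corrected by some \<open>y\<close> that lies in \<open>I\<close> and
  in all members of \<open>S\<close> but not in \<open>Q\<close>. Incomparability provides
  \<open>y\<close>; in the application the primes are maximal annihilators, hence
  incomparable.\<close>

lemma (in cring) prime_avoidance_antichain:
  assumes "finite S" "ideal I R" "\<And>P. P \<in> S \<Longrightarrow> primeideal P R"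
    "\<And>P Q. P \<in> S \<Longrightarrow> Q \<in> S \<Longrightarrow> P \<subseteq> Q \<Longrightarrow> P = Q" "\<And>P. P \<in> S \<Longrightarrow> \<not> I \<subseteq> P"
  shows "\<exists>x\<in>I. x \<notin> \<Union>S"
  using assms(1,3-)
proof (induction S rule: finite_induct)
  case empty
  then show ?case using ideal_memD(2)[OF assms(2)] by auto
next
  case (insert Q S)
  note I = ideal_memD[OF assms(2)]
  obtain x where x: "x \<in> I" "x \<notin> \<Union>S" using insert by auto
  have prime: "primeideal Q R" using insert by simp
  have idl: "\<And>J. J \<in> insert Q S \<Longrightarrow> ideal J R" using insert(4) primeideal.axioms(1) by blast
  show ?case
  proof (cases "x \<in> Q")
    case True
    have "\<exists>y\<in>carrier R. y \<notin> Q \<and> (\<forall>J\<in>insert I S. y \<in> J)"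
    proof (rule prime_not_containing_Inter[OF prime])
      show "finite (insert I S)" using insert by simp
      fix J assume J: "J \<in> insert I S"
      then show "ideal J R" using idl assms(2) by auto
      \<comment> \<open>A member of \<open>S\<close> inside \<open>Q\<close> would equal
        \<open>Q\<close>, but \<open>Q\<close> is not in \<open>S\<close>.\<close>
      show "\<not> J \<subseteq> Q" using J insert(2,5,6) by (metis insert_iff)
    qed
    then obtain y where y: "y \<in> carrier R" "y \<notin> Q" "y \<in> I" "\<And>J. J \<in> S \<Longrightarrow> y \<in> J" by auto
    have xR: "x \<in> carrier R" using I(1)[OF x(1)] .
    have "x \<oplus> y \<notin> Q"
    proof
      assume "x \<oplus> y \<in> Q"
      then have "\<ominus> x \<oplus> (x \<oplus> y) \<in> Q" using ideal_memD(3,6)[OF idl] True by simp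
      then show False using y xR by (simp add: r_neg1)
    qed
    moreover have "x \<oplus> y \<notin> J" if J: "J \<in> S" for J
    proof
      assume *: "x \<oplus> y \<in> J"
      have JI: "ideal J R" using idl J by simp
      have "\<ominus> y \<oplus> (y \<oplus> x) \<in> J"
        using ideal_memD(3)[OF JI ideal_memD(6)[OF JI y(4)[OF J]] *] a_comm[OF xR y(1)] by simp
      then show False using y xR x(2) J by (auto simp: r_neg1)
    qed
    ultimately show ?thesis using I(3)[OF x(1) y(3)] by auto
  next
    case False
    then show ?thesis using x by auto
  qed
qed

section \<open>Annihilators of elements of \<open>M/K\<close> and associated primes\<close>

definition colon_mod :: "('a, 'r) ring_scheme \<Rightarrow> ('a, 'm) module \<Rightarrow> 'm set \<Rightarrow> 'm \<Rightarrow> 'a set" where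
  "colon_mod R M K m = {r \<in> carrier R. r \<odot>\<^bsub>M\<^esub> m \<in> K}"

context plain_module
begin

lemma ideal_colon_mod:
  assumes "submodule K R M" "m \<in> carrier M"
  shows "ideal (colon_mod R M K m) R"
proof (rule ideal_memI)
  note D = submodule_memD[OF assms(1)]
  show "colon_mod R M K m \<subseteq> carrier R" unfolding colon_mod_def by auto
  show "\<zero> \<in> colon_mod R M K m" unfolding colon_mod_def using assms(2) D(2) by simp
  show "r \<oplus> s \<in> colon_mod R M K m" if "r \<in> colon_mod R M K m" "s \<in> colon_mod R M K m" for r s
    using that D(3) assms(2) unfolding colon_mod_def by (simp add: smult_l_distr)
  show "r \<otimes> s \<in> colon_mod R M K m" if "r \<in> carrier R" "s \<in> colon_mod R M K m" for r s
    using that D(4) assms(2) unfolding colon_mod_def by (simp add: smult_assoc1)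
qed

lemma submodule_transporter:
  assumes "submodule K R M" "a \<in> carrier R"
  shows "submodule {z \<in> carrier M. a \<odot>\<^bsub>M\<^esub> z \<in> K} R M"
proof (rule submodule_memI)
  note D = submodule_memD[OF assms(1)]
  show "\<zero>\<^bsub>M\<^esub> \<in> {z \<in> carrier M. a \<odot>\<^bsub>M\<^esub> z \<in> K}" using D(2) assms(2) by simp
  show "x \<oplus>\<^bsub>M\<^esub> y \<in> {z \<in> carrier M. a \<odot>\<^bsub>M\<^esub> z \<in> K}"
    if "x \<in> {z \<in> carrier M. a \<odot>\<^bsub>M\<^esub> z \<in> K}" "y \<in> {z \<in> carrier M. a \<odot>\<^bsub>M\<^esub> z \<in> K}" for x y
    using that D(3) assms(2) by (simp add: smult_r_distr)
  show "r \<odot>\<^bsub>M\<^esub> x \<in> {z \<in> carrier M. a \<odot>\<^bsub>M\<^esub> z \<in> K}"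
    if "r \<in> carrier R" "x \<in> {z \<in> carrier M. a \<odot>\<^bsub>M\<^esub> z \<in> K}" for r x
    using that D(4) assms(2) smult_swap[of a r x] by simp
qed auto

text \<open>If \<open>b\<close> does not carry \<open>m\<close> into \<open>K\<close>, the
  annihilator of \<open>b m\<close> modulo \<open>K\<close> contains that of \<open>m\<close> and
  equals it by maximality; and \<open>a b\<close> annihilates \<open>m\<close> exactly if
  \<open>a\<close> annihilates \<open>b m\<close>.\<close>

lemma maximal_colon_prime:
  assumes "submodule K R M" "m \<in> carrier M - K"
    and max: "\<And>m'. m' \<in> carrier M - K \<Longrightarrow> colon_mod R M K m \<subseteq> colon_mod R M K m'
      \<Longrightarrow> colon_mod R M K m' = colon_mod R M K m"
  shows "primeideal (colon_mod R M K m) R"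
proof (rule primeidealI)
  note D = submodule_memD[OF assms(1)]
  show "ideal (colon_mod R M K m) R" using ideal_colon_mod assms by auto
  show "cring R" by (rule R.is_cring)
  have "\<one> \<notin> colon_mod R M K m" unfolding colon_mod_def using assms(2) by simp
  then show "carrier R \<noteq> colon_mod R M K m" by auto
  fix a b assume a: "a \<in> carrier R" and b: "b \<in> carrier R" and ab: "a \<otimes> b \<in> colon_mod R M K m"
  show "a \<in> colon_mod R M K m \<or> b \<in> colon_mod R M K m"
  proof (rule disjCI)
    assume "b \<notin> colon_mod R M K m"
    then have m': "b \<odot>\<^bsub>M\<^esub> m \<in> carrier M - K" using assms(2) b unfolding colon_mod_def by auto
    have "colon_mod R M K m \<subseteq> colon_mod R M K (b \<odot>\<^bsub>M\<^esub> m)"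
      unfolding colon_mod_def using b D(4) assms(2) by (auto simp: smult_swap[of _ b m])
    then have "colon_mod R M K (b \<odot>\<^bsub>M\<^esub> m) = colon_mod R M K m" by (rule max[OF m'])
    moreover have "a \<in> colon_mod R M K (b \<odot>\<^bsub>M\<^esub> m)"
      using ab a b assms(2) unfolding colon_mod_def by (simp add: smult_assoc1)
    ultimately show "a \<in> colon_mod R M K m" by simp
  qed
qed

end

context noetherian_module
begin

text \<open>
  Kaplansky's argument: the zero divisors on \<open>M / K\<close> form a finite union of maximal annihilators.
  Finiteness holds because the elements with a maximal annihilator span a finitely generated
  submodule, and the annihilator of a combination of \<open>m\<^sub>1, \<dots>, m\<^sub>k\<close> contains the intersection of
  those of the \<open>m\<^sub>j\<close>.
\<close>

lemma associated_prime_of_zerodivisors: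
  assumes fg: "fin_gen_module R M" and K: "submodule K R M" and I: "ideal I R"
    and zd: "\<And>x. x \<in> I \<Longrightarrow> \<not> nonzerodivisor_mod M K x"
  shows "\<exists>m\<in>carrier M - K. primeideal (colon_mod R M K m) R \<and> I \<subseteq> colon_mod R M K m"
proof -
  let ?c = "colon_mod R M K"
  define S where "S = {m \<in> carrier M - K. \<forall>m'\<in>carrier M - K. ?c m \<subseteq> ?c m' \<longrightarrow> ?c m' = ?c m}"
  have SM: "S \<subseteq> carrier M" unfolding S_def by auto
  have prime: "primeideal (?c m) R" if "m \<in> S" for m
    using that unfolding S_def by (intro maximal_colon_prime[OF K]) simp_all
  have S_K: "m \<in> carrier M - K" if "m \<in> S" for m
    using that unfolding S_def by simp
  have S_max: "?c m' = ?c m" if "m \<in> S" "m' \<in> carrier M - K" "?c m \<subseteq> ?c m'" for m m'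
    using that unfolding S_def by simp
  obtain B where "finite B" "submodule_span R M B = submodule_span R M S"
    using submodule_fin_gen[OF fg span_submodule[OF SM]] by blast
  from span_subset_of_finite[OF SM this]
  obtain S0 where S0: "S0 \<subseteq> S" "finite S0" "submodule_span R M S0 = submodule_span R M S"
    by blast
  \<comment> \<open>If the prime \<open>(K : m)\<close> were not among the annihilators of elements
    of \<open>S0\<close>, it would contain none of them by maximality. Some \<open>a\<close> outside
    it would then lie in all of them and carry the span of \<open>S0\<close>, hence
    \<open>m\<close>, into \<open>K\<close>.\<close>
  have cover: "\<exists>m0\<in>S0. ?c m0 = ?c m" if m: "m \<in> S" for m
  proof (rule ccontr)
    assume no: "\<not> (\<exists>m0\<in>S0. ?c m0 = ?c m)"
    have "\<not> J \<subseteq> ?c m" if J: "J \<in> ?c ` S0" for J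
    proof
      assume le: "J \<subseteq> ?c m"
      obtain m0 where m0: "m0 \<in> S0" "J = ?c m0" using J by auto
      then have "m0 \<in> S" using S0(1) by auto
      then have "?c m = ?c m0" using S_max[OF _ S_K[OF m]] le m0(2) by simp
      then show False using no m0 by auto
    qed
    moreover have "\<And>J. J \<in> ?c ` S0 \<Longrightarrow> ideal J R" using ideal_colon_mod[OF K] S0 SM by blast
    ultimately obtain a where a: "a \<in> carrier R" "a \<notin> ?c m" "\<And>J. J \<in> ?c ` S0 \<Longrightarrow> a \<in> J"
      using R.prime_not_containing_Inter[OF prime[OF m], of "?c ` S0"] S0(2) by auto
    have "S0 \<subseteq> {z \<in> carrier M. a \<odot>\<^bsub>M\<^esub> z \<in> K}"
      using a(3) S0(1) SM unfolding colon_mod_def by auto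
    then have "submodule_span R M S0 \<subseteq> {z \<in> carrier M. a \<odot>\<^bsub>M\<^esub> z \<in> K}"
      by (intro span_minimal submodule_transporter[OF K a(1)])
    then have "a \<odot>\<^bsub>M\<^esub> m \<in> K" using S0(3) span_incl[of S] m by auto
    then show False using a unfolding colon_mod_def by auto
  qed
  have I_cover: "\<exists>P\<in>?c ` S0. x \<in> P" if x: "x \<in> I" for x
  proof -
    have xR: "x \<in> carrier R" using R.ideal_memD(1)[OF I x] .
    obtain m where m: "m \<in> carrier M - K" "x \<in> ?c m"
      using zd[OF x] xR unfolding nonzerodivisor_mod_def colon_mod_def by auto
    \<comment> \<open>The family of annihilators above \<open>(K : m)\<close>. A maximal member
      belongs to an element of \<open>S\<close> and still contains \<open>x\<close>.\<close>
    define C where "C = {J. \<exists>m'\<in>carrier M - K. J = ?c m' \<and> ?c m \<subseteq> ?c m'}"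
    have "C \<noteq> {}" "\<And>J. J \<in> C \<Longrightarrow> ideal J R" unfolding C_def using m ideal_colon_mod[OF K] by auto
    from ideal_family_maximal[OF this] obtain J where J: "J \<in> C" "\<forall>L\<in>C. J \<subseteq> L \<longrightarrow> L = J" by blast
    obtain m' where m': "m' \<in> carrier M - K" "J = ?c m'" "?c m \<subseteq> ?c m'" using J(1) unfolding C_def by auto
    have "?c n = ?c m'" if n: "n \<in> carrier M - K" "?c m' \<subseteq> ?c n" for n
    proof -
      have "?c n \<in> C" unfolding C_def using m'(3) n by auto
      then show ?thesis using J(2) n(2) m'(2) by simp
    qed
    then have "m' \<in> S" unfolding S_def using m'(1) by simp
    then show ?thesis using cover[of m'] m m' by auto
  qed
  have "\<exists>P\<in>?c ` S0. I \<subseteq> P"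
  proof (rule ccontr)
    assume no: "\<not> (\<exists>P\<in>?c ` S0. I \<subseteq> P)"
    have "\<exists>x\<in>I. x \<notin> \<Union>(?c ` S0)"
    proof (rule R.prime_avoidance_antichain[OF _ I])
      show "finite (?c ` S0)" using S0 by simp
      show "\<And>P. P \<in> ?c ` S0 \<Longrightarrow> primeideal P R" using prime S0 by auto
      show "\<And>P. P \<in> ?c ` S0 \<Longrightarrow> \<not> I \<subseteq> P" using no by blast
      fix P Q assume PQ: "P \<in> ?c ` S0" "Q \<in> ?c ` S0" "P \<subseteq> Q"
      then obtain p q where pq: "p \<in> S" "q \<in> S" "P = ?c p" "Q = ?c q" using S0(1) by auto
      then show "P = Q" using S_max[OF pq(1) S_K[OF pq(2)]] PQ(3) by simp
    qed
    then show False using I_cover by auto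
  qed
  then obtain m where "m \<in> S0" "I \<subseteq> ?c m" by auto
  then show ?thesis using S0(1) prime S_K by blast
qed

end

text \<open>The fraction \<open>y / s\<close> is zero exactly if some \<open>u\<close> outside
  \<open>P\<close> kills \<open>y\<close>. So the localization is nonzero exactly if one
  \<open>y\<close> survives every such multiplier.\<close>

lemma (in plain_module) Supp_iff:
  "P \<in> Supp R M \<longleftrightarrow> primeideal P R \<and> (\<exists>y\<in>carrier M. \<forall>u\<in>carrier R - P. u \<odot>\<^bsub>M\<^esub> y \<noteq> \<zero>\<^bsub>M\<^esub>)"
proof (cases "primeideal P R")
  case True
  interpret P: primeideal P R by fact
  let ?X = "prime_loc_pairs R M P" and ?r = "prime_loc_rel R M P"
  have one: "\<one> \<in> carrier R - P" using P.I_notcarr P.one_imp_carrier by blast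
  have mult: "u \<otimes> v \<in> carrier R - P" if "u \<in> carrier R - P" "v \<in> carrier R - P" for u v
    using that P.I_prime by blast
  have z: "(\<zero>\<^bsub>M\<^esub>, \<one>) \<in> ?X" using one unfolding prime_loc_pairs_def by simp
  have rel_zero: "((y, s), (\<zero>\<^bsub>M\<^esub>, \<one>)) \<in> ?r \<longleftrightarrow> (\<exists>u\<in>carrier R - P. u \<odot>\<^bsub>M\<^esub> y = \<zero>\<^bsub>M\<^esub>)"
    if "(y, s) \<in> ?X" for y s
    using that z unfolding prime_loc_rel_def by (auto simp: prime_loc_pairs_def)
  have eqv: "equiv ?X ?r"
  proof (rule equivI)
    show "?r \<subseteq> ?X \<times> ?X" unfolding prime_loc_rel_def by auto
    show "refl_on ?X ?r" using one unfolding refl_on_def prime_loc_rel_def by auto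
    show "sym ?r" by (rule symI) (auto simp: prime_loc_rel_def intro: sym)
    show "trans ?r"
    proof (rule transI)
      fix p q w assume "(p, q) \<in> ?r" "(q, w) \<in> ?r"
      moreover obtain x s y t v r where pq: "p = (x, s)" "q = (y, t)" "w = (v, r)" by (metis surj_pair)
      ultimately obtain a b where X: "(x, s) \<in> ?X" "(y, t) \<in> ?X" "(v, r) \<in> ?X"
        and a: "a \<in> carrier R - P" "a \<odot>\<^bsub>M\<^esub> (t \<odot>\<^bsub>M\<^esub> x) = a \<odot>\<^bsub>M\<^esub> (s \<odot>\<^bsub>M\<^esub> y)"
        and b: "b \<in> carrier R - P" "b \<odot>\<^bsub>M\<^esub> (r \<odot>\<^bsub>M\<^esub> y) = b \<odot>\<^bsub>M\<^esub> (t \<odot>\<^bsub>M\<^esub> v)"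
        unfolding prime_loc_rel_def by auto
      note [simp] = smult_assoc1[symmetric]
      have c: "x \<in> carrier M" "y \<in> carrier M" "v \<in> carrier M" "s \<in> carrier R - P" "t \<in> carrier R - P" "r \<in> carrier R - P"
        using X unfolding prime_loc_pairs_def by auto
      then have cR: "s \<in> carrier R" "t \<in> carrier R" "r \<in> carrier R" "a \<in> carrier R" "b \<in> carrier R" using a b by auto
      \<comment> \<open>The multiplier for transitivity: \<open>a\<close> and \<open>b\<close> come
        from the two given relations, and \<open>t\<close> is the middle denominator.\<close>
      have "(a \<otimes> b \<otimes> t) \<odot>\<^bsub>M\<^esub> (r \<odot>\<^bsub>M\<^esub> x) = (b \<otimes> r) \<odot>\<^bsub>M\<^esub> (a \<odot>\<^bsub>M\<^esub> (t \<odot>\<^bsub>M\<^esub> x))"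
        using c cR by (simp add: R.m_ac)
      also have "\<dots> = (a \<otimes> s) \<odot>\<^bsub>M\<^esub> (b \<odot>\<^bsub>M\<^esub> (r \<odot>\<^bsub>M\<^esub> y))"
        unfolding a(2) using c cR by (simp add: R.m_ac)
      also have "\<dots> = (a \<otimes> b \<otimes> t) \<odot>\<^bsub>M\<^esub> (s \<odot>\<^bsub>M\<^esub> v)"
        unfolding b(2) using c cR by (simp add: R.m_ac)
      finally show "(p, w) \<in> ?r"
        unfolding pq prime_loc_rel_def using X(1,3) mult[OF mult[OF a(1) b(1)] c(5)] by auto
    qed
  qed
  have quot: "A // r = {r `` {a}} \<longleftrightarrow> (\<forall>p\<in>A. r `` {p} = r `` {a})" if "a \<in> A"
    for A :: "('m \<times> 'a) set" and r a
  proof -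
    have "A // r = (\<lambda>p. r `` {p}) ` A" unfolding quotient_def by auto
    moreover have "f ` A = {f a} \<longleftrightarrow> (\<forall>p\<in>A. f p = f a)" for f :: "'m \<times> 'a \<Rightarrow> ('m \<times> 'a) set"
      using that by blast
    ultimately show ?thesis by simp
  qed
  have "zero_module (prime_loc_module R M P) \<longleftrightarrow> ?X // ?r = {?r `` {(\<zero>\<^bsub>M\<^esub>, \<one>)}}"
    unfolding zero_module_def prime_loc_module_def by simp
  also have "\<dots> \<longleftrightarrow> (\<forall>p\<in>?X. ?r `` {p} = ?r `` {(\<zero>\<^bsub>M\<^esub>, \<one>)})"
    by (rule quot[OF z])
  also have "\<dots> \<longleftrightarrow> (\<forall>p\<in>?X. (p, (\<zero>\<^bsub>M\<^esub>, \<one>)) \<in> ?r)"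
    by (intro ball_cong refl eq_equiv_class_iff[OF eqv _ z])
  also have "\<dots> \<longleftrightarrow> (\<forall>y\<in>carrier M. \<exists>u\<in>carrier R - P. u \<odot>\<^bsub>M\<^esub> y = \<zero>\<^bsub>M\<^esub>)"
    using rel_zero one unfolding prime_loc_pairs_def by auto
  finally show ?thesis using True unfolding Supp_def by blast
next
  case False
  then show ?thesis unfolding Supp_def by auto
qed

context noetherian_module
begin

text \<open>Krull's argument: an ideal that is maximal among those containing \<open>A\<close> and
  missing all powers of \<open>x\<close> is prime.\<close>

lemma prime_avoiding_powers:
  assumes A: "ideal A R" and x: "x \<in> carrier R" and pow: "\<And>k::nat. x [^] k \<notin> A"
  shows "\<exists>P. primeideal P R \<and> A \<subseteq> P \<and> x \<notin> P"
proof -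
  define C where "C = {J. ideal J R \<and> A \<subseteq> J \<and> (\<forall>k::nat. x [^] k \<notin> J)}"
  have "C \<noteq> {}" "\<And>J. J \<in> C \<Longrightarrow> ideal J R" unfolding C_def using A pow by auto
  from ideal_family_maximal[OF this] obtain P where PC: "P \<in> C" and max: "\<forall>L\<in>C. P \<subseteq> L \<longrightarrow> L = P" by blast
  have P: "ideal P R" "A \<subseteq> P" "\<And>k::nat. x [^] k \<notin> P" using PC unfolding C_def by auto
  note D = R.ideal_memD[OF P(1)]
  \<comment> \<open>For \<open>a\<close> outside \<open>P\<close> the ideal generated by
    \<open>P\<close> and \<open>a\<close> is strictly larger, so by maximality it contains a power
    of \<open>x\<close>. Multiplying two such powers yields primality.\<close>
  have reach: "\<exists>k::nat. \<exists>r\<in>carrier R. \<exists>p\<in>P. x [^] k = r \<otimes> a \<oplus> p" if a: "a \<in> carrier R" "a \<notin> P" for a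
  proof (rule ccontr)
    assume no: "\<not> ?thesis"
    let ?L = "PIdl a <+>\<^bsub>R\<^esub> P"
    have L: "ideal ?L R" by (intro R.add_ideals R.cgenideal_ideal a P(1))
    have mem: "z \<in> ?L \<longleftrightarrow> (\<exists>r\<in>carrier R. \<exists>p\<in>P. z = r \<otimes> a \<oplus> p)" for z
      unfolding set_add_def' cgenideal_def by auto
    have PL: "P \<subseteq> ?L"
    proof
      fix p assume "p \<in> P"
      then have "p = \<zero> \<otimes> a \<oplus> p" using a D(1) by simp
      then show "p \<in> ?L" using mem \<open>p \<in> P\<close> by blast
    qed
    have "x [^] k \<notin> ?L" for k :: nat using no mem by blast
    then have "?L \<in> C" unfolding C_def using L PL P(2) by blast
    then have "?L = P" using max PL by blast
    moreover have "a = \<one> \<otimes> a \<oplus> \<zero>" using a by simp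
    then have "a \<in> ?L" using mem D(2) by blast
    ultimately show False using a by blast
  qed
  have "primeideal P R"
  proof (rule primeidealI[OF P(1)])
    show "cring R" by (rule R.is_cring)
    show "carrier R \<noteq> P" using P(3)[of 0] by auto
    fix a b assume a: "a \<in> carrier R" and b: "b \<in> carrier R" and ab: "a \<otimes> b \<in> P"
    show "a \<in> P \<or> b \<in> P"
    proof (rule ccontr)
      assume "\<not> (a \<in> P \<or> b \<in> P)"
      then obtain k l :: nat and r s p q where *: "r \<in> carrier R" "p \<in> P" "x [^] k = r \<otimes> a \<oplus> p"
        "s \<in> carrier R" "q \<in> P" "x [^] l = s \<otimes> b \<oplus> q" using reach a b by metis
      have "x [^] (k + l) = (r \<otimes> a \<oplus> p) \<otimes> (s \<otimes> b \<oplus> q)"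
        using x * by (simp add: R.nat_pow_mult[symmetric])
      also have "\<dots> = (r \<otimes> s) \<otimes> (a \<otimes> b) \<oplus> ((r \<otimes> a) \<otimes> q \<oplus> p \<otimes> (s \<otimes> b \<oplus> q))"
        using *(1,4) D(1)[OF *(2)] D(1)[OF *(5)] a b
        by (simp add: R.l_distr R.r_distr R.m_ac R.a_ac)
      also have "\<dots> \<in> P"
      proof (intro D(3))
        show "(r \<otimes> s) \<otimes> (a \<otimes> b) \<in> P" using D(4)[OF _ ab] *(1,4) by simp
        show "(r \<otimes> a) \<otimes> q \<in> P" using D(4)[OF _ *(5)] *(1) a by simp
        show "p \<otimes> (s \<otimes> b \<oplus> q) \<in> P" using D(5)[OF _ *(2)] *(4) b D(1)[OF *(5)] by simp
      qed
      finally show False using P(3) by blast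
    qed
  qed
  moreover have "x \<notin> P" using P(3)[of 1] x by simp
  ultimately show ?thesis using P(2) by blast
qed

end

context plain_module
begin

text \<open>The product of the individual multipliers stays outside the prime. For finitely many
  generators this turns vanishing at \<open>P\<close> into one multiplier that kills the
  module.\<close>

lemma finite_common_annihilator:
  assumes P: "primeideal P R" and "finite Y" "Y \<subseteq> carrier M"
    and "\<And>y. y \<in> Y \<Longrightarrow> \<exists>u\<in>carrier R - P. u \<odot>\<^bsub>M\<^esub> y = \<zero>\<^bsub>M\<^esub>"
  shows "\<exists>u\<in>carrier R - P. \<forall>y\<in>Y. u \<odot>\<^bsub>M\<^esub> y = \<zero>\<^bsub>M\<^esub>"
  using assms(2-)
proof (induction Y rule: finite_induct)
  interpret P: primeideal P R by fact
  case empty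
  show ?case using P.I_notcarr P.one_imp_carrier by auto
next
  interpret P: primeideal P R by fact
  case (insert y Y)
  then obtain u where u: "u \<in> carrier R - P" "\<And>z. z \<in> Y \<Longrightarrow> u \<odot>\<^bsub>M\<^esub> z = \<zero>\<^bsub>M\<^esub>" by auto
  obtain v where v: "v \<in> carrier R - P" "v \<odot>\<^bsub>M\<^esub> y = \<zero>\<^bsub>M\<^esub>" using insert(5)[of y] by auto
  have "u \<otimes> v \<in> carrier R - P" using P.I_prime u v by blast
  moreover have "(u \<otimes> v) \<odot>\<^bsub>M\<^esub> y = \<zero>\<^bsub>M\<^esub>" using u(1) v insert(4) by (simp add: smult_assoc1)
  moreover have "(u \<otimes> v) \<odot>\<^bsub>M\<^esub> z = \<zero>\<^bsub>M\<^esub>" if "z \<in> Y" for z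
    using u v insert(4) that by (auto simp: smult_assoc1 smult_swap[of u v z])
  ultimately show ?case by blast
qed

lemma annihilator_of_generators:
  assumes "a \<in> carrier R" "submodule_span R M Y = carrier M" "Y \<subseteq> carrier M" "\<And>y. y \<in> Y \<Longrightarrow> a \<odot>\<^bsub>M\<^esub> y = \<zero>\<^bsub>M\<^esub>"
    "z \<in> carrier M"
  shows "a \<odot>\<^bsub>M\<^esub> z = \<zero>\<^bsub>M\<^esub>"
proof -
  have "submodule_span R M Y \<subseteq> {z \<in> carrier M. a \<odot>\<^bsub>M\<^esub> z \<in> {\<zero>\<^bsub>M\<^esub>}}"
    using assms by (intro span_minimal submodule_transporter submodule_zero) auto
  then show ?thesis using assms by auto
qed

end

context noetherian_module
begin

text \<open>Otherwise some prime \<open>P\<close> contains the annihilator of the module but not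
  \<open>x\<close>. As \<open>x\<close> is in \<open>I\<close>, this \<open>P\<close> is outside the
  support, so finite generation gives an element outside \<open>P\<close> that annihilates the
  module, a contradiction. It is applied with \<open>N\<close> in the place of
  \<open>M\<close>.\<close>

lemma power_annihilates:
  assumes fg: "fin_gen_module R M" and supp: "Supp R M \<subseteq> prime_vanishing R I" and I: "ideal I R" and x: "x \<in> I"
  shows "\<exists>k::nat. \<forall>y\<in>carrier M. (x [^] k) \<odot>\<^bsub>M\<^esub> y = \<zero>\<^bsub>M\<^esub>"
proof (rule ccontr)
  assume no: "\<not> ?thesis"
  have xR: "x \<in> carrier R" using R.ideal_memD(1)[OF I x] .
  let ?A = "{r \<in> carrier R. \<forall>y\<in>carrier M. r \<odot>\<^bsub>M\<^esub> y = \<zero>\<^bsub>M\<^esub>}"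
  have "ideal ?A R"
    by (rule ideal_memI) (auto simp: smult_l_distr smult_assoc1)
  moreover have "x [^] k \<notin> ?A" for k :: nat using no xR by blast
  ultimately obtain P where P: "primeideal P R" "?A \<subseteq> P" "x \<notin> P"
    using prime_avoiding_powers[of ?A x] xR by blast
  obtain Y where Y: "Y \<subseteq> carrier M" "finite Y" "submodule_span R M Y = carrier M"
    using fg unfolding fin_gen_module_def by auto
  have "P \<notin> Supp R M" using supp P x unfolding prime_vanishing_def by blast
  then have "\<And>y. y \<in> Y \<Longrightarrow> \<exists>u\<in>carrier R - P. u \<odot>\<^bsub>M\<^esub> y = \<zero>\<^bsub>M\<^esub>"
    using P(1) Y(1) Supp_iff by blast
  then obtain u where u: "u \<in> carrier R - P" "\<And>y. y \<in> Y \<Longrightarrow> u \<odot>\<^bsub>M\<^esub> y = \<zero>\<^bsub>M\<^esub>"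
    using finite_common_annihilator[OF P(1) Y(2,1)] by blast
  then have "u \<in> ?A" using annihilator_of_generators[OF _ Y(3,1)] by blast
  then show False using P(2) u(1) by blast
qed

end

section \<open>Nonzero maps from \<open>N\<close> to \<open>M/K\<close>\<close>

context plain_module
begin

text \<open>
  If \<open>span Y\<close> contains a multiple \<open>s N\<close> with \<open>s \<notin> P\<close> and \<open>Y\<close> is smallest with this property, the
  coefficient of a chosen \<open>y0 \<in> Y\<close> is well-defined modulo \<open>P\<close>; this gives a nonzero map \<open>N \<rightarrow> R / P\<close>.
\<close>

lemma relative_coordinate:
  assumes fg: "fin_gen_module R M" and P: "P \<in> Supp R M"
  obtains s y0 L where "s \<in> carrier R - P" "y0 \<in> carrier M" "submodule L R M"
    "\<And>z. z \<in> carrier M \<Longrightarrow> \<exists>c\<in>carrier R. \<exists>w\<in>L. s \<odot>\<^bsub>M\<^esub> z = c \<odot>\<^bsub>M\<^esub> y0 \<oplus>\<^bsub>M\<^esub> w"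
    "\<And>a. a \<in> carrier R \<Longrightarrow> a \<odot>\<^bsub>M\<^esub> y0 \<in> L \<Longrightarrow> a \<in> P"
proof -
  have prime: "primeideal P R" using P Supp_iff by blast
  interpret P: primeideal P R by (rule prime)
  obtain y where y: "y \<in> carrier M" "\<And>u. u \<in> carrier R - P \<Longrightarrow> u \<odot>\<^bsub>M\<^esub> y \<noteq> \<zero>\<^bsub>M\<^esub>" using P Supp_iff by blast
  \<comment> \<open>In other words, \<open>k\<close> elements generate the localization at
    \<open>P\<close>.\<close>
  define Q where "Q k \<longleftrightarrow> (\<exists>Y s. Y \<subseteq> carrier M \<and> finite Y \<and> card Y = k \<and> s \<in> carrier R - P \<and>
    (\<forall>z\<in>carrier M. s \<odot>\<^bsub>M\<^esub> z \<in> submodule_span R M Y))" for k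
  obtain Y0 where Y0: "Y0 \<subseteq> carrier M" "finite Y0" "submodule_span R M Y0 = carrier M"
    using fg unfolding fin_gen_module_def by auto
  have "\<one> \<in> carrier R - P" using P.I_notcarr P.one_imp_carrier by blast
  then have "Q (card Y0)" unfolding Q_def using Y0 by (intro exI[of _ Y0] exI[of _ \<one>]) auto
  then have "Q (LEAST k. Q k)" by (rule LeastI)
  then obtain Y s where Y: "Y \<subseteq> carrier M" "finite Y" "card Y = (LEAST k. Q k)" "s \<in> carrier R - P"
    "\<And>z. z \<in> carrier M \<Longrightarrow> s \<odot>\<^bsub>M\<^esub> z \<in> submodule_span R M Y" unfolding Q_def by blast
  \<comment> \<open>Membership of \<open>P\<close> in the support is used here: with no generators,
    \<open>s\<close> would kill the surviving element \<open>y\<close>.\<close>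
  have "Y \<noteq> {}"
  proof
    assume "Y = {}"
    then have "s \<odot>\<^bsub>M\<^esub> y = \<zero>\<^bsub>M\<^esub>" using Y(5)[OF y(1)] span_empty by auto
    then show False using y(2) Y(4) by blast
  qed
  then obtain y0 where y0: "y0 \<in> Y" by blast
  let ?Y = "Y - {y0}"
  have Yins: "Y = insert y0 ?Y" using y0 by auto
  have sub: "?Y \<subseteq> carrier M" "y0 \<in> carrier M" using Y y0 by auto
  note L = span_submodule[OF sub(1)]
  have coord: "\<exists>c\<in>carrier R. \<exists>w\<in>submodule_span R M ?Y. s \<odot>\<^bsub>M\<^esub> z = c \<odot>\<^bsub>M\<^esub> y0 \<oplus>\<^bsub>M\<^esub> w" if "z \<in> carrier M" for z
    using Y(5)[OF that] span_insert[OF sub(2,1)] Yins by auto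
  have "a \<in> P" if a: "a \<in> carrier R" "a \<odot>\<^bsub>M\<^esub> y0 \<in> submodule_span R M ?Y" for a
  proof (rule ccontr)
    assume "a \<notin> P"
    then have as: "a \<otimes> s \<in> carrier R - P" using a Y(4) P.I_prime by blast
    have "(a \<otimes> s) \<odot>\<^bsub>M\<^esub> z \<in> submodule_span R M ?Y" if z: "z \<in> carrier M" for z
    proof -
      obtain c w where cw: "c \<in> carrier R" "w \<in> submodule_span R M ?Y" "s \<odot>\<^bsub>M\<^esub> z = c \<odot>\<^bsub>M\<^esub> y0 \<oplus>\<^bsub>M\<^esub> w"
        using coord[OF z] by blast
      have "(a \<otimes> s) \<odot>\<^bsub>M\<^esub> z = c \<odot>\<^bsub>M\<^esub> (a \<odot>\<^bsub>M\<^esub> y0) \<oplus>\<^bsub>M\<^esub> a \<odot>\<^bsub>M\<^esub> w"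
        using cw a Y(4) z sub submodule_memD(1)[OF L] by (simp add: smult_assoc1 smult_r_distr smult_swap[of a c])
      then show ?thesis using submodule_memD(3,4)[OF L] cw a by simp
    qed
    then have "Q (card ?Y)" unfolding Q_def using sub Y(2) as by blast
    then have "card Y \<le> card ?Y" using Y(3) Least_le by simp
    then show False using y0 Y(2) by (metis card_Diff1_less leD)
  qed
  then show thesis using that[OF Y(4) sub(2) L coord] by blast
qed

end

text \<open>For \<open>P = (K : m)\<close> the map \<open>c -> c m\<close> embeds \<open>R/P\<close>
  into \<open>M/K\<close>. Composed with the coordinate along \<open>y0\<close>, which is well
  defined modulo \<open>P\<close>, and with \<open>e\<close>, it lifts to a 0-cocycle. This cocycle
  is nonzero because the coordinate of \<open>y0\<close> is the class of \<open>s\<close>, which is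
  outside \<open>P\<close>.\<close>

lemma (in resolution_coeffs) not_vanishing_0:
  assumes noeth: "noetherian_ring R" and fg: "fin_gen_module R N" and K: "submodule K R M"
    and m: "m \<in> carrier M - K" and P: "colon_mod R M K m \<in> Supp R N"
  shows "\<not> vanishing K 0"
proof
  assume van: "vanishing K 0"
  interpret N: noetherian_module R N using N_module noeth by (simp add: noetherian_module_def plain_module_def)
  let ?P = "colon_mod R M K m"
  obtain s y0 L where s: "s \<in> carrier R - ?P" and y0: "y0 \<in> carrier N" and L: "submodule L R N"
    and coord: "\<And>z. z \<in> carrier N \<Longrightarrow> \<exists>c\<in>carrier R. \<exists>w\<in>L. s \<odot>\<^bsub>N\<^esub> z = c \<odot>\<^bsub>N\<^esub> y0 \<oplus>\<^bsub>N\<^esub> w"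
    and inP: "\<And>a. a \<in> carrier R \<Longrightarrow> a \<odot>\<^bsub>N\<^esub> y0 \<in> L \<Longrightarrow> a \<in> ?P"
    using N.relative_coordinate[OF fg P] by metis
  note L' = N.submodule_memD[OF L] and eD = linear_mapD[OF e_linear]
  have sR: "s \<in> carrier R" and mM: "m \<in> carrier M" using s m by auto
  \<comment> \<open>The relation keeps every admissible coordinate \<open>c\<close>; they differ by
    elements of \<open>P\<close>, so the values \<open>c m\<close> differ by elements of
    \<open>K\<close>.\<close>
  let ?T = "\<lambda>z p. \<exists>c\<in>carrier R. \<exists>w\<in>L. s \<odot>\<^bsub>N\<^esub> e z = c \<odot>\<^bsub>N\<^esub> y0 \<oplus>\<^bsub>N\<^esub> w \<and> p = c \<odot>\<^bsub>M\<^esub> m"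
  have "\<exists>f. linear_map R (F 0) M f \<and> (\<forall>z\<in>carrier (F 0). ?T z (f z))"
  proof (rule free_module_select[OF F_free module_axioms])
    fix z assume "z \<in> carrier (F 0)"
    then obtain c w where "c \<in> carrier R" "w \<in> L" "s \<odot>\<^bsub>N\<^esub> e z = c \<odot>\<^bsub>N\<^esub> y0 \<oplus>\<^bsub>N\<^esub> w"
      using coord[OF eD(1)] by blast
    then show "\<exists>p\<in>carrier M. ?T z p" by (intro bexI[of _ "c \<odot>\<^bsub>M\<^esub> m"]) (auto intro: mM)
  next
    have "s \<odot>\<^bsub>N\<^esub> e \<zero>\<^bsub>F 0\<^esub> = \<zero> \<odot>\<^bsub>N\<^esub> y0 \<oplus>\<^bsub>N\<^esub> \<zero>\<^bsub>N\<^esub>" "\<zero>\<^bsub>M\<^esub> = \<zero> \<odot>\<^bsub>M\<^esub> m"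
      using linear_map_zero[OF F_module N_module e_linear] sR y0 mM by simp_all
    then show "?T \<zero>\<^bsub>F 0\<^esub> \<zero>\<^bsub>M\<^esub>" using L'(2) R.zero_closed by blast
  next
    fix z p w q assume zw: "z \<in> carrier (F 0)" "w \<in> carrier (F 0)" and "?T z p" "?T w q"
    then obtain c k b l where *: "c \<in> carrier R" "k \<in> L" "s \<odot>\<^bsub>N\<^esub> e z = c \<odot>\<^bsub>N\<^esub> y0 \<oplus>\<^bsub>N\<^esub> k" "p = c \<odot>\<^bsub>M\<^esub> m"
      "b \<in> carrier R" "l \<in> L" "s \<odot>\<^bsub>N\<^esub> e w = b \<odot>\<^bsub>N\<^esub> y0 \<oplus>\<^bsub>N\<^esub> l" "q = b \<odot>\<^bsub>M\<^esub> m" by blast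
    have "s \<odot>\<^bsub>N\<^esub> e (z \<oplus>\<^bsub>F 0\<^esub> w) = s \<odot>\<^bsub>N\<^esub> e z \<oplus>\<^bsub>N\<^esub> s \<odot>\<^bsub>N\<^esub> e w"
      using zw sR eD by (simp add: N.smult_r_distr)
    also have "\<dots> = (c \<oplus> b) \<odot>\<^bsub>N\<^esub> y0 \<oplus>\<^bsub>N\<^esub> (k \<oplus>\<^bsub>N\<^esub> l)"
      unfolding *(3,7) using *(1,5) L'(1)[OF *(2)] L'(1)[OF *(6)] y0
      by (simp add: N.smult_l_distr N.M.a_ac)
    finally have "s \<odot>\<^bsub>N\<^esub> e (z \<oplus>\<^bsub>F 0\<^esub> w) = (c \<oplus> b) \<odot>\<^bsub>N\<^esub> y0 \<oplus>\<^bsub>N\<^esub> (k \<oplus>\<^bsub>N\<^esub> l)" .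
    moreover have "p \<oplus>\<^bsub>M\<^esub> q = (c \<oplus> b) \<odot>\<^bsub>M\<^esub> m" using * mM by (simp add: smult_l_distr)
    ultimately show "?T (z \<oplus>\<^bsub>F 0\<^esub> w) (p \<oplus>\<^bsub>M\<^esub> q)" using L'(3)[OF *(2,6)] R.a_closed[OF *(1,5)] by blast
  next
    fix r z p assume r: "r \<in> carrier R" and z: "z \<in> carrier (F 0)" and "?T z p"
    then obtain c k where *: "c \<in> carrier R" "k \<in> L" "s \<odot>\<^bsub>N\<^esub> e z = c \<odot>\<^bsub>N\<^esub> y0 \<oplus>\<^bsub>N\<^esub> k" "p = c \<odot>\<^bsub>M\<^esub> m" by blast
    have "s \<odot>\<^bsub>N\<^esub> e (r \<odot>\<^bsub>F 0\<^esub> z) = r \<odot>\<^bsub>N\<^esub> (s \<odot>\<^bsub>N\<^esub> e z)"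
      using z r sR eD by (simp add: N.smult_swap[of s r])
    also have "\<dots> = (r \<otimes> c) \<odot>\<^bsub>N\<^esub> y0 \<oplus>\<^bsub>N\<^esub> r \<odot>\<^bsub>N\<^esub> k"
      unfolding *(3) using *(1) L'(1)[OF *(2)] y0 r by (simp add: N.smult_assoc1 N.smult_r_distr)
    finally have "s \<odot>\<^bsub>N\<^esub> e (r \<odot>\<^bsub>F 0\<^esub> z) = (r \<otimes> c) \<odot>\<^bsub>N\<^esub> y0 \<oplus>\<^bsub>N\<^esub> r \<odot>\<^bsub>N\<^esub> k" .
    moreover have "r \<odot>\<^bsub>M\<^esub> p = (r \<otimes> c) \<odot>\<^bsub>M\<^esub> m" using * mM r by (simp add: smult_assoc1)
    ultimately show "?T (r \<odot>\<^bsub>F 0\<^esub> z) (r \<odot>\<^bsub>M\<^esub> p)" using L'(4)[OF r *(2)] R.m_closed[OF r *(1)] by blast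
  qed
  then obtain f where f: "linear_map R (F 0) M f" and fT: "\<And>z. z \<in> carrier (F 0) \<Longrightarrow> ?T z (f z)" by blast
  have "cocycle_mod K 0 f"
    unfolding cocycle_mod_def
  proof (intro conjI f ballI)
    fix z assume z: "z \<in> carrier (F (Suc 0))"
    have "d 0 z \<in> d 0 ` carrier (F (Suc 0))" using z by simp
    then have "e (d 0 z) = \<zero>\<^bsub>N\<^esub>" unfolding exact_0 by simp
    moreover obtain c w where c: "c \<in> carrier R" "w \<in> L" "s \<odot>\<^bsub>N\<^esub> e (d 0 z) = c \<odot>\<^bsub>N\<^esub> y0 \<oplus>\<^bsub>N\<^esub> w" "f (d 0 z) = c \<odot>\<^bsub>M\<^esub> m"
      using fT[OF d_closed[OF z]] by blast
    ultimately have "c \<odot>\<^bsub>N\<^esub> y0 \<oplus>\<^bsub>N\<^esub> w \<in> L" using sR L'(2) by simp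
    then have "c \<odot>\<^bsub>N\<^esub> y0 \<in> L" using N.submodule_add_cancel[OF L _ c(2)] c(1) y0 by simp
    then have "c \<in> ?P" using inP c(1) by blast
    then show "f (d 0 z) \<in> K" using c(4) unfolding colon_mod_def by simp
  qed
  then obtain b where "bnd 0 b" and fb: "\<And>z. z \<in> carrier (F 0) \<Longrightarrow> \<exists>k\<in>K. f z = b z \<oplus>\<^bsub>M\<^esub> k"
    using van unfolding vanishing_def coboundary_mod_def by blast
  then have b0: "\<And>z. z \<in> carrier (F 0) \<Longrightarrow> b z = \<zero>\<^bsub>M\<^esub>" unfolding bnd_def by simp
  \<comment> \<open>A preimage of \<open>y0\<close>. Its coordinate \<open>c\<close> satisfies
    \<open>s y0 = c y0 + w\<close>, so \<open>s - c\<close> lies in \<open>P\<close>. Vanishing of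
    the class puts \<open>c\<close> into \<open>P\<close>, hence also \<open>s\<close>.\<close>
  obtain z where z: "z \<in> carrier (F 0)" "e z = y0" using e_surj y0 by (metis imageE)
  obtain c w where c: "c \<in> carrier R" "w \<in> L" "s \<odot>\<^bsub>N\<^esub> y0 = c \<odot>\<^bsub>N\<^esub> y0 \<oplus>\<^bsub>N\<^esub> w" "f z = c \<odot>\<^bsub>M\<^esub> m"
    using fT[OF z(1)] z(2) by blast
  have "c \<odot>\<^bsub>M\<^esub> m \<in> K" using fb[OF z(1)] b0[OF z(1)] c(4) submodule_memD(1)[OF K] by auto
  then have cP: "c \<in> ?P" using c(1) unfolding colon_mod_def by simp
  have "(\<ominus> c \<oplus> s) \<odot>\<^bsub>N\<^esub> y0 = \<ominus>\<^bsub>N\<^esub> (c \<odot>\<^bsub>N\<^esub> y0) \<oplus>\<^bsub>N\<^esub> (c \<odot>\<^bsub>N\<^esub> y0 \<oplus>\<^bsub>N\<^esub> w)"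
    using c(1) sR y0 by (simp add: N.smult_l_distr N.smult_l_minus c(3))
  also have "\<dots> = w" using c(1) y0 L'(1)[OF c(2)] by (simp add: N.M.r_neg1)
  finally have "\<ominus> c \<oplus> s \<in> ?P" using inP[of "\<ominus> c \<oplus> s"] c(1,2) sR by simp
  moreover have "ideal ?P R" using ideal_colon_mod[OF K mM] .
  ultimately have "c \<oplus> (\<ominus> c \<oplus> s) \<in> ?P" using cP R.ideal_memD(3) by blast
  then show False using s c(1) sR by (simp add: R.r_neg2)
qed

section \<open>Quotient modules and cyclic modules\<close>

context plain_module
begin

lemma submodule_abelian_subgroup:
  assumes "submodule K R M"
  shows "abelian_subgroup K M"
proof (rule abelian_subgroupI3)
  show "additive_subgroup K M"
    using assms by (intro additive_subgroupI submodule.axioms(1))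
  show "abelian_group M" ..
qed

lemma coset_eq_iff:
  assumes "submodule K R M" "a \<in> carrier M" "b \<in> carrier M"
  shows "K +>\<^bsub>M\<^esub> a = K +>\<^bsub>M\<^esub> b \<longleftrightarrow> (\<exists>k\<in>K. a = k \<oplus>\<^bsub>M\<^esub> b)"
proof -
  interpret K: abelian_subgroup K M by (rule submodule_abelian_subgroup[OF assms(1)])
  have "K +>\<^bsub>M\<^esub> a = K +>\<^bsub>M\<^esub> b \<longleftrightarrow> a \<in> K +>\<^bsub>M\<^esub> b"
    using K.a_rcos_self[OF assms(2)] K.a_repr_independence'[of a b] assms by auto
  then show ?thesis unfolding a_r_coset_def' by auto
qed

text \<open>The union in the scalar multiplication runs over all representatives; since
  \<open>x\<close> maps \<open>K\<close> into itself, they all give the same coset.\<close>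

lemma quot_smult:
  assumes "submodule K R M" "x \<in> carrier R" "m \<in> carrier M"
  shows "x \<odot>\<^bsub>quot_module M K\<^esub> (K +>\<^bsub>M\<^esub> m) = K +>\<^bsub>M\<^esub> (x \<odot>\<^bsub>M\<^esub> m)"
proof -
  note D = submodule_memD[OF assms(1)]
  interpret K: abelian_subgroup K M by (rule submodule_abelian_subgroup[OF assms(1)])
  have "K +>\<^bsub>M\<^esub> (x \<odot>\<^bsub>M\<^esub> c) = K +>\<^bsub>M\<^esub> (x \<odot>\<^bsub>M\<^esub> m)" if c: "c \<in> K +>\<^bsub>M\<^esub> m" for c
  proof -
    obtain k where k: "k \<in> K" "c = k \<oplus>\<^bsub>M\<^esub> m" using c unfolding a_r_coset_def' by auto
    note [simp] = assms(2,3) D(1)[OF k(1)]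
    have "x \<odot>\<^bsub>M\<^esub> c = x \<odot>\<^bsub>M\<^esub> k \<oplus>\<^bsub>M\<^esub> x \<odot>\<^bsub>M\<^esub> m" "x \<odot>\<^bsub>M\<^esub> c \<in> carrier M"
      unfolding k(2) by (simp_all add: smult_r_distr)
    then show ?thesis using coset_eq_iff[OF assms(1), of "x \<odot>\<^bsub>M\<^esub> c" "x \<odot>\<^bsub>M\<^esub> m"] D(4)[OF assms(2) k(1)]
      by auto
  qed
  moreover have "m \<in> K +>\<^bsub>M\<^esub> m" using K.a_rcos_self[OF assms(3)] .
  ultimately have "(\<Union>c\<in>K +>\<^bsub>M\<^esub> m. K +>\<^bsub>M\<^esub> (x \<odot>\<^bsub>M\<^esub> c)) = K +>\<^bsub>M\<^esub> (x \<odot>\<^bsub>M\<^esub> m)"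
    using UN_constant_eq[of m "K +>\<^bsub>M\<^esub> m" "\<lambda>c. K +>\<^bsub>M\<^esub> (x \<odot>\<^bsub>M\<^esub> c)"] by blast
  then show ?thesis unfolding quot_module_def by simp
qed

lemma quot_carrier: "carrier (quot_module M K) = (\<lambda>m. K +>\<^bsub>M\<^esub> m) ` carrier M"
  unfolding quot_module_def A_RCOSETS_def' by auto

lemma quot_add:
  assumes "submodule K R M" "a \<in> carrier M" "b \<in> carrier M"
  shows "(K +>\<^bsub>M\<^esub> a) \<oplus>\<^bsub>quot_module M K\<^esub> (K +>\<^bsub>M\<^esub> b) = K +>\<^bsub>M\<^esub> (a \<oplus>\<^bsub>M\<^esub> b)"
proof -
  interpret K: abelian_subgroup K M by (rule submodule_abelian_subgroup[OF assms(1)])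
  show ?thesis unfolding quot_module_def using K.a_rcos_sum assms by simp
qed

lemma quot_is_module:
  assumes K: "submodule K R M"
  shows "module R (quot_module M K)"
proof (rule moduleI)
  let ?Q = "quot_module M K"
  interpret K: abelian_subgroup K M by (rule submodule_abelian_subgroup[OF K])
  show "cring R" by (rule R.is_cring)
  note simps = quot_smult[OF K] quot_add[OF K]
  have zero: "\<zero>\<^bsub>?Q\<^esub> = K +>\<^bsub>M\<^esub> \<zero>\<^bsub>M\<^esub>"
    unfolding quot_module_def using M.a_coset_add_zero[of K] K.a_subset by simp
  show "abelian_group ?Q"
  proof (rule abelian_groupI)
    fix x assume "x \<in> carrier ?Q"
    then obtain m where m: "m \<in> carrier M" "x = K +>\<^bsub>M\<^esub> m" unfolding quot_carrier by auto
    then have "(K +>\<^bsub>M\<^esub> (\<ominus>\<^bsub>M\<^esub> m)) \<oplus>\<^bsub>?Q\<^esub> x = \<zero>\<^bsub>?Q\<^esub>" using zero by (simp add: simps M.l_neg)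
    then show "\<exists>y\<in>carrier ?Q. y \<oplus>\<^bsub>?Q\<^esub> x = \<zero>\<^bsub>?Q\<^esub>" unfolding quot_carrier using m by blast
  next
    fix x y z assume "x \<in> carrier ?Q" "y \<in> carrier ?Q" "z \<in> carrier ?Q"
    then show "(x \<oplus>\<^bsub>?Q\<^esub> y) \<oplus>\<^bsub>?Q\<^esub> z = x \<oplus>\<^bsub>?Q\<^esub> (y \<oplus>\<^bsub>?Q\<^esub> z)"
      unfolding quot_carrier by (auto simp: simps M.a_assoc)
  next
    fix x y assume "x \<in> carrier ?Q" "y \<in> carrier ?Q"
    then show "x \<oplus>\<^bsub>?Q\<^esub> y = y \<oplus>\<^bsub>?Q\<^esub> x"
      unfolding quot_carrier by (auto simp: simps M.a_comm)
  qed (unfold zero quot_carrier, auto simp: simps)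
  show "a \<odot>\<^bsub>?Q\<^esub> x \<in> carrier ?Q" if "a \<in> carrier R" "x \<in> carrier ?Q" for a x
    using that unfolding quot_carrier by (auto simp: simps)
  show "(a \<oplus> b) \<odot>\<^bsub>?Q\<^esub> x = a \<odot>\<^bsub>?Q\<^esub> x \<oplus>\<^bsub>?Q\<^esub> b \<odot>\<^bsub>?Q\<^esub> x"
    if "a \<in> carrier R" "b \<in> carrier R" "x \<in> carrier ?Q" for a b x
    using that unfolding quot_carrier by (auto simp: simps smult_l_distr)
  show "a \<odot>\<^bsub>?Q\<^esub> (x \<oplus>\<^bsub>?Q\<^esub> y) = a \<odot>\<^bsub>?Q\<^esub> x \<oplus>\<^bsub>?Q\<^esub> a \<odot>\<^bsub>?Q\<^esub> y"
    if "a \<in> carrier R" "x \<in> carrier ?Q" "y \<in> carrier ?Q" for a x y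
    using that unfolding quot_carrier by (auto simp: simps smult_r_distr)
  show "(a \<otimes> b) \<odot>\<^bsub>?Q\<^esub> x = a \<odot>\<^bsub>?Q\<^esub> (b \<odot>\<^bsub>?Q\<^esub> x)"
    if "a \<in> carrier R" "b \<in> carrier R" "x \<in> carrier ?Q" for a b x
    using that unfolding quot_carrier by (auto simp: simps smult_assoc1)
  show "\<one> \<odot>\<^bsub>?Q\<^esub> x = x" if "x \<in> carrier ?Q" for x
    using that unfolding quot_carrier by (auto simp: simps)
qed

lemma inj_on_quot_smult_iff:
  assumes K: "submodule K R M" and x: "x \<in> carrier R"
  shows "inj_on (\<lambda>m. x \<odot>\<^bsub>quot_module M K\<^esub> m) (carrier (quot_module M K)) \<longleftrightarrow> nonzerodivisor_mod M K x"
proof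
  note D = submodule_memD[OF K]
  have K0: "K +>\<^bsub>M\<^esub> m = K +>\<^bsub>M\<^esub> \<zero>\<^bsub>M\<^esub> \<longleftrightarrow> m \<in> K" if "m \<in> carrier M" for m
    using coset_eq_iff[OF K that, of "\<zero>\<^bsub>M\<^esub>"] D(1) by (metis M.r_zero M.zero_closed)
  assume inj: "inj_on (\<lambda>m. x \<odot>\<^bsub>quot_module M K\<^esub> m) (carrier (quot_module M K))"
  show "nonzerodivisor_mod M K x" unfolding nonzerodivisor_mod_def
  proof (intro ballI impI)
    fix m assume m: "m \<in> carrier M" "x \<odot>\<^bsub>M\<^esub> m \<in> K"
    then have "K +>\<^bsub>M\<^esub> (x \<odot>\<^bsub>M\<^esub> m) = K +>\<^bsub>M\<^esub> (x \<odot>\<^bsub>M\<^esub> \<zero>\<^bsub>M\<^esub>)" using K0 x by simp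
    then have "x \<odot>\<^bsub>quot_module M K\<^esub> (K +>\<^bsub>M\<^esub> m) = x \<odot>\<^bsub>quot_module M K\<^esub> (K +>\<^bsub>M\<^esub> \<zero>\<^bsub>M\<^esub>)"
      using quot_smult[OF K x] m by simp
    then have "K +>\<^bsub>M\<^esub> m = K +>\<^bsub>M\<^esub> \<zero>\<^bsub>M\<^esub>"
      using inj_onD[OF inj] m(1) unfolding quot_carrier by blast
    then show "m \<in> K" using K0[OF m(1)] by simp
  qed
next
  note D = submodule_memD[OF K]
  assume nzd: "nonzerodivisor_mod M K x"
  show "inj_on (\<lambda>m. x \<odot>\<^bsub>quot_module M K\<^esub> m) (carrier (quot_module M K))"
  proof (rule inj_onI)
    fix A B assume "A \<in> carrier (quot_module M K)" "B \<in> carrier (quot_module M K)"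
      and eq: "x \<odot>\<^bsub>quot_module M K\<^esub> A = x \<odot>\<^bsub>quot_module M K\<^esub> B"
    then obtain a b where ab: "a \<in> carrier M" "b \<in> carrier M" "A = K +>\<^bsub>M\<^esub> a" "B = K +>\<^bsub>M\<^esub> b"
      unfolding quot_carrier by auto
    then have "K +>\<^bsub>M\<^esub> (x \<odot>\<^bsub>M\<^esub> a) = K +>\<^bsub>M\<^esub> (x \<odot>\<^bsub>M\<^esub> b)" using eq quot_smult[OF K x] by simp
    then obtain k where k: "k \<in> K" "x \<odot>\<^bsub>M\<^esub> a = k \<oplus>\<^bsub>M\<^esub> x \<odot>\<^bsub>M\<^esub> b"
      using coset_eq_iff[OF K, of "x \<odot>\<^bsub>M\<^esub> a" "x \<odot>\<^bsub>M\<^esub> b"] x ab by auto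
    then have "x \<odot>\<^bsub>M\<^esub> a = x \<odot>\<^bsub>M\<^esub> b \<oplus>\<^bsub>M\<^esub> k" using D(1) x ab by (simp add: M.a_comm)
    then obtain k' where "k' \<in> K" "a = b \<oplus>\<^bsub>M\<^esub> k'"
      using nonzerodivisor_mod_cancel[OF K x nzd ab(1,2) k(1)] by blast
    then have "\<exists>k\<in>K. a = k \<oplus>\<^bsub>M\<^esub> b" using D(1) ab M.a_comm by blast
    then show "A = B" using coset_eq_iff[OF K ab(1,2)] ab by simp
  qed
qed

section \<open>The submodules \<open>JM\<close> and regular sequences\<close>

lemma ideal_smult_submodule:
  assumes "J \<subseteq> carrier R"
  shows "submodule (ideal_smult R J M) R M"
  unfolding ideal_smult_def using assms by (intro span_submodule) auto

lemma ideal_smult_mem: "a \<in> J \<Longrightarrow> m \<in> carrier M \<Longrightarrow> a \<odot>\<^bsub>M\<^esub> m \<in> ideal_smult R J M"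
  unfolding ideal_smult_def by (rule subsetD[OF span_incl]) blast

lemma ideal_smult_minimal:
  assumes "submodule K R M" "\<And>a m. a \<in> J \<Longrightarrow> m \<in> carrier M \<Longrightarrow> a \<odot>\<^bsub>M\<^esub> m \<in> K"
  shows "ideal_smult R J M \<subseteq> K"
  unfolding ideal_smult_def using assms by (intro span_minimal) auto

lemma ideal_smult_mono: "J \<subseteq> J' \<Longrightarrow> ideal_smult R J M \<subseteq> ideal_smult R J' M"
  unfolding ideal_smult_def by (rule span_mono) blast

text \<open>The scalars that carry \<open>M\<close> into \<open>K\<close> form an ideal, so it
  suffices to test generators.\<close>

lemma ideal_smult_genideal_minimal:
  assumes K: "submodule K R M" and A: "A \<subseteq> carrier R"
    and "\<And>a m. a \<in> A \<Longrightarrow> m \<in> carrier M \<Longrightarrow> a \<odot>\<^bsub>M\<^esub> m \<in> K"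
  shows "ideal_smult R (Idl A) M \<subseteq> K"
proof -
  note D = submodule_memD[OF K]
  let ?J = "{a \<in> carrier R. \<forall>m\<in>carrier M. a \<odot>\<^bsub>M\<^esub> m \<in> K}"
  have "ideal ?J R"
    by (rule ideal_memI) (use D in \<open>auto simp: smult_l_distr smult_assoc1\<close>)
  moreover have "A \<subseteq> ?J" using assms by auto
  ultimately have "Idl A \<subseteq> ?J" by (rule R.genideal_minimal)
  then show ?thesis using K by (intro ideal_smult_minimal) auto
qed

lemma ideal_smult_empty: "ideal_smult R (Idl {}) M = {\<zero>\<^bsub>M\<^esub>}"
proof
  show "ideal_smult R (Idl {}) M \<subseteq> {\<zero>\<^bsub>M\<^esub>}" by (rule ideal_smult_genideal_minimal[OF submodule_zero]) auto
  have "submodule (ideal_smult R (Idl {}) M) R M"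
    using R.ideal_memD(1)[OF R.genideal_ideal[of "{}"]] by (intro ideal_smult_submodule) auto
  then show "{\<zero>\<^bsub>M\<^esub>} \<subseteq> ideal_smult R (Idl {}) M" using submodule_memD(2) by simp
qed

lemma genideal_smult_submodule:
  assumes "A \<subseteq> carrier R"
  shows "submodule (ideal_smult R (Idl A) M) R M"
  using R.ideal_memD(1)[OF R.genideal_ideal[OF assms]] by (intro ideal_smult_submodule) auto

text \<open>This matches one more element of a regular sequence with one step from \<open>K\<close>
  to \<open>K + xM\<close>.\<close>

lemma ideal_smult_insert:
  assumes "A \<subseteq> carrier R" "x \<in> carrier R"
  shows "ideal_smult R (Idl (insert x A)) M = plus_multiples M (ideal_smult R (Idl A) M) x"
    (is "?L = ?P")
proof
  have ins: "insert x A \<subseteq> carrier R" using assms by auto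
  note K = genideal_smult_submodule[OF assms(1)]
  note D = submodule_memD[OF K]
  show "?L \<subseteq> ?P"
  proof (rule ideal_smult_genideal_minimal[OF submodule_plus_multiples[OF K assms(2)] ins])
    fix a m assume a: "a \<in> insert x A" and m: "m \<in> carrier M"
    show "a \<odot>\<^bsub>M\<^esub> m \<in> ?P"
    proof (cases "a = x")
      case True
      then have "a \<odot>\<^bsub>M\<^esub> m = x \<odot>\<^bsub>M\<^esub> m \<oplus>\<^bsub>M\<^esub> \<zero>\<^bsub>M\<^esub>" using assms m by simp
      then show ?thesis unfolding plus_multiples_def using m D(2) by blast
    next
      case False
      then have "a \<in> Idl A" using a R.genideal_self[OF assms(1)] by auto
      then show ?thesis using ideal_smult_mem[OF _ m] plus_multiples_incl[OF K assms(2)] by blast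
    qed
  qed
  note E = submodule_memD[OF genideal_smult_submodule[OF ins]]
  have self: "insert x A \<subseteq> Idl (insert x A)" by (rule R.genideal_self[OF ins])
  have "Idl A \<subseteq> Idl (insert x A)"
    using self R.genideal_ideal[OF ins] by (intro R.genideal_minimal) auto
  then have sub: "ideal_smult R (Idl A) M \<subseteq> ?L" by (rule ideal_smult_mono)
  show "?P \<subseteq> ?L"
  proof
    fix z assume "z \<in> ?P"
    then obtain m k where z: "z = x \<odot>\<^bsub>M\<^esub> m \<oplus>\<^bsub>M\<^esub> k" "m \<in> carrier M" "k \<in> ideal_smult R (Idl A) M"
      unfolding plus_multiples_def by auto
    have "x \<odot>\<^bsub>M\<^esub> m \<in> ?L" using ideal_smult_mem[of x "Idl (insert x A)" m] self z(2) by simp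
    then show "z \<in> ?L" using E(3) sub z by blast
  qed
qed

lemma regular_sequence_iff:
  assumes "set xs \<subseteq> carrier R"
  shows "regular_sequence R M xs \<longleftrightarrow>
    (\<forall>j<length xs. nonzerodivisor_mod M (ideal_smult R (Idl (set (take j xs))) M) (xs ! j)) \<and>
    ideal_smult R (Idl (set xs)) M \<noteq> carrier M"
proof -
  have "inj_on (\<lambda>m. (xs ! j) \<odot>\<^bsub>quot_module M K\<^esub> m) (carrier (quot_module M K)) \<longleftrightarrow> nonzerodivisor_mod M K (xs ! j)"
    if "j < length xs" "K = ideal_smult R (Idl (set (take j xs))) M" for j K
  proof -
    have "set (take j xs) \<subseteq> carrier R" using set_take_subset assms by fast
    moreover have "xs ! j \<in> carrier R" using assms that(1) by auto
    ultimately show ?thesis using inj_on_quot_smult_iff genideal_smult_submodule that(2) by blast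
  qed
  then show ?thesis unfolding regular_sequence_def Let_def using assms by simp
qed

end

text \<open>A multiplier that kills the generator \<open>y\<close> kills everything, so the support
  is decided at \<open>y\<close>, where the annihilator is \<open>I\<close>. The formulation by
  generator and annihilator covers both \<open>R/I\<close> and its copy over the type of
  \<open>fg_module\<close>.\<close>

lemma cyclic_module_fin_gen_Supp:
  fixes R :: "('a, 'r) ring_scheme" (structure) and N :: "('a, 'n) module"
  assumes N: "module R N" and y: "y \<in> carrier N"
    and gen: "\<And>z. z \<in> carrier N \<Longrightarrow> \<exists>c\<in>carrier R. z = c \<odot>\<^bsub>N\<^esub> y"
    and ann: "\<And>c. c \<in> carrier R \<Longrightarrow> c \<odot>\<^bsub>N\<^esub> y = \<zero>\<^bsub>N\<^esub> \<longleftrightarrow> c \<in> I" and I: "I \<subseteq> carrier R"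
  shows "fin_gen_module R N" "Supp R N = prime_vanishing R I"
proof -
  interpret N: plain_module R N using N by (simp add: plain_module_def)
  have "submodule_span R N {y} = carrier N"
  proof
    show "submodule_span R N {y} \<subseteq> carrier N" using y by (intro N.span_closed) auto
    have "submodule (submodule_span R N {y}) R N" using y by (intro N.span_submodule) auto
    then show "carrier N \<subseteq> submodule_span R N {y}"
      using gen N.submodule_memD(4) N.span_incl[of "{y}"] by fastforce
  qed
  then show "fin_gen_module R N" unfolding fin_gen_module_def
    using N y by (intro conjI exI[of _ "{y}"]) simp_all
  have "(\<exists>z\<in>carrier N. \<forall>u\<in>carrier R - P. u \<odot>\<^bsub>N\<^esub> z \<noteq> \<zero>\<^bsub>N\<^esub>) \<longleftrightarrow> I \<subseteq> P" for P
  proof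
    assume "\<exists>z\<in>carrier N. \<forall>u\<in>carrier R - P. u \<odot>\<^bsub>N\<^esub> z \<noteq> \<zero>\<^bsub>N\<^esub>"
    then obtain c where c: "c \<in> carrier R" "\<And>u. u \<in> carrier R - P \<Longrightarrow> u \<odot>\<^bsub>N\<^esub> (c \<odot>\<^bsub>N\<^esub> y) \<noteq> \<zero>\<^bsub>N\<^esub>"
      using gen by blast
    show "I \<subseteq> P"
    proof
      fix u assume u: "u \<in> I"
      then have "u \<odot>\<^bsub>N\<^esub> (c \<odot>\<^bsub>N\<^esub> y) = \<zero>\<^bsub>N\<^esub>" using N.smult_swap[of u c y] ann[of u] c(1) y I by auto
      then show "u \<in> P" using c(2) u I by blast
    qed
  next
    assume "I \<subseteq> P"
    then show "\<exists>z\<in>carrier N. \<forall>u\<in>carrier R - P. u \<odot>\<^bsub>N\<^esub> z \<noteq> \<zero>\<^bsub>N\<^esub>" using y ann by blast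
  qed
  note supp = this
  show "Supp R N = prime_vanishing R I"
    by (rule Set.set_eqI) (simp add: prime_vanishing_def N.Supp_iff supp)
qed

lemma (in cring) regular_module_module: "module R (regular_module R)"
proof (rule moduleI)
  show "cring R" by (rule is_cring)
  show "abelian_group (regular_module R)"
    by (rule abelian_groupI) (auto simp: regular_module_def a_ac intro: add.l_inv_ex)
qed (auto simp: regular_module_def l_distr r_distr m_assoc)

lemma (in cring) ring_quotient_cyclic:
  fixes I Q defines "Q \<equiv> quot_module (regular_module R) I"
  assumes I: "ideal I R"
  obtains y where "module R Q" "y \<in> carrier Q" "\<forall>z\<in>carrier Q. \<exists>c\<in>carrier R. z = c \<odot>\<^bsub>Q\<^esub> y"
    "\<forall>c\<in>carrier R. c \<odot>\<^bsub>Q\<^esub> y = \<zero>\<^bsub>Q\<^esub> \<longleftrightarrow> c \<in> I"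
proof -
  let ?M = "regular_module R"
  interpret M: plain_module R ?M using regular_module_module by (simp add: plain_module_def)
  have simps: "carrier ?M = carrier R" "\<And>a b. a \<odot>\<^bsub>?M\<^esub> b = a \<otimes> b" "\<And>a b. a \<oplus>\<^bsub>?M\<^esub> b = a \<oplus> b" "\<zero>\<^bsub>?M\<^esub> = \<zero>"
    unfolding regular_module_def by auto
  note D = ideal_memD[OF I]
  have K: "submodule I R ?M"
    by (rule M.submodule_memI) (use D in \<open>auto simp: simps\<close>)
  let ?y = "I +>\<^bsub>?M\<^esub> \<one>"
  have y: "?y \<in> carrier Q" unfolding Q_def M.quot_carrier by (simp add: simps)
  have smult: "c \<odot>\<^bsub>Q\<^esub> ?y = I +>\<^bsub>?M\<^esub> c" if c: "c \<in> carrier R" for c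
    using M.quot_smult[OF K c, of \<one>] c unfolding Q_def by (simp add: simps)
  have mod: "module R Q" unfolding Q_def by (rule M.quot_is_module[OF K])
  have gen: "\<forall>z\<in>carrier Q. \<exists>c\<in>carrier R. z = c \<odot>\<^bsub>Q\<^esub> ?y"
    using smult unfolding Q_def M.quot_carrier by (auto simp: simps)
  have ann: "c \<odot>\<^bsub>Q\<^esub> ?y = \<zero>\<^bsub>Q\<^esub> \<longleftrightarrow> c \<in> I" if c: "c \<in> carrier R" for c
  proof -
    interpret K: abelian_subgroup I ?M by (rule M.submodule_abelian_subgroup[OF K])
    have "\<zero>\<^bsub>Q\<^esub> = I +>\<^bsub>?M\<^esub> \<zero>\<^bsub>?M\<^esub>"
      unfolding Q_def quot_module_def using M.M.a_coset_add_zero[of I] K.a_subset by simp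
    then have "c \<odot>\<^bsub>Q\<^esub> ?y = \<zero>\<^bsub>Q\<^esub> \<longleftrightarrow> (\<exists>k\<in>I. c = k \<oplus> \<zero>)"
      using smult[OF c] M.coset_eq_iff[OF K, of c \<zero>] c by (simp add: simps)
    then show ?thesis using D(1) by auto
  qed
  then show thesis using that[OF mod y gen] by simp
qed

lemma (in cring) ring_quotient_fin_gen_Supp:
  assumes I: "ideal I R"
  shows "fin_gen_module R (quot_module (regular_module R) I)"
    "Supp R (quot_module (regular_module R) I) = prime_vanishing R I"
proof -
  let ?Q = "quot_module (regular_module R) I"
  obtain y where Q: "module R ?Q" and y: "y \<in> carrier ?Q" "\<forall>z\<in>carrier ?Q. \<exists>c\<in>carrier R. z = c \<odot>\<^bsub>?Q\<^esub> y"
    "\<forall>c\<in>carrier R. c \<odot>\<^bsub>?Q\<^esub> y = \<zero>\<^bsub>?Q\<^esub> \<longleftrightarrow> c \<in> I"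
    by (rule ring_quotient_cyclic[OF I])
  have "I \<subseteq> carrier R" using ideal_memD(1)[OF I] by auto
  from cyclic_module_fin_gen_Supp[OF Q y(1) bspec[OF y(2)] bspec[OF y(3)] this]
  show "fin_gen_module R ?Q" "Supp R ?Q = prime_vanishing R I" by simp_all
qed

text \<open>A copy of a module along an injection of element types. The second statement of the
  theorem uses \<open>R/I\<close> over the type \<open>'a set\<close>, whereas the first and third
  range over modules of type \<open>fg_module\<close>.\<close>

definition transport_module :: "('n \<Rightarrow> 'p) \<Rightarrow> ('a, 'n) module \<Rightarrow> ('a, 'p) module" where
  "transport_module f N =
     \<lparr>carrier = f ` carrier N, monoid.mult = undefined, one = undefined, ring.zero = f \<zero>\<^bsub>N\<^esub>,
      ring.add = (\<lambda>x y. f (inv_into (carrier N) f x \<oplus>\<^bsub>N\<^esub> inv_into (carrier N) f y)),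
      smult = (\<lambda>a x. f (a \<odot>\<^bsub>N\<^esub> inv_into (carrier N) f x))\<rparr>"

lemma transport_is_module:
  fixes R :: "('a, 'r) ring_scheme" (structure) and N :: "('a, 'n) module"
  assumes N: "module R N" and inj: "inj_on f (carrier N)"
  shows "module R (transport_module f N)"
proof -
  interpret N: plain_module R N using N by (simp add: plain_module_def)
  note [simp] = inv_into_f_f[OF inj]
  show ?thesis
  proof (rule moduleI)
    show "cring R" by (rule N.R.is_cring)
    show "abelian_group (transport_module f N)"
      by (rule abelian_groupI)
        (auto simp: transport_module_def N.M.a_ac intro!: bexI[of _ "\<ominus>\<^bsub>N\<^esub> _"] N.M.l_neg arg_cong[of _ _ f])
  qed (auto simp: transport_module_def N.smult_l_distr N.smult_r_distr N.smult_assoc1)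
qed

lemma (in cring) ring_quotient_fg_module:
  assumes I: "ideal I R"
  shows "\<exists>N :: 'a fg_module. fin_gen_module R N \<and> Supp R N = prime_vanishing R I"
proof -
  let ?Q = "quot_module (regular_module R) I"
  \<comment> \<open>Each coset of \<open>I\<close> becomes a set of lists of length one.\<close>
  let ?f = "(`) (\<lambda>r. [r]) :: 'a set \<Rightarrow> 'a list set"
  let ?N = "transport_module ?f ?Q"
  have inj: "inj ?f" by (rule inj_on_image) (simp add: inj_on_def)
  then have inj': "inj_on ?f (carrier ?Q)" by (rule inj_on_subset) simp
  obtain y where Q: "module R ?Q" and y: "y \<in> carrier ?Q" "\<forall>z\<in>carrier ?Q. \<exists>c\<in>carrier R. z = c \<odot>\<^bsub>?Q\<^esub> y"
    "\<forall>c\<in>carrier R. c \<odot>\<^bsub>?Q\<^esub> y = \<zero>\<^bsub>?Q\<^esub> \<longleftrightarrow> c \<in> I"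
    by (rule ring_quotient_cyclic[OF I])
  note N = transport_is_module[OF Q inj']
  have smult: "c \<odot>\<^bsub>?N\<^esub> ?f y = ?f (c \<odot>\<^bsub>?Q\<^esub> y)" if "c \<in> carrier R" for c
    unfolding transport_module_def using inv_into_f_f[OF inj' y(1)] by simp
  have gen: "\<exists>c\<in>carrier R. z = c \<odot>\<^bsub>?N\<^esub> ?f y" if z: "z \<in> carrier ?N" for z
  proof -
    obtain w where w: "w \<in> carrier ?Q" "z = ?f w" using z unfolding transport_module_def by auto
    obtain c where c: "c \<in> carrier R" "w = c \<odot>\<^bsub>?Q\<^esub> y" using bspec[OF y(2) w(1)] by blast
    have "z = c \<odot>\<^bsub>?N\<^esub> ?f y" unfolding smult[OF c(1)] w(2) c(2) ..
    then show ?thesis using c(1) by blast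
  qed
  have ann: "c \<odot>\<^bsub>?N\<^esub> ?f y = \<zero>\<^bsub>?N\<^esub> \<longleftrightarrow> c \<in> I" if "c \<in> carrier R" for c
  proof -
    have "c \<odot>\<^bsub>?N\<^esub> ?f y = \<zero>\<^bsub>?N\<^esub> \<longleftrightarrow> ?f (c \<odot>\<^bsub>?Q\<^esub> y) = ?f \<zero>\<^bsub>?Q\<^esub>"
      unfolding smult[OF that] by (simp add: transport_module_def)
    also have "\<dots> \<longleftrightarrow> c \<odot>\<^bsub>?Q\<^esub> y = \<zero>\<^bsub>?Q\<^esub>" using inj by (rule inj_eq)
    finally show ?thesis using bspec[OF y(3) that] by simp
  qed
  have "?f y \<in> carrier ?N" unfolding transport_module_def using y(1) by simp
  moreover have "I \<subseteq> carrier R" using ideal_memD(1)[OF I] by auto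
  ultimately have "fin_gen_module R ?N" "Supp R ?N = prime_vanishing R I"
    using cyclic_module_fin_gen_Supp[OF N _ gen ann] by simp_all
  then show ?thesis by blast
qed

section \<open>Resolutions by free modules of finite rank\<close>

text \<open>The \<open>Inl\<close> entries are dictated by the element type
  \<open>('a + 'n) list\<close> of \<open>chosen_resolution\<close>; vectors over \<open>R\<close>
  contain no \<open>Inr\<close> entries.\<close>

definition list_vec :: "nat \<Rightarrow> (nat \<Rightarrow> 'a) \<Rightarrow> ('a + 'n) list" where
  "list_vec k g = map (\<lambda>i. Inl (g i)) [0..<k]"

definition coord :: "('a + 'n) list \<Rightarrow> nat \<Rightarrow> 'a" where
  "coord xs i = projl (xs ! i)"

text \<open>The free module of rank \<open>k\<close> inside the element type of \<^const>\<open>chosen_resolution\<close>.\<close>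

definition free_rank :: "('a, 'r) ring_scheme \<Rightarrow> nat \<Rightarrow> ('a, ('a + 'n) list) module" where
  "free_rank R k =
     \<lparr>carrier = {xs. length xs = k \<and> (\<forall>i<k. xs ! i \<in> Inl ` carrier R)},
      monoid.mult = undefined, one = undefined,
      ring.zero = list_vec k (\<lambda>_. \<zero>\<^bsub>R\<^esub>),
      ring.add = (\<lambda>xs ys. list_vec k (\<lambda>i. coord xs i \<oplus>\<^bsub>R\<^esub> coord ys i)),
      smult = (\<lambda>a xs. list_vec k (\<lambda>i. a \<otimes>\<^bsub>R\<^esub> coord xs i))\<rparr>"

definition unit_vec :: "('a, 'r) ring_scheme \<Rightarrow> nat \<Rightarrow> nat \<Rightarrow> ('a + 'n) list" where
  "unit_vec R k j = list_vec k (\<lambda>i. if i = j then \<one>\<^bsub>R\<^esub> else \<zero>\<^bsub>R\<^esub>)"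

lemma coord_list_vec [simp]: "i < k \<Longrightarrow> coord (list_vec k g) i = g i"
  unfolding coord_def list_vec_def by simp

lemma list_vec_cong: "(\<And>i. i < k \<Longrightarrow> g i = h i) \<Longrightarrow> list_vec k g = list_vec k h"
  unfolding list_vec_def by auto

lemma list_vec_closed: "(\<And>i. i < k \<Longrightarrow> g i \<in> carrier R) \<Longrightarrow> list_vec k g \<in> carrier (free_rank R k)"
  unfolding free_rank_def list_vec_def by auto

lemma coord_closed: "xs \<in> carrier (free_rank R k) \<Longrightarrow> i < k \<Longrightarrow> coord xs i \<in> carrier R"
  unfolding free_rank_def coord_def by auto

lemma list_vec_coord: "xs \<in> carrier (free_rank R k) \<Longrightarrow> list_vec k (coord xs) = xs"
  unfolding free_rank_def list_vec_def coord_def by (auto intro!: nth_equalityI)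

lemma free_rank_eqI:
  fixes xs ys :: "('a + 'n) list"
  assumes "xs \<in> carrier (free_rank R k)" "ys \<in> carrier (free_rank R k)" "\<And>i. i < k \<Longrightarrow> coord xs i = coord ys i"
  shows "xs = ys"
proof -
  have "(list_vec k (coord xs) :: ('a + 'n) list) = list_vec k (coord ys)"
    by (rule list_vec_cong) (rule assms(3))
  then show ?thesis using list_vec_coord assms(1,2) by metis
qed

lemma free_rank_simps:
  "\<zero>\<^bsub>free_rank R k\<^esub> = list_vec k (\<lambda>_. \<zero>\<^bsub>R\<^esub>)"
  "xs \<oplus>\<^bsub>free_rank R k\<^esub> ys = list_vec k (\<lambda>i. coord xs i \<oplus>\<^bsub>R\<^esub> coord ys i)"
  "a \<odot>\<^bsub>free_rank R k\<^esub> xs = list_vec k (\<lambda>i. a \<otimes>\<^bsub>R\<^esub> coord xs i)"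
  unfolding free_rank_def by auto

context cring
begin

lemma free_rank_module: "module R (free_rank R k :: ('a, ('a + 'n) list) module)"
proof (rule moduleI)
  let ?F = "free_rank R k :: ('a, ('a + 'n) list) module"
  note [simp] = free_rank_simps and [intro] = list_vec_closed and c = coord_closed[of _ R k]
  show "cring R" by (rule is_cring)
  show "abelian_group ?F"
  proof (rule abelian_groupI)
    fix xs assume xs: "xs \<in> carrier ?F"
    have "list_vec k (\<lambda>i. \<ominus> coord xs i) \<oplus>\<^bsub>?F\<^esub> xs = \<zero>\<^bsub>?F\<^esub>"
      using c[OF xs] by (auto intro!: list_vec_cong simp: l_neg)
    then show "\<exists>ys\<in>carrier ?F. ys \<oplus>\<^bsub>?F\<^esub> xs = \<zero>\<^bsub>?F\<^esub>" using c[OF xs] by blast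
    show "\<zero>\<^bsub>?F\<^esub> \<oplus>\<^bsub>?F\<^esub> xs = xs"
      using xs c[OF xs] by (intro free_rank_eqI[of _ R k]) auto
  next
    fix xs ys zs assume *: "xs \<in> carrier ?F" "ys \<in> carrier ?F" "zs \<in> carrier ?F"
    show "(xs \<oplus>\<^bsub>?F\<^esub> ys) \<oplus>\<^bsub>?F\<^esub> zs = xs \<oplus>\<^bsub>?F\<^esub> (ys \<oplus>\<^bsub>?F\<^esub> zs)"
      using c[OF *(1)] c[OF *(2)] c[OF *(3)] by (auto intro!: list_vec_cong simp: a_assoc)
  next
    fix xs ys assume *: "xs \<in> carrier ?F" "ys \<in> carrier ?F"
    show "xs \<oplus>\<^bsub>?F\<^esub> ys \<in> carrier ?F" using c[OF *(1)] c[OF *(2)] by auto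
    show "xs \<oplus>\<^bsub>?F\<^esub> ys = ys \<oplus>\<^bsub>?F\<^esub> xs" using c[OF *(1)] c[OF *(2)] by (auto intro!: list_vec_cong simp: a_comm)
  qed auto
  show "a \<odot>\<^bsub>?F\<^esub> xs \<in> carrier ?F" if "a \<in> carrier R" "xs \<in> carrier ?F" for a xs
    using that c[OF that(2)] by auto
  show "(a \<oplus> b) \<odot>\<^bsub>?F\<^esub> xs = a \<odot>\<^bsub>?F\<^esub> xs \<oplus>\<^bsub>?F\<^esub> b \<odot>\<^bsub>?F\<^esub> xs"
    if "a \<in> carrier R" "b \<in> carrier R" "xs \<in> carrier ?F" for a b xs
    using that c[OF that(3)] by (auto intro!: list_vec_cong simp: l_distr)
  show "a \<odot>\<^bsub>?F\<^esub> (xs \<oplus>\<^bsub>?F\<^esub> ys) = a \<odot>\<^bsub>?F\<^esub> xs \<oplus>\<^bsub>?F\<^esub> a \<odot>\<^bsub>?F\<^esub> ys"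
    if "a \<in> carrier R" "xs \<in> carrier ?F" "ys \<in> carrier ?F" for a xs ys
    using that c[OF that(2)] c[OF that(3)] by (auto intro!: list_vec_cong simp: r_distr)
  show "(a \<otimes> b) \<odot>\<^bsub>?F\<^esub> xs = a \<odot>\<^bsub>?F\<^esub> (b \<odot>\<^bsub>?F\<^esub> xs)"
    if "a \<in> carrier R" "b \<in> carrier R" "xs \<in> carrier ?F" for a b xs
    using that c[OF that(3)] by (auto intro!: list_vec_cong simp: m_assoc)
  show "\<one> \<odot>\<^bsub>?F\<^esub> xs = xs" if "xs \<in> carrier ?F" for xs
    using that c[OF that] by (intro free_rank_eqI[of _ R k]) auto
qed

lemma unit_vec_closed: "unit_vec R k j \<in> carrier (free_rank R k :: ('a, ('a + 'n) list) module)"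
  unfolding unit_vec_def by (rule list_vec_closed) auto

lemma free_rank_span:
  "submodule_span R (free_rank R k) (unit_vec R k ` {..<k}) = carrier (free_rank R k :: ('a, ('a + 'n) list) module)"
    (is "submodule_span R ?F ?B = _")
proof
  interpret F: plain_module R ?F using free_rank_module by (simp add: plain_module_def)
  have B: "?B \<subseteq> carrier ?F" using unit_vec_closed by auto
  show "submodule_span R ?F ?B \<subseteq> carrier ?F" by (rule F.span_closed[OF B])
  note D = F.submodule_memD[OF F.span_submodule[OF B]]
  \<comment> \<open>Induction on a bound \<open>m\<close> from which on all coordinates vanish; each
    step splits off the last coordinate below the bound.\<close>
  have "xs \<in> submodule_span R ?F ?B"
    if "xs \<in> carrier ?F" "m \<le> k" "\<And>i. m \<le> i \<Longrightarrow> i < k \<Longrightarrow> coord xs i = \<zero>" for m xs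
    using that
  proof (induction m arbitrary: xs)
    case 0
    then have "xs = \<zero>\<^bsub>?F\<^esub>" by (intro free_rank_eqI[of _ R k]) (auto simp: free_rank_simps intro: list_vec_closed)
    then show ?case using D(2) by simp
  next
    case (Suc m)
    let ?ys = "list_vec k (\<lambda>i. if i = m then \<zero> else coord xs i) :: ('a + 'n) list"
    note c = coord_closed[OF Suc(2)]
    have ys: "?ys \<in> carrier ?F" using c by (intro list_vec_closed) auto
    have tail: "?ys \<in> submodule_span R ?F ?B"
      using ys Suc(3,4) by (intro Suc(1)) auto
    have head: "coord xs m \<odot>\<^bsub>?F\<^esub> unit_vec R k m \<in> submodule_span R ?F ?B"
    proof (rule D(4))
      show "coord xs m \<in> carrier R" using c Suc(3) by simp
      show "unit_vec R k m \<in> submodule_span R ?F ?B" using F.span_incl[of ?B] Suc(3) by auto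
    qed
    have eq: "xs = coord xs m \<odot>\<^bsub>?F\<^esub> unit_vec R k m \<oplus>\<^bsub>?F\<^esub> ?ys"
    proof (rule free_rank_eqI[OF Suc(2)])
      show "coord xs m \<odot>\<^bsub>?F\<^esub> unit_vec R k m \<oplus>\<^bsub>?F\<^esub> ?ys \<in> carrier ?F"
        using c Suc(3) ys unit_vec_closed by (intro F.M.a_closed F.smult_closed) auto
      show "coord xs i = coord (coord xs m \<odot>\<^bsub>?F\<^esub> unit_vec R k m \<oplus>\<^bsub>?F\<^esub> ?ys) i" if "i < k" for i
        using that c Suc(3) by (auto simp: free_rank_simps unit_vec_def)
    qed
    show ?case by (subst eq) (rule D(3)[OF head tail])
  qed
  from this[of _ k] show "carrier ?F \<subseteq> submodule_span R ?F ?B" by auto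
qed

text \<open>All terms of the combination other than that of the \<open>j\<close>-th unit vector lie
  in the submodule of vectors whose \<open>j\<close>-th coordinate is zero, so this coordinate of
  the sum is the coefficient in question.\<close>

lemma free_rank_basis: "module_basis R (free_rank R k :: ('a, ('a + 'n) list) module) (unit_vec R k ` {..<k})"
  unfolding module_basis_def
proof (intro conjI allI impI free_rank_span ballI)
  let ?F = "free_rank R k :: ('a, ('a + 'n) list) module" and ?B = "unit_vec R k ` {..<k} :: ('a + 'n) list set"
  interpret F: plain_module R ?F using free_rank_module by (simp add: plain_module_def)
  show "?B \<subseteq> carrier ?F" using unit_vec_closed by auto
  fix A c b
  assume "finite A \<and> A \<subseteq> ?B \<and> c \<in> A \<rightarrow> carrier R \<and> (\<Oplus>\<^bsub>?F\<^esub>b\<in>A. c b \<odot>\<^bsub>?F\<^esub> b) = \<zero>\<^bsub>?F\<^esub>" and b: "b \<in> A"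
  then have A: "finite A" "A \<subseteq> ?B" "\<And>b. b \<in> A \<Longrightarrow> c b \<in> carrier R" "(\<Oplus>\<^bsub>?F\<^esub>b\<in>A. c b \<odot>\<^bsub>?F\<^esub> b) = \<zero>\<^bsub>?F\<^esub>" by auto
  have AF: "A \<subseteq> carrier ?F" using A(2) unit_vec_closed by auto
  obtain j where j: "j < k" "b = unit_vec R k j" using A(2) b by auto
  let ?H = "{xs \<in> carrier ?F. coord xs j = \<zero>}"
  have "submodule ?H R ?F"
  proof (rule F.submodule_memI)
    show "\<zero>\<^bsub>?F\<^esub> \<in> ?H" using j F.M.zero_closed by (simp add: free_rank_simps)
    show "x \<oplus>\<^bsub>?F\<^esub> y \<in> ?H" if "x \<in> ?H" "y \<in> ?H" for x y
      using that j F.M.a_closed[of x y] by (simp add: free_rank_simps)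
    show "a \<odot>\<^bsub>?F\<^esub> x \<in> ?H" if "a \<in> carrier R" "x \<in> ?H" for a x
      using that j F.smult_closed[of a x] by (simp add: free_rank_simps)
  qed auto
  moreover have cf: "coeff_fun R (A - {b}) (\<lambda>x. if x \<in> A - {b} then c x else \<zero>)"
    using A by (auto simp: coeff_fun_def)
  moreover have "(\<lambda>x. x) \<in> A - {b} \<rightarrow> ?H"
  \<comment> \<open>Elements of \<open>A\<close> other than \<open>b\<close> have an index other
    than \<open>j\<close>. Over the zero ring all unit vectors coincide, and then
    \<open>A - {b}\<close> is empty.\<close>
  proof
    fix x assume x: "x \<in> A - {b}"
    then obtain i where "i < k" "x = unit_vec R k i" using A(2) by auto
    then show "x \<in> ?H" using x j AF by (auto simp: unit_vec_def)
  qed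
  ultimately have "comb ?F (\<lambda>x. x) (A - {b}) (\<lambda>x. if x \<in> A - {b} then c x else \<zero>) \<in> ?H"
    by (rule F.comb_in_submodule)
  moreover have "comb ?F (\<lambda>x. x) (A - {b}) (\<lambda>x. if x \<in> A - {b} then c x else \<zero>) = (\<Oplus>\<^bsub>?F\<^esub>x\<in>A - {b}. c x \<odot>\<^bsub>?F\<^esub> x)"
    unfolding comb_def using A(3) AF by (intro F.M.add.finprod_cong') (auto intro!: F.smult_closed)
  ultimately have rest: "(\<Oplus>\<^bsub>?F\<^esub>x\<in>A - {b}. c x \<odot>\<^bsub>?F\<^esub> x) \<in> ?H" by simp
  have "(\<Oplus>\<^bsub>?F\<^esub>x\<in>insert b (A - {b}). c x \<odot>\<^bsub>?F\<^esub> x) = c b \<odot>\<^bsub>?F\<^esub> b \<oplus>\<^bsub>?F\<^esub> (\<Oplus>\<^bsub>?F\<^esub>x\<in>A - {b}. c x \<odot>\<^bsub>?F\<^esub> x)"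
    using A b AF by (intro F.M.finsum_insert) (auto intro!: F.smult_closed)
  then have "c b \<odot>\<^bsub>?F\<^esub> b \<oplus>\<^bsub>?F\<^esub> (\<Oplus>\<^bsub>?F\<^esub>x\<in>A - {b}. c x \<odot>\<^bsub>?F\<^esub> x) = \<zero>\<^bsub>?F\<^esub>"
    using A(4) insert_Diff[OF b] by simp
  then have "coord (c b \<odot>\<^bsub>?F\<^esub> b \<oplus>\<^bsub>?F\<^esub> (\<Oplus>\<^bsub>?F\<^esub>x\<in>A - {b}. c x \<odot>\<^bsub>?F\<^esub> x)) j = \<zero>"
    using j by (simp add: free_rank_simps)
  then show "c b = \<zero>" using rest j A(3)[OF b] by (simp add: free_rank_simps unit_vec_def)
qed

lemma free_rank_free: "free_module R (free_rank R k :: ('a, ('a + 'n) list) module)"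
  unfolding free_module_def using free_rank_module free_rank_basis by blast

lemma free_rank_fin_gen: "fin_gen_module R (free_rank R k :: ('a, ('a + 'n) list) module)"
  unfolding fin_gen_module_def using free_rank_module free_rank_span unit_vec_closed
  by (intro conjI exI[of _ "unit_vec R k ` {..<k}"]) auto

end

lemma (in plain_module) ex_free_cover:
  assumes "Y \<subseteq> carrier M" "finite Y"
  shows "\<exists>k h. h \<in> mod_homs R (free_rank R k :: ('a, ('a + 'n) list) module) M \<and>
    h ` carrier (free_rank R k :: ('a, ('a + 'n) list) module) = submodule_span R M Y"
proof -
  obtain ys where ys: "set ys = Y" using finite_list[OF assms(2)] by auto
  define k where "k = length ys"
  let ?F = "free_rank R k :: ('a, ('a + 'n) list) module"
  interpret F: plain_module R ?F using R.free_rank_module by (simp add: plain_module_def)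
  \<comment> \<open>Coordinates are continued by zero beyond \<open>k\<close>, as
    \<open>coeff_fun\<close> demands.\<close>
  define c where "c xs i = (if i < k then coord xs i else \<zero>)" for xs :: "('a + 'n) list" and i
  define h where "h xs = comb M ((!) ys) {..<k} (c xs)" for xs
  have ysM: "(!) ys \<in> {..<k} \<rightarrow> carrier M" using assms(1) ys unfolding k_def by auto
  have ysS: "(!) ys \<in> {..<k} \<rightarrow> submodule_span R M Y" using span_incl[of Y] ys unfolding k_def by auto
  have cf: "coeff_fun R {..<k} (c xs)" if "xs \<in> carrier ?F" for xs
    using coord_closed[OF that] unfolding coeff_fun_def c_def by auto
  have h: "linear_map R ?F M h"
    unfolding linear_map_def
  proof (intro conjI ballI)
    show "h \<in> carrier ?F \<rightarrow> carrier M" unfolding h_def using comb_closed[OF cf ysM] by auto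
    show "h (xs \<oplus>\<^bsub>?F\<^esub> zs) = h xs \<oplus>\<^bsub>M\<^esub> h zs" if "xs \<in> carrier ?F" "zs \<in> carrier ?F" for xs zs
    proof -
      have "c (xs \<oplus>\<^bsub>?F\<^esub> zs) = (\<lambda>i. c xs i \<oplus> c zs i)" unfolding c_def by (auto simp: free_rank_simps)
      then show ?thesis unfolding h_def using comb_add[OF cf[OF that(1)] cf[OF that(2)] ysM] by simp
    qed
    show "h (a \<odot>\<^bsub>?F\<^esub> xs) = a \<odot>\<^bsub>M\<^esub> h xs" if "a \<in> carrier R" "xs \<in> carrier ?F" for a xs
    proof -
      have "c (a \<odot>\<^bsub>?F\<^esub> xs) = (\<lambda>i. a \<otimes> c xs i)" unfolding c_def using that(1) by (auto simp: free_rank_simps)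
      then show ?thesis unfolding h_def using comb_smult[OF cf[OF that(2)] that(1) ysM] by simp
    qed
  qed
  note hD = linear_mapD[OF h]
  have "h ` carrier ?F = submodule_span R M Y"
  proof
    show "h ` carrier ?F \<subseteq> submodule_span R M Y"
      using comb_in_submodule[OF span_submodule[OF assms(1)] cf ysS] unfolding h_def by auto
    have "submodule (h ` carrier ?F) R M"
    proof (rule submodule_memI)
      show "h ` carrier ?F \<subseteq> carrier M" using hD(1) by auto
      show "\<zero>\<^bsub>M\<^esub> \<in> h ` carrier ?F"
        using linear_map_zero[OF F.module_axioms module_axioms h] F.M.zero_closed by (metis imageI)
      show "a \<oplus>\<^bsub>M\<^esub> b \<in> h ` carrier ?F" if "a \<in> h ` carrier ?F" "b \<in> h ` carrier ?F" for a b
      proof -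
        obtain x y where "x \<in> carrier ?F" "y \<in> carrier ?F" "a = h x" "b = h y" using \<open>a \<in> _\<close> \<open>b \<in> _\<close> by auto
        then show ?thesis using hD(2) by (intro image_eqI[of _ _ "x \<oplus>\<^bsub>?F\<^esub> y"]) auto
      qed
      show "r \<odot>\<^bsub>M\<^esub> b \<in> h ` carrier ?F" if "r \<in> carrier R" "b \<in> h ` carrier ?F" for r b
      proof -
        obtain y where "y \<in> carrier ?F" "b = h y" using \<open>b \<in> _\<close> by auto
        then show ?thesis using hD(3) \<open>r \<in> _\<close> by (intro image_eqI[of _ _ "r \<odot>\<^bsub>?F\<^esub> y"]) auto
      qed
    qed
    moreover have "Y \<subseteq> h ` carrier ?F"
    proof
      fix y assume "y \<in> Y"
      then obtain j where j: "j < k" "y = ys ! j" using ys unfolding k_def by (metis in_set_conv_nth)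
      let ?u = "unit_vec R k j :: ('a + 'n) list"
      have yM: "ys ! j \<in> carrier M" using ysM j by auto
      have u: "coeff_fun R {j} (c ?u)" unfolding coeff_fun_def c_def using j by (auto simp: unit_vec_def)
      have "h ?u = comb M ((!) ys) {j} (c ?u)"
        unfolding h_def using comb_mono[OF u _ _ ysM] j by simp
      also have "\<dots> = y" using comb_single[OF u, of "(!) ys"] yM j by (simp add: c_def unit_vec_def)
      finally show "y \<in> h ` carrier ?F" using R.unit_vec_closed by (metis imageI)
    qed
    ultimately show "submodule_span R M Y \<subseteq> h ` carrier ?F" by (rule span_minimal)
  qed
  moreover have "restrict h (carrier ?F) \<in> mod_homs R ?F M"
    using restrict_mod_homs[OF F.module_axioms h] .
  moreover have "restrict h (carrier ?F) ` carrier ?F = h ` carrier ?F" by simp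
  ultimately show ?thesis by metis
qed

lemma kernel_submodule:
  assumes "module R N" "module R M" "linear_map R N M h"
  shows "submodule {x \<in> carrier N. h x = \<zero>\<^bsub>M\<^esub>} R N"
proof -
  interpret N: plain_module R N using assms(1) by (simp add: plain_module_def)
  interpret M: plain_module R M using assms(2) by (simp add: plain_module_def)
  note hD = linear_mapD[OF assms(3)]
  show ?thesis
    by (rule N.submodule_memI) (auto simp: hD linear_map_zero[OF assms])
qed

text \<open>The kernel is a submodule of a free module of finite rank, hence finitely generated, and
  can be covered by another free module of finite rank.\<close>

lemma (in noetherian_module) ex_kernel_cover:
  fixes h :: "('a + 'n) list \<Rightarrow> 'm"
  assumes h: "h \<in> mod_homs R (free_rank R k) M"
  shows "\<exists>l q. q \<in> mod_homs R (free_rank R l :: ('a, ('a + 'n) list) module) (free_rank R k :: ('a, ('a + 'n) list) module) \<and>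
    q ` carrier (free_rank R l) = {x \<in> carrier (free_rank R k). h x = \<zero>\<^bsub>M\<^esub>}"
proof -
  let ?F = "free_rank R k :: ('a, ('a + 'n) list) module"
  interpret F: noetherian_module R ?F
    using R.free_rank_module noetherian_ring_axioms by (simp add: noetherian_module_def plain_module_def)
  have "submodule {x \<in> carrier ?F. h x = \<zero>\<^bsub>M\<^esub>} R ?F"
    using h mod_homs_iff by (intro kernel_submodule[OF F.module_axioms module_axioms]) blast
  then obtain Y where Y: "Y \<subseteq> {x \<in> carrier ?F. h x = \<zero>\<^bsub>M\<^esub>}" "finite Y"
    "submodule_span R ?F Y = {x \<in> carrier ?F. h x = \<zero>\<^bsub>M\<^esub>}"
    using F.submodule_fin_gen[OF R.free_rank_fin_gen] by blast
  then have "Y \<subseteq> carrier ?F" by blast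
  from F.ex_free_cover[OF this Y(2)] show ?thesis unfolding Y(3) by blast
qed

lemma (in noetherian_module) ex_free_resolution:
  assumes fg: "fin_gen_module R M"
  shows "\<exists>(F :: nat \<Rightarrow> ('a, ('a + 'm) list) module) d e. free_resolution R F d e M"
proof -
  let ?F = "\<lambda>k. free_rank R k :: ('a, ('a + 'm) list) module"
  obtain Y where "Y \<subseteq> carrier M" "finite Y" "submodule_span R M Y = carrier M"
    using fg unfolding fin_gen_module_def by auto
  then obtain k0 e where e: "e \<in> mod_homs R (?F k0) M" "e ` carrier (?F k0) = carrier M"
    using ex_free_cover[of Y] by metis
  \<comment> \<open>A state \<open>(k, l, h)\<close> of the dependent choice is a differential
    \<open>h\<close> from rank \<open>l\<close> to rank \<open>k\<close>. State 0 must map onto the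
    kernel of the augmentation, and \<open>Q\<close> makes each later differential map onto the
    kernel of its predecessor.\<close>
  define P where "P n s \<longleftrightarrow> (case s of (k, l, h) \<Rightarrow> h \<in> mod_homs R (?F l) (?F k) \<and>
     (n = 0 \<longrightarrow> k = k0 \<and> h ` carrier (?F l) = {x \<in> carrier (?F k). e x = \<zero>\<^bsub>M\<^esub>}))" for n :: nat and s
  define Q where "Q s t \<longleftrightarrow> (case s of (k, l, h) \<Rightarrow> case t of (k', l', h') \<Rightarrow>
     k' = l \<and> h' ` carrier (?F l') = {x \<in> carrier (?F l). h x = \<zero>\<^bsub>?F k\<^esub>})" for s t
  have "\<exists>f. \<forall>n. P n (f n) \<and> Q (f n) (f (Suc n))"
  proof (rule dependent_nat_choice)
    show "\<exists>s. P 0 s" unfolding P_def using ex_kernel_cover[OF e(1)] by auto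
    fix s :: "nat \<times> nat \<times> (('a + 'm) list \<Rightarrow> ('a + 'm) list)" and n assume "P n s"
    then obtain k l h where s: "s = (k, l, h)" "h \<in> mod_homs R (?F l) (?F k)" unfolding P_def by (cases s) auto
    interpret F: noetherian_module R "?F k"
      using R.free_rank_module noetherian_ring_axioms by (simp add: noetherian_module_def plain_module_def)
    obtain l' h' where "h' \<in> mod_homs R (?F l') (?F l)" "h' ` carrier (?F l') = {x \<in> carrier (?F l). h x = \<zero>\<^bsub>?F k\<^esub>}"
    proof -
      obtain Y where Y: "Y \<subseteq> {x \<in> carrier (?F l). h x = \<zero>\<^bsub>?F k\<^esub>}" "finite Y"
        "submodule_span R (?F l) Y = {x \<in> carrier (?F l). h x = \<zero>\<^bsub>?F k\<^esub>}"
      proof -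
        interpret L: noetherian_module R "?F l"
          using R.free_rank_module noetherian_ring_axioms by (simp add: noetherian_module_def plain_module_def)
        have "submodule {x \<in> carrier (?F l). h x = \<zero>\<^bsub>?F k\<^esub>} R (?F l)"
          using s(2) mod_homs_iff by (intro kernel_submodule[OF L.module_axioms F.module_axioms]) blast
        then show ?thesis using L.submodule_fin_gen[OF R.free_rank_fin_gen] that by blast
      qed
      interpret L: plain_module R "?F l" using R.free_rank_module by (simp add: plain_module_def)
      have "Y \<subseteq> carrier (?F l)" using Y(1) by blast
      from L.ex_free_cover[OF this Y(2)] show ?thesis unfolding Y(3) using that by blast
    qed
    then show "\<exists>t. P (Suc n) t \<and> Q s t" unfolding P_def Q_def s(1) by (intro exI[of _ "(l, l', h')"]) simp
  qed
  then obtain f where f: "\<And>n. P n (f n)" "\<And>n. Q (f n) (f (Suc n))" by blast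
  define k where "k n = fst (f n)" for n
  define d where "d n = snd (snd (f n))" for n
  have next_k: "fst (snd (f n)) = k (Suc n)" for n
    using f(2)[of n] unfolding Q_def k_def by (auto split: prod.splits)
  have f_eq: "f n = (k n, k (Suc n), d n)" for n using next_k[of n] unfolding k_def d_def by (metis prod.collapse)
  have d: "d n \<in> mod_homs R (?F (k (Suc n))) (?F (k n))" for n
    using f(1)[of n] unfolding P_def f_eq by simp
  have d0: "k 0 = k0" "d 0 ` carrier (?F (k 1)) = {x \<in> carrier (?F (k 0)). e x = \<zero>\<^bsub>M\<^esub>}"
    using f(1)[of 0] unfolding P_def f_eq by simp_all
  have dS: "d (Suc n) ` carrier (?F (k (Suc (Suc n)))) = {x \<in> carrier (?F (k (Suc n))). d n x = \<zero>\<^bsub>?F (k n)\<^esub>}" for n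
    using f(2)[of n] unfolding Q_def f_eq by simp
  have "free_resolution R (\<lambda>n. ?F (k n)) d e M"
    unfolding free_resolution_def using d d0 dS e by (simp add: R.free_rank_free)
  then show ?thesis by blast
qed

section \<open>Ext and regular sequences\<close>

lemma (in noetherian_module) chosen_resolution_free_resolution:
  assumes "fin_gen_module R M" "chosen_resolution R M = (F, d)"
  shows "\<exists>e. free_resolution R F d e M"
proof -
  have "\<exists>s :: (nat \<Rightarrow> ('a, ('a + 'm) list) module) \<times> (nat \<Rightarrow> ('a + 'm) list \<Rightarrow> ('a + 'm) list).
      (case s of (F, d) \<Rightarrow> \<exists>e. free_resolution R F d e M)"
    using ex_free_resolution[OF assms(1)] by auto
  then have "case chosen_resolution R M of (F, d) \<Rightarrow> \<exists>e. free_resolution R F d e M"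
    unfolding chosen_resolution_def by (rule someI_ex)
  then show ?thesis using assms(2) by simp
qed

text \<open>Here \<open>C\<close> will be the record of cocycles, obtained from
  \<open>hom_module\<close> by replacing the carrier. The hypotheses are the closure properties of
  \<open>B\<close> that decide when a coset equals \<open>B\<close>, with \<open>z\<close> acting as
  zero.\<close>

lemma zero_quot_module_iff:
  assumes B: "z \<in> B" "B \<subseteq> carrier C" and zero: "\<And>a. a \<in> carrier C \<Longrightarrow> z \<oplus>\<^bsub>C\<^esub> a = a"
    and add: "\<And>a b. a \<in> B \<Longrightarrow> b \<in> B \<Longrightarrow> a \<oplus>\<^bsub>C\<^esub> b \<in> B"
    and diff: "\<And>a b. a \<in> B \<Longrightarrow> b \<in> B \<Longrightarrow> \<exists>c\<in>B. b = c \<oplus>\<^bsub>C\<^esub> a"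
  shows "zero_module (quot_module C B) \<longleftrightarrow> carrier C \<subseteq> B"
proof -
  have coset: "B +>\<^bsub>C\<^esub> a = B \<longleftrightarrow> a \<in> B" if a: "a \<in> carrier C" for a
  proof
    assume "B +>\<^bsub>C\<^esub> a = B"
    moreover have "z \<oplus>\<^bsub>C\<^esub> a \<in> B +>\<^bsub>C\<^esub> a" unfolding a_r_coset_def' using B by blast
    ultimately show "a \<in> B" using zero[OF a] by simp
  next
    assume "a \<in> B"
    then show "B +>\<^bsub>C\<^esub> a = B" unfolding a_r_coset_def' using add diff by fastforce
  qed
  have "zero_module (quot_module C B) \<longleftrightarrow> (\<lambda>a. B +>\<^bsub>C\<^esub> a) ` carrier C = {B}"
    unfolding zero_module_def quot_module_def A_RCOSETS_def' by (simp add: UNION_singleton_eq_range)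
  also have "\<dots> \<longleftrightarrow> (\<forall>a\<in>carrier C. B +>\<^bsub>C\<^esub> a = B)" using B by blast
  also have "\<dots> \<longleftrightarrow> carrier C \<subseteq> B" using coset by blast
  finally show ?thesis .
qed

section \<open>Comparison of \<open>hom_cohomology\<close> with \<open>vanishing\<close>\<close>

context resolution_coeffs
begin

lemma cocycles_iff:
  "f \<in> cocycles R F d M i \<longleftrightarrow> f \<in> mod_homs R (F i) M \<and> cocycle_mod {\<zero>\<^bsub>M\<^esub>} i f"
proof -
  have "compose (carrier (F (Suc i))) f (d i) = (\<lambda>x\<in>carrier (F (Suc i)). \<zero>\<^bsub>M\<^esub>) \<longleftrightarrow>
      (\<forall>z\<in>carrier (F (Suc i)). f (d i z) = \<zero>\<^bsub>M\<^esub>)"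
    by (auto simp: compose_def fun_eq_iff)
  then show ?thesis unfolding cocycles_def cocycle_mod_def hom_module_def mod_homs_iff by auto
qed

lemma coboundaries_iff: "f \<in> coboundaries R F d M i \<longleftrightarrow> f \<in> mod_homs R (F i) M \<and> bnd i f"
proof (cases i)
  case 0
  have "bnd 0 f \<and> f \<in> mod_homs R (F 0) M \<longleftrightarrow> f = (\<lambda>x\<in>carrier (F 0). \<zero>\<^bsub>M\<^esub>)"
  proof
    assume "bnd 0 f \<and> f \<in> mod_homs R (F 0) M"
    then show "f = (\<lambda>x\<in>carrier (F 0). \<zero>\<^bsub>M\<^esub>)"
      unfolding bnd_def mod_homs_iff by (intro extensionalityI[of _ "carrier (F 0)"]) auto
  next
    assume f: "f = (\<lambda>x\<in>carrier (F 0). \<zero>\<^bsub>M\<^esub>)"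
    then have "f \<in> mod_homs R (F 0) M"
      using restrict_mod_homs[OF F_module linear_map_const_zero[OF module_axioms]] by simp
    then show "bnd 0 f \<and> f \<in> mod_homs R (F 0) M" unfolding bnd_def mod_homs_iff using f by simp
  qed
  then show ?thesis using 0 by (auto simp: hom_module_def)
next
  case (Suc j)
  show ?thesis
  proof
    assume "f \<in> coboundaries R F d M i"
    then obtain g where g: "linear_map R (F j) M g" "f = restrict (\<lambda>z. g (d j z)) (carrier (F i))"
      using Suc by (auto simp: mod_homs_iff compose_def)
    have "linear_map R (F i) M (\<lambda>z. g (d j z))" using linear_map_comp[OF d_linear g(1)] Suc by simp
    then have "f \<in> mod_homs R (F i) M" unfolding g(2) by (rule restrict_mod_homs[OF F_module])
    moreover have "\<forall>z\<in>carrier (F i). f z = g (d j z)" unfolding g(2) by simp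
    ultimately show "f \<in> mod_homs R (F i) M \<and> bnd i f"
      unfolding bnd_def mod_homs_iff using Suc g(1) by auto
  next
    assume f: "f \<in> mod_homs R (F i) M \<and> bnd i f"
    then obtain g where g: "linear_map R (F j) M g" "\<And>z. z \<in> carrier (F (Suc j)) \<Longrightarrow> f z = g (d j z)"
      using Suc bnd_SucE by metis
    have "f = compose (carrier (F (Suc j))) (restrict g (carrier (F j))) (d j)"
      using f Suc g(2) d_closed
      by (intro extensionalityI[of _ "carrier (F (Suc j))"]) (auto simp: mod_homs_iff compose_def)
    then show "f \<in> coboundaries R F d M i" using Suc restrict_mod_homs[OF F_module g(1)] by auto
  qed
qed

lemma bnd_cong:
  assumes "bnd i b" "\<And>z. z \<in> carrier (F i) \<Longrightarrow> f z = b z" "linear_map R (F i) M f"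
  shows "bnd i f"
  using assms unfolding bnd_def by (cases i) auto

lemma bnd_add: "bnd i a \<Longrightarrow> bnd i b \<Longrightarrow> bnd i (\<lambda>z. a z \<oplus>\<^bsub>M\<^esub> b z)"
proof (cases i)
  case 0
  assume "bnd i a" "bnd i b"
  then show ?thesis unfolding bnd_def using 0 by (simp add: linear_map_add[OF module_axioms])
next
  case (Suc j)
  assume ab: "bnd i a" "bnd i b"
  obtain g h where gh: "linear_map R (F j) M g" "linear_map R (F j) M h"
    "\<And>z. z \<in> carrier (F (Suc j)) \<Longrightarrow> a z = g (d j z)" "\<And>z. z \<in> carrier (F (Suc j)) \<Longrightarrow> b z = h (d j z)"
    using ab Suc bnd_SucE by metis
  show ?thesis
    unfolding Suc
    by (rule bnd_cong[OF bnd_SucI[OF linear_map_add[OF module_axioms gh(1,2)]]])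
      (use gh(3,4) linear_map_add[OF module_axioms bnd_linear[OF ab(1)] bnd_linear[OF ab(2)]] Suc in auto)
qed

lemma bnd_smult: "bnd i a \<Longrightarrow> r \<in> carrier R \<Longrightarrow> bnd i (\<lambda>z. r \<odot>\<^bsub>M\<^esub> a z)"
proof (cases i)
  case 0
  assume "bnd i a" "r \<in> carrier R"
  then show ?thesis unfolding bnd_def using 0 by (simp add: linear_map_smult[OF module_axioms])
next
  case (Suc j)
  assume a: "bnd i a" and r: "r \<in> carrier R"
  obtain g where g: "linear_map R (F j) M g" "\<And>z. z \<in> carrier (F (Suc j)) \<Longrightarrow> a z = g (d j z)"
    using a Suc bnd_SucE by metis
  show ?thesis
    unfolding Suc
    by (rule bnd_cong[OF bnd_SucI[OF linear_map_smult[OF module_axioms g(1) r]]])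
      (use g(2) linear_map_smult[OF module_axioms bnd_linear[OF a] r] Suc in auto)
qed

lemma vanishing_zero_iff:
  "vanishing {\<zero>\<^bsub>M\<^esub>} i \<longleftrightarrow> cocycles R F d M i \<subseteq> coboundaries R F d M i"
proof
  assume van: "vanishing {\<zero>\<^bsub>M\<^esub>} i"
  show "cocycles R F d M i \<subseteq> coboundaries R F d M i"
  proof
    fix f assume "f \<in> cocycles R F d M i"
    then have f: "f \<in> mod_homs R (F i) M" "cocycle_mod {\<zero>\<^bsub>M\<^esub>} i f" using cocycles_iff by auto
    then obtain b where b: "bnd i b" "\<And>z. z \<in> carrier (F i) \<Longrightarrow> f z = b z \<oplus>\<^bsub>M\<^esub> \<zero>\<^bsub>M\<^esub>"
      using van unfolding vanishing_def coboundary_mod_def by blast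
    have fb: "f z = b z" if "z \<in> carrier (F i)" for z
      using b(2)[OF that] linear_mapD(1)[OF bnd_linear[OF b(1)] that] by simp
    have "linear_map R (F i) M f" using f(1) mod_homs_iff by metis
    from bnd_cong[OF b(1) fb this] show "f \<in> coboundaries R F d M i" using f(1) coboundaries_iff by simp
  qed
next
  assume sub: "cocycles R F d M i \<subseteq> coboundaries R F d M i"
  show "vanishing {\<zero>\<^bsub>M\<^esub>} i" unfolding vanishing_def
  proof (intro allI impI)
    fix f assume f: "cocycle_mod {\<zero>\<^bsub>M\<^esub>} i f"
    let ?f = "restrict f (carrier (F i))"
    have fl: "linear_map R (F i) M f" using f unfolding cocycle_mod_def by simp
    have f': "?f \<in> mod_homs R (F i) M" by (rule restrict_mod_homs[OF F_module fl])
    moreover have "cocycle_mod {\<zero>\<^bsub>M\<^esub>} i ?f"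
      using f f' d_closed unfolding cocycle_mod_def mod_homs_iff by simp
    ultimately have "bnd i ?f" using sub cocycles_iff coboundaries_iff by auto
    moreover have "f z = ?f z \<oplus>\<^bsub>M\<^esub> \<zero>\<^bsub>M\<^esub>" if "z \<in> carrier (F i)" for z
      using that linear_mapD(1)[OF fl that] by simp
    ultimately show "coboundary_mod {\<zero>\<^bsub>M\<^esub>} i f" unfolding coboundary_mod_def by blast
  qed
qed

lemma zero_hom_cohomology_iff: "zero_module (hom_cohomology R F d M i) \<longleftrightarrow> vanishing {\<zero>\<^bsub>M\<^esub>} i"
proof -
  let ?B = "coboundaries R F d M i"
  let ?C = "(hom_module R (F i) M)\<lparr>carrier := cocycles R F d M i\<rparr>"
  let ?z = "\<lambda>x\<in>carrier (F i). \<zero>\<^bsub>M\<^esub>"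
  have add: "a \<oplus>\<^bsub>?C\<^esub> b = (\<lambda>x\<in>carrier (F i). a x \<oplus>\<^bsub>M\<^esub> b x)" for a b unfolding hom_module_def by simp
  have B: "linear_map R (F i) M a" "bnd i a" "a \<in> extensional (carrier (F i))" if "a \<in> ?B" for a
    using that unfolding coboundaries_iff mod_homs_iff by auto
  have restrict_B: "restrict b (carrier (F i)) \<in> ?B" if b: "bnd i b" for b
  proof -
    have h: "restrict b (carrier (F i)) \<in> mod_homs R (F i) M" by (rule restrict_mod_homs[OF F_module bnd_linear[OF b]])
    then show ?thesis unfolding coboundaries_iff using bnd_cong[OF b] by (simp add: mod_homs_iff)
  qed
  have zB: "?z \<in> ?B"
  proof -
    have "bnd i (\<lambda>_. \<zero>\<^bsub>M\<^esub>)"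
    proof (cases i)
      case 0 then show ?thesis unfolding bnd_def using linear_map_const_zero[OF module_axioms] by simp
    next
      case (Suc j) then show ?thesis using bnd_SucI[OF linear_map_const_zero[OF module_axioms]] by simp
    qed
    then show ?thesis by (rule restrict_B)
  qed
  have BC: "?B \<subseteq> cocycles R F d M i"
    by (auto simp: cocycles_iff coboundaries_iff cocycle_mod_def bnd_d bnd_linear)
  have "zero_module (quot_module ?C ?B) \<longleftrightarrow> carrier ?C \<subseteq> ?B"
  proof (rule zero_quot_module_iff[OF zB])
    show "?B \<subseteq> carrier ?C" using BC by simp
    show "?z \<oplus>\<^bsub>?C\<^esub> a = a" if "a \<in> carrier ?C" for a
      unfolding add using that linear_mapD(1)[of R "F i" M a]
      by (intro extensionalityI[of _ "carrier (F i)"]) (auto simp: cocycles_iff mod_homs_iff)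
    show "a \<oplus>\<^bsub>?C\<^esub> b \<in> ?B" if "a \<in> ?B" "b \<in> ?B" for a b
      unfolding add using restrict_B[OF bnd_add[OF B(2) B(2)]] that by simp
    show "\<exists>c\<in>?B. b = c \<oplus>\<^bsub>?C\<^esub> a" if ab: "a \<in> ?B" "b \<in> ?B" for a b
    proof (rule bexI)
      \<comment> \<open>The difference \<open>b - a\<close>, with the sign written as a scalar so
        that \<open>bnd_smult\<close> applies.\<close>
      let ?c = "\<lambda>x\<in>carrier (F i). b x \<oplus>\<^bsub>M\<^esub> (\<ominus> \<one>) \<odot>\<^bsub>M\<^esub> a x"
      show "?c \<in> ?B" using restrict_B[OF bnd_add[OF B(2) bnd_smult[OF B(2)]]] ab by simp
      show "b = ?c \<oplus>\<^bsub>?C\<^esub> a" unfolding add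
        using B(3)[OF ab(2)] linear_mapD(1)[OF B(1)[OF ab(1)]] linear_mapD(1)[OF B(1)[OF ab(2)]]
        by (intro extensionalityI[of _ "carrier (F i)"]) (auto simp: smult_l_minus M.a_assoc M.l_neg)
    qed
  qed
  then show ?thesis unfolding hom_cohomology_def vanishing_zero_iff by simp
qed

end

text \<open>The single passage from \<open>Ext\<close> to \<open>vanishing\<close>: the existence of
  a resolution guarantees that the chosen one is exact, and \<open>K\<close> is the zero
  submodule.\<close>

lemma Ext_resolution_coeffs:
  fixes R :: "('a, 'r) ring_scheme" (structure) and M :: "('a, 'm) module" and N :: "('a, 'n) module"
  assumes "cring R" "noetherian_ring R" "module R M" "fin_gen_module R N"
  obtains F :: "nat \<Rightarrow> ('a, ('a + 'n) list) module" and d e where "resolution_coeffs R M N F d e"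
    "\<forall>i. zero_module (Ext R i N M) \<longleftrightarrow> resolution_coeffs.vanishing R M F d {\<zero>\<^bsub>M\<^esub>} i"
proof -
  have N: "module R N" using assms(4) unfolding fin_gen_module_def by blast
  interpret N: noetherian_module R N
    using N assms(2) by (simp add: noetherian_module_def plain_module_def)
  obtain F d where Fd: "chosen_resolution R N = (F, d)" by fastforce
  then obtain e where e: "free_resolution R F d e N"
    using N.chosen_resolution_free_resolution[OF assms(4)] by blast
  interpret resolution_coeffs R M N F d e
    using assms(3) e N by (simp add: resolution_coeffs_def resolution_coeffs_axioms_def plain_module_def)
  have "zero_module (Ext R i N M) \<longleftrightarrow> vanishing {\<zero>\<^bsub>M\<^esub>} i" for i
    unfolding Ext_def Fd using zero_hom_cohomology_iff by simp
  then show thesis using that[OF resolution_coeffs_axioms] by simp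
qed

section \<open>Induction along a regular sequence\<close>

context resolution_coeffs
begin

text \<open>Degree \<open>i\<close> after \<open>j\<close> elements follows from degree
  \<open>i - 1\<close> after \<open>j + 1\<close> elements, as the next element is a nonzerodivisor
  and some power of it kills \<open>N\<close>. The sum \<open>i + j\<close> is constant along this
  descent, so a next element is always available.\<close>

lemma vanishing_of_regular_sequence:
  assumes noeth: "noetherian_ring R" and I: "ideal I R" and fg: "fin_gen_module R N"
    and supp: "Supp R N \<subseteq> prime_vanishing R I"
    and xs: "set xs \<subseteq> I" "regular_sequence R M xs" and ij: "i + j < length xs"
  shows "vanishing (ideal_smult R (Idl (set (take j xs))) M) i"
  using ij
proof (induction i arbitrary: j)
  interpret N: noetherian_module R N
    using N_module noeth by (simp add: noetherian_module_def plain_module_def)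
  have xsR: "set xs \<subseteq> carrier R" using xs(1) R.ideal_memD(1)[OF I] by auto
  let ?K = "\<lambda>j. ideal_smult R (Idl (set (take j xs))) M"
  have step: "vanishing (?K j) i"
    if j: "j < length xs" and prev: "\<And>l. i = Suc l \<Longrightarrow> vanishing (?K (Suc j)) l" for i j
  proof -
    have xI: "xs ! j \<in> I" using xs(1) j by auto
    then have xR: "xs ! j \<in> carrier R" using R.ideal_memD(1)[OF I] by blast
    have tR: "set (take j xs) \<subseteq> carrier R" using set_take_subset xsR by fast
    have "set (take (Suc j) xs) = insert (xs ! j) (set (take j xs))"
      using j by (simp add: take_Suc_conv_app_nth)
    then have KS: "?K (Suc j) = plus_multiples M (?K j) (xs ! j)"
      using ideal_smult_insert[OF tR xR] by simp
    have nzd: "nonzerodivisor_mod M (?K j) (xs ! j)" using regular_sequence_iff[OF xsR] xs(2) j by blast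
    obtain k :: nat where k: "\<And>y. y \<in> carrier N \<Longrightarrow> (xs ! j [^] k) \<odot>\<^bsub>N\<^esub> y = \<zero>\<^bsub>N\<^esub>"
      using N.power_annihilates[OF fg supp I xI] by blast
    show ?thesis
      using vanishing_of_nonzerodivisor[OF genideal_smult_submodule[OF tR] xR nzd _ k] prev KS by simp
  qed
  {
    case 0
    then show ?case by (auto intro!: step)
  next
    case (Suc i)
    have "vanishing (?K (Suc j)) i" using Suc by simp
    then show ?case using Suc.prems by (auto intro: step)
  }
qed

text \<open>The sequence grows by one element at a time while the range of vanishing degrees shrinks
  by one; this range must be part of the induction claim, as each choice of an element depends on
  degree 0.\<close>

lemma ex_regular_sequence:
  assumes noeth: "noetherian_ring R" and I: "ideal I R" and fgM: "fin_gen_module R M" and fg: "fin_gen_module R N"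
    and supp: "Supp R N = prime_vanishing R I"
    and van: "\<And>i. i < n \<Longrightarrow> vanishing {\<zero>\<^bsub>M\<^esub>} i"
  shows "j \<le> n \<Longrightarrow> \<exists>xs. length xs = j \<and> set xs \<subseteq> I \<and>
    (\<forall>l<j. nonzerodivisor_mod M (ideal_smult R (Idl (set (take l xs))) M) (xs ! l)) \<and>
    (\<forall>i. i + j < n \<longrightarrow> vanishing (ideal_smult R (Idl (set xs)) M) i)"
proof (induction j)
  case 0
  then show ?case using van ideal_smult_empty by auto
next
  case (Suc j)
  interpret M: noetherian_module R M
    using noeth module_axioms by (simp add: noetherian_module_def plain_module_def)
  obtain xs where xs: "length xs = j" "set xs \<subseteq> I"
    "\<And>l. l < j \<Longrightarrow> nonzerodivisor_mod M (ideal_smult R (Idl (set (take l xs))) M) (xs ! l)"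
    "\<And>i. i + j < n \<Longrightarrow> vanishing (ideal_smult R (Idl (set xs)) M) i" using Suc by auto
  let ?K = "ideal_smult R (Idl (set xs)) M"
  have xsR: "set xs \<subseteq> carrier R" using xs(2) R.ideal_memD(1)[OF I] by auto
  note K = genideal_smult_submodule[OF xsR]
  obtain x where x: "x \<in> I" "nonzerodivisor_mod M ?K x"
  proof (rule ccontr)
    assume no: "\<not> thesis"
    then have "\<And>x. x \<in> I \<Longrightarrow> \<not> nonzerodivisor_mod M ?K x" using that by blast
    then obtain m where m: "m \<in> carrier M - ?K" "primeideal (colon_mod R M ?K m) R" "I \<subseteq> colon_mod R M ?K m"
      using M.associated_prime_of_zerodivisors[OF fgM K I] by blast
    \<comment> \<open>Equality of supports enters here: every prime above \<open>I\<close> has to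
      lie in the support of \<open>N\<close>.\<close>
    then have "colon_mod R M ?K m \<in> Supp R N" unfolding supp prime_vanishing_def by simp
    then have "\<not> vanishing ?K 0" by (rule not_vanishing_0[OF noeth fg K m(1)])
    \<comment> \<open>Degree 0 is still in the range because \<open>Suc j \<le> n\<close>.\<close>
    then show False using xs(4)[of 0] Suc.prems by simp
  qed
  have xR: "x \<in> carrier R" using R.ideal_memD(1)[OF I x(1)] .
  have "nonzerodivisor_mod M (ideal_smult R (Idl (set (take l (xs @ [x])))) M) ((xs @ [x]) ! l)" if "l < Suc j" for l
    using that xs(1,3) x(2) by (cases "l = j") (auto simp: nth_append)
  \<comment> \<open>Degrees \<open>i\<close> and \<open>i + 1\<close> for \<open>K\<close> give
    degree \<open>i\<close> for \<open>K + xM\<close>.\<close>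
  moreover have "vanishing (ideal_smult R (Idl (set (xs @ [x]))) M) i" if "i + Suc j < n" for i
    using vanishing_plus_multiples[OF K xR x(2) xs(4) xs(4), of i] ideal_smult_insert[OF xsR xR] that by simp
  ultimately show ?case using xs(1,2) x(1) by (intro exI[of _ "xs @ [x]"]) auto
qed

end

lemma Ext_vanishes_of_regular_sequence:
  fixes R :: "('a, 'r) ring_scheme" (structure) and M :: "('a, 'm) module" and N :: "('a, 'n) module"
  assumes "cring R" "noetherian_ring R" "fin_gen_module R M" "ideal I R"
    and "set xs \<subseteq> I" "regular_sequence R M xs"
    and "fin_gen_module R N" "Supp R N \<subseteq> prime_vanishing R I" "i < length xs"
  shows "zero_module (Ext R i N M)"
proof -
  have M: "module R M" using assms(3) unfolding fin_gen_module_def by blast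
  obtain F :: "nat \<Rightarrow> ('a, ('a + 'n) list) module" and d e where "resolution_coeffs R M N F d e"
    and Ext: "\<forall>i. zero_module (Ext R i N M) \<longleftrightarrow> resolution_coeffs.vanishing R M F d {\<zero>\<^bsub>M\<^esub>} i"
    by (rule Ext_resolution_coeffs[OF assms(1,2) M assms(7)])
  interpret resolution_coeffs R M N F d e by fact
  have "vanishing {\<zero>\<^bsub>M\<^esub>} i"
    using vanishing_of_regular_sequence[OF assms(2,4,7,8,5,6), of i 0] assms(9) ideal_smult_empty by simp
  then show ?thesis using Ext by simp
qed

lemma regular_sequence_of_Ext_vanishing:
  fixes R :: "('a, 'r) ring_scheme" (structure) and M :: "('a, 'm) module" and N :: "('a, 'n) module"
  assumes "cring R" "noetherian_ring R" "fin_gen_module R M" "ideal I R" "ideal_smult R I M \<noteq> carrier M"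
    and "fin_gen_module R N" "Supp R N = prime_vanishing R I" "\<And>i. i < n \<Longrightarrow> zero_module (Ext R i N M)"
  shows "\<exists>xs. length xs = n \<and> set xs \<subseteq> I \<and> regular_sequence R M xs"
proof -
  have M: "module R M" using assms(3) unfolding fin_gen_module_def by blast
  obtain F :: "nat \<Rightarrow> ('a, ('a + 'n) list) module" and d e where "resolution_coeffs R M N F d e"
    and Ext: "\<forall>i. zero_module (Ext R i N M) \<longleftrightarrow> resolution_coeffs.vanishing R M F d {\<zero>\<^bsub>M\<^esub>} i"
    by (rule Ext_resolution_coeffs[OF assms(1,2) M assms(6)])
  interpret resolution_coeffs R M N F d e by fact
  have "\<And>i. i < n \<Longrightarrow> vanishing {\<zero>\<^bsub>M\<^esub>} i" using assms(8) Ext by simp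
  then obtain xs where xs: "length xs = n" "set xs \<subseteq> I"
    "\<forall>l<n. nonzerodivisor_mod M (ideal_smult R (Idl (set (take l xs))) M) (xs ! l)"
    using ex_regular_sequence[OF assms(2,4,3,6,7), of n n] by auto
  have IR: "I \<subseteq> carrier R" using R.ideal_memD(1)[OF assms(4)] by auto
  \<comment> \<open>The last clause of regularity comes from \<open>IM \<noteq> M\<close>, as the
    elements of the sequence generate an ideal inside \<open>I\<close>.\<close>
  have "Idl (set xs) \<subseteq> I" using xs(2) assms(4) by (intro R.genideal_minimal)
  then have "ideal_smult R (Idl (set xs)) M \<subseteq> ideal_smult R I M" by (rule ideal_smult_mono)
  moreover have "ideal_smult R I M \<subseteq> carrier M" using submodule_memD(1)[OF ideal_smult_submodule[OF IR]] by auto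
  ultimately have "ideal_smult R (Idl (set xs)) M \<noteq> carrier M" using assms(5) by auto
  moreover have "set xs \<subseteq> carrier R" using xs(2) IR by auto
  ultimately have "regular_sequence R M xs" using regular_sequence_iff xs(1,3) by simp
  then show ?thesis using xs(1,2) by blast
qed

theorem theorem3p1:
  fixes R :: "('a, 'r) ring_scheme" and M :: "('a, 'm) module" and I :: "'a set" and n :: nat
  assumes "cring R" and "noetherian_ring R"
    and "fin_gen_module R M"
    and "ideal I R"
    and "ideal_smult R I M \<noteq> carrier M"
    and "n > 0"
  shows
    "let S1 = (\<forall>N :: 'a fg_module. fin_gen_module R N \<and> Supp R N \<subseteq> prime_vanishing R I \<longrightarrow>
                 (\<forall>i<n. zero_module (Ext R i N M)));
         S2 = (\<forall>i<n. zero_module (Ext R i (quot_module (regular_module R) I) M));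
         S3 = (\<exists>N :: 'a fg_module. fin_gen_module R N \<and> Supp R N = prime_vanishing R I \<and>
                 (\<forall>i<n. zero_module (Ext R i N M)));
         S4 = (\<exists>xs. length xs = n \<and> set xs \<subseteq> I \<and> regular_sequence R M xs);
         \<comment> \<open>the first and third statement for modules over an arbitrary type: passing to
             \<open>fg_module\<close> loses nothing\<close>
         S1_any = (\<forall>N :: ('a, 'n) module. fin_gen_module R N \<and> Supp R N \<subseteq> prime_vanishing R I \<longrightarrow>
                 (\<forall>i<n. zero_module (Ext R i N M)));
         S3_any = (\<exists>N :: ('a, 'n) module. fin_gen_module R N \<and> Supp R N = prime_vanishing R I \<and>
                 (\<forall>i<n. zero_module (Ext R i N M)))
     in (S1 \<longleftrightarrow> S2) \<and> (S2 \<longleftrightarrow> S3) \<and> (S3 \<longleftrightarrow> S4) \<and> (S1 \<longrightarrow> S1_any) \<and> (S3_any \<longrightarrow> S3)"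
proof -
  let ?Q = "quot_module (regular_module R) I"
  define S1 where "S1 \<longleftrightarrow> (\<forall>N :: 'a fg_module. fin_gen_module R N \<and> Supp R N \<subseteq> prime_vanishing R I \<longrightarrow>
     (\<forall>i<n. zero_module (Ext R i N M)))"
  define S2 where "S2 \<longleftrightarrow> (\<forall>i<n. zero_module (Ext R i ?Q M))"
  define S3 where "S3 \<longleftrightarrow> (\<exists>N :: 'a fg_module. fin_gen_module R N \<and> Supp R N = prime_vanishing R I \<and>
     (\<forall>i<n. zero_module (Ext R i N M)))"
  define S4 where "S4 \<longleftrightarrow> (\<exists>xs. length xs = n \<and> set xs \<subseteq> I \<and> regular_sequence R M xs)"
  define S1_any where "S1_any \<longleftrightarrow> (\<forall>N :: ('a, 'n) module. fin_gen_module R N \<and> Supp R N \<subseteq> prime_vanishing R I \<longrightarrow>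
     (\<forall>i<n. zero_module (Ext R i N M)))"
  define S3_any where "S3_any \<longleftrightarrow> (\<exists>N :: ('a, 'n) module. fin_gen_module R N \<and> Supp R N = prime_vanishing R I \<and>
     (\<forall>i<n. zero_module (Ext R i N M)))"
  note to_Ext = Ext_vanishes_of_regular_sequence[OF assms(1-4)]
  note to_seq = regular_sequence_of_Ext_vanishing[OF assms(1-5)]
  note Q = cring.ring_quotient_fin_gen_Supp[OF assms(1,4)]
  obtain N0 :: "'a fg_module" where N0: "fin_gen_module R N0" "Supp R N0 = prime_vanishing R I"
    using cring.ring_quotient_fg_module[OF assms(1,4)] by blast
  \<comment> \<open>All implications pass through \<open>S4\<close>, which mentions no module
    \<open>N\<close>. The lemmas leading to and from it hold for every element type of
    \<open>N\<close>, and so they also yield \<open>S1_any\<close> and handle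
    \<open>S3_any\<close>.\<close>
  have "S1" if S4 using that unfolding S4_def S1_def by (auto intro: to_Ext)
  moreover have "S1_any" if S4 using that unfolding S4_def S1_any_def by (auto intro: to_Ext)
  moreover have "S2" if S4 using that unfolding S4_def S2_def by (auto intro: to_Ext Q simp: Q)
  moreover have "S3" if S1 using that N0 unfolding S1_def S3_def by (intro exI[of _ N0]) simp
  moreover have "S4" if S2 using that unfolding S4_def S2_def by (intro to_seq[OF Q]) simp
  moreover have "S4" if S3
  proof -
    obtain N :: "'a fg_module" where N: "fin_gen_module R N" "Supp R N = prime_vanishing R I"
      "\<forall>i<n. zero_module (Ext R i N M)"
      using \<open>S3\<close> unfolding S3_def by blast
    show S4 unfolding S4_def by (rule to_seq[OF N(1,2)]) (simp add: N(3))
  qed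
  moreover have "S4" if S3_any
  proof -
    obtain N :: "('a, 'n) module" where N: "fin_gen_module R N" "Supp R N = prime_vanishing R I"
      "\<forall>i<n. zero_module (Ext R i N M)"
      using \<open>S3_any\<close> unfolding S3_any_def by blast
    show S4 unfolding S4_def by (rule to_seq[OF N(1,2)]) (simp add: N(3))
  qed
  ultimately have "(S1 \<longleftrightarrow> S2) \<and> (S2 \<longleftrightarrow> S3) \<and> (S3 \<longleftrightarrow> S4) \<and> (S1 \<longrightarrow> S1_any) \<and> (S3_any \<longrightarrow> S3)" by blast
  then show ?thesis unfolding Let_def S1_def S2_def S3_def S4_def S1_any_def S3_any_def .
qed

end
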